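(* Fix a target tree $T\in\mathcal T_n$ and an integer $k\ge1$. (i) Let $\delta_1,\dots,\delta_k$ be pairwise distinct displays of $T$ in a common host $U\in\mathcal T_m$. Contract every edge of $U$ whose endpoints lie in the same contraction block in each of the $k$ displays. The resulting quotient tree has at most $k(n-1)+1$ vertices. (ii) Let $\mathfrak C_k(T)$ be the set of isomorphism classes of ordered survivor-decorated $k$-cores for $T$ whose underlying tree has at most $k(n-1)+1$ vertices. Then $\mathfrak C_k(T)$ is finite, and for every $m$ the number $k!\,C_k(T;m)$ of trees in $\mathcal T_m$ equipped with an ordered $k$-tuple of pairwise distinct displays of $T$ satisfies $$k!\,C_k(T;m)=\sum_{[\Omega]\in\mathfrak C_k(T)}\frac{L_m^{\mathrm{rig}}(\Omega)}{|\operatorname{Aut}(\Omega)|}.$$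
   Context: $[m]=\{1,\dots,m\}$, and $\mathcal T_m$ is the set of trees with vertex set $[m]$ (labeled trees). Displays. Let $T\in\mathcal T_n$, $U\in\mathcal T_m$. A display of $T$ in $U$ is a pair $\delta=(R,q)$ where $R=\{r_1<\cdots<r_n\}\subseteq[m]$ is an $n$-element set (the survivors) and $q:[m]\to R$ is a retraction ($q(r)=r$ for $r\in R$) such that (1) every fiber $q^{-1}(r_i)$ induces a connected subtree of $U$; (2) after each fiber is contracted to one vertex, the quotient tree, with the vertex coming from $q^{-1}(r_i)$ labeled $i$, is equal to $T$. The fibers of $q$ are the contraction blocks. $c_T(U)$ is the number of displays of $T$ in $U$, and $C_k(T;m)=\sum_{U\in\mathcal T_m}\binom{c_T(U)}{k}$. Decorated cores. Let $\mathcal M_{k,n}=[k]\times[n]$ (the mark $(a,j)$ stands for the survivor representing target vertex $j$ in display $a$). An ordered survivor-decorated $k$-core for $T\in\mathcal T_n$ is a tuple $\Omega=(H,\varphi_1,\dots,\varphi_k,\mathcal P,\beta)$, where $H$ is a finite tree (the underlying tree), such that: (C1) for every $a\in[k]$, $\varphi_a:V(H)\to[n]$ is a surjection whose fibers induce connected subtrees of $H$ and such that contracting each fiber $\varphi_a^{-1}(j)$ to a vertex labeled $j$ yields $T$; (C2) for every edge $xy\in E(H)$ there is $a$ with $\varphi_a(x)\ne\varphi_a(y)$; (S1) $\mathcal P$ is a partition of the set $\mathcal M_{k,n}$ (marks in the same class stand for equal survivors, marks in different classes for different survivors); (S2) $\beta:\mathcal P\to V(H)$ is a map such that, writing $C_{a,j}\in\mathcal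 P$ for the class containing $(a,j)$, $\varphi_a(\beta(C_{a,j}))=j$ for all $(a,j)$; (S3) for each $a$ the classes $C_{a,1},\dots,C_{a,n}$ are distinct, and the transitive closure of the relations $C_{a,1}<C_{a,2}<\cdots<C_{a,n}$ ($a\in[k]$) on $\mathcal P$ is acyclic; (D) if $a\ne b$, then either $\varphi_a\ne\varphi_b$ or $C_{a,j}\ne C_{b,j}$ for some $j\in[n]$. Two decorated cores $\Omega=(H,\varphi_1,\dots,\varphi_k,\mathcal P,\beta)$ and $\Omega'=(H',\varphi'_1,\dots,\varphi'_k,\mathcal P,\beta')$ with the same partition $\mathcal P$ are isomorphic if there is a tree isomorphism $g:H\to H'$ with $\varphi'_a\circ g=\varphi_a$ for all $a\in[k]$ and $g(\beta(C))=\beta'(C)$ for all $C\in\mathcal P$ (cores with different partitions are not isomorphic). $\operatorname{Aut}(\Omega)$ is the group of $g\in\operatorname{Aut}(H)$ with $\varphi_a\circ g=\varphi_a$ for all $a$ and $g(\beta(C))=\beta(C)$ for all $C\in\mathcal P$. Lift counts. For a family $B=(B_x)_{x\in V(H)}$ of nonempty pairwise disjoint sets with union $[m]$, let $N_\Omega(B)$ be the number of injections $\theta:\mathcal P\hookrightarrow[m]$ such that $\theta(C)\in B_{\beta(C)}$ for every $C\in\mathcal P$ and $\theta(C_{a,1})<\cdots<\theta(C_{a,n})$ for every $a\in[k]$. Define $$L_m^{\mathrm{rig}}(\Omega)=\sum_{\substack{[m]=\bigsqcup_{x\in V(H)}B_x\\ B_x\ne\varnothing}}N_\Omega(B)\prod_{x\in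 V(H)}|B_x|^{|B_x|-2+d_H(x)},$$ where the sum is over families of blocks indexed by $V(H)$, $d_H(x)$ is the degree of $x$ in $H$, and powers of $1$ equal $1$. *)

theory Defs
  imports Complex_Main "HOL-Library.FuncSet" "HOL-Library.Disjoint_Sets"
begin

section \<open>Graphs and trees\<close>

datatype 'v graph = Graph (verts: "'v set") (edges: "'v set set")

definition simple_graph :: "'v graph \<Rightarrow> bool" where
  "simple_graph G \<longleftrightarrow>
     finite (verts G) \<and> edges G \<subseteq> {{x, y} | x y. x \<in> verts G \<and> y \<in> verts G \<and> x \<noteq> y}"

definition adj :: "'v set set \<Rightarrow> 'v rel" where
  "adj E = {(x, y). {x, y} \<in> E}"

definition connected_graph :: "'v graph \<Rightarrow> bool" where
  "connected_graph G \<longleftrightarrow>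
     verts G \<noteq> {} \<and> (\<forall>x \<in> verts G. \<forall>y \<in> verts G. (x, y) \<in> (adj (edges G))\<^sup>*)"

definition is_cycle :: "'v graph \<Rightarrow> 'v list \<Rightarrow> bool" where
  "is_cycle G xs \<longleftrightarrow>
     length xs \<ge> 3 \<and> distinct xs \<and>
     (\<forall>i < length xs. {xs ! i, xs ! (Suc i mod length xs)} \<in> edges G)"

definition is_tree :: "'v graph \<Rightarrow> bool" where
  "is_tree G \<longleftrightarrow> simple_graph G \<and> connected_graph G \<and> (\<nexists>xs. is_cycle G xs)"

definition degree :: "'v graph \<Rightarrow> 'v \<Rightarrow> nat" where
  "degree G x = card {e \<in> edges G. x \<in> e}"

definition induced :: "'v graph \<Rightarrow> 'v set \<Rightarrow> 'v graph" where
  "induced G S = Graph S {e \<in> edges G. e \<subseteq> S}"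

definition graph_iso :: "('v \<Rightarrow> 'w) \<Rightarrow> 'v graph \<Rightarrow> 'w graph \<Rightarrow> bool" where
  "graph_iso g G G' \<longleftrightarrow> bij_betw g (verts G) (verts G') \<and> (`) g ` edges G = edges G'"

definition labeled_trees :: "nat \<Rightarrow> nat graph set" where
  "labeled_trees m = {U. is_tree U \<and> verts U = {1..m}}"


section \<open>Contractions\<close>

text \<open>Every fiber of \<^term>\<open>f\<close> becomes one vertex, named by the value of \<^term>\<open>f\<close>;
  an edge inside a fiber (whose image is a singleton) disappears.\<close>

definition quotient_graph :: "('v \<Rightarrow> 'w) \<Rightarrow> 'v graph \<Rightarrow> 'w graph" where
  "quotient_graph f G = Graph (f ` verts G) {f ` e | e. e \<in> edges G \<and> card (f ` e) = 2}"

definition contracts_onto :: "('v \<Rightarrow> 'w) \<Rightarrow> 'v graph \<Rightarrow> 'w graph \<Rightarrow> bool" where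
  "contracts_onto f G T \<longleftrightarrow>
     f ` verts G = verts T \<and>
     (\<forall>j \<in> verts T. connected_graph (induced G {x \<in> verts G. f x = j})) \<and>
     quotient_graph f G = T"

text \<open>Contraction of the edges in \<^term>\<open>F\<close>: the vertices of the result are the connected
  components of the graph with the vertices of \<^term>\<open>G\<close> and the edge set \<^term>\<open>F\<close>.\<close>

definition contract_edges :: "'v graph \<Rightarrow> 'v set set \<Rightarrow> 'v set graph" where
  "contract_edges G F = quotient_graph (\<lambda>x. {y \<in> verts G. (x, y) \<in> (adj F)\<^sup>*}) G"


section \<open>Displays\<close>

text \<open>The position of \<^term>\<open>r\<close> in \<^term>\<open>R\<close>: if \<open>R = {r\<^sub>1 < \<dots> < r\<^sub>n}\<close>,
  then \<open>rank_in R r\<^sub>i = i\<close>.\<close>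

definition rank_in :: "nat set \<Rightarrow> nat \<Rightarrow> nat" where
  "rank_in R r = card {s \<in> R. s \<le> r}"

text \<open>The retraction of a display is extensional (that is, \<open>undefined\<close> outside of \<open>[m]\<close>), so
  that equality of HOL pairs is equality of displays.\<close>

definition displays :: "nat \<Rightarrow> nat \<Rightarrow> nat graph \<Rightarrow> nat graph \<Rightarrow> (nat set \<times> (nat \<Rightarrow> nat)) set" where
  "displays n m T U =
     {(R, q). R \<subseteq> {1..m} \<and> card R = n \<and>
              q \<in> {1..m} \<rightarrow>\<^sub>E R \<and> (\<forall>r \<in> R. q r = r) \<and>
              (\<forall>r \<in> R. connected_graph (induced U {x \<in> {1..m}. q x = r})) \<and>
              quotient_graph (\<lambda>x. rank_in R (q x)) U = T}"

definition display_count :: "nat \<Rightarrow> nat \<Rightarrow> nat graph \<Rightarrow> nat graph \<Rightarrow> nat" where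
  "display_count n m T U = card (displays n m T U)"

definition Ck :: "nat \<Rightarrow> nat \<Rightarrow> nat graph \<Rightarrow> nat \<Rightarrow> nat" where
  "Ck k n T m = (\<Sum>U \<in> labeled_trees m. display_count n m T U choose k)"

definition display_tuples ::
  "nat \<Rightarrow> nat \<Rightarrow> nat \<Rightarrow> nat graph \<Rightarrow> nat graph \<Rightarrow> (nat \<Rightarrow> nat set \<times> (nat \<Rightarrow> nat)) set" where
  "display_tuples k n m T U = {\<delta> \<in> {1..k} \<rightarrow>\<^sub>E displays n m T U. inj_on \<delta> {1..k}}"

definition common_block_edges ::
  "nat \<Rightarrow> nat graph \<Rightarrow> (nat \<Rightarrow> nat set \<times> (nat \<Rightarrow> nat)) \<Rightarrow> nat set set" where
  "common_block_edges k U \<delta> =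
     {{x, y} | x y. {x, y} \<in> edges U \<and> (\<forall>a \<in> {1..k}. snd (\<delta> a) x = snd (\<delta> a) y)}"


section \<open>Survivor-decorated cores\<close>

type_synonym mark = "nat \<times> nat"

datatype 'v core =
  Core (underlying: "'v graph")
       (proj: "nat \<Rightarrow> 'v \<Rightarrow> nat")
       (mark_partition: "mark set set")
       (place: "mark set \<Rightarrow> 'v")

definition class_of :: "mark set set \<Rightarrow> nat \<Rightarrow> nat \<Rightarrow> mark set" where
  "class_of P a j = (THE C. C \<in> P \<and> (a, j) \<in> C)"

definition class_order :: "nat \<Rightarrow> nat \<Rightarrow> mark set set \<Rightarrow> mark set rel" where
  "class_order k n P =
     {(class_of P a j, class_of P a (Suc j)) | a j. a \<in> {1..k} \<and> j \<in> {1..<n}}"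

text \<open>All functions are extensional, so that the inequality \<open>\<phi> a \<noteq> \<phi> b\<close> of HOL functions below is
  the inequality of maps on the vertex set.\<close>

definition is_core :: "nat \<Rightarrow> nat \<Rightarrow> nat graph \<Rightarrow> 'v core \<Rightarrow> bool" where
  "is_core k n T \<Omega> \<longleftrightarrow>
     (let H = underlying \<Omega>; \<phi> = proj \<Omega>; P = mark_partition \<Omega>; \<beta> = place \<Omega> in
      is_tree H \<and>
      \<phi> \<in> {1..k} \<rightarrow>\<^sub>E (verts H \<rightarrow>\<^sub>E {1..n}) \<and> (\<forall>a \<in> {1..k}. contracts_onto (\<phi> a) H T) \<and>
      (\<forall>x y. {x, y} \<in> edges H \<longrightarrow> (\<exists>a \<in> {1..k}. \<phi> a x \<noteq> \<phi> a y)) \<and>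
      partition_on ({1..k} \<times> {1..n}) P \<and>
      \<beta> \<in> P \<rightarrow>\<^sub>E verts H \<and> (\<forall>a \<in> {1..k}. \<forall>j \<in> {1..n}. \<phi> a (\<beta> (class_of P a j)) = j) \<and>
      (\<forall>a \<in> {1..k}. inj_on (class_of P a) {1..n}) \<and> acyclic (class_order k n P) \<and>
      (\<forall>a \<in> {1..k}. \<forall>b \<in> {1..k}. a \<noteq> b \<longrightarrow>
         \<phi> a \<noteq> \<phi> b \<or> (\<exists>j \<in> {1..n}. class_of P a j \<noteq> class_of P b j)))"

definition core_iso :: "nat \<Rightarrow> ('v \<Rightarrow> 'w) \<Rightarrow> 'v core \<Rightarrow> 'w core \<Rightarrow> bool" where
  "core_iso k g \<Omega> \<Omega>' \<longleftrightarrow>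
     mark_partition \<Omega> = mark_partition \<Omega>' \<and>
     graph_iso g (underlying \<Omega>) (underlying \<Omega>') \<and>
     (\<forall>a \<in> {1..k}. \<forall>x \<in> verts (underlying \<Omega>). proj \<Omega>' a (g x) = proj \<Omega> a x) \<and>
     (\<forall>C \<in> mark_partition \<Omega>. g (place \<Omega> C) = place \<Omega>' C)"

definition core_aut :: "nat \<Rightarrow> 'v core \<Rightarrow> ('v \<Rightarrow> 'v) set" where
  "core_aut k \<Omega> = {g \<in> extensional (verts (underlying \<Omega>)). core_iso k g \<Omega> \<Omega>}"

text \<open>Every finite tree has an isomorphic copy with vertices in \<^typ>\<open>nat\<close>, so the
  isomorphism classes of cores are represented by the cores on \<^typ>\<open>nat\<close>.\<close>

definition small_cores :: "nat \<Rightarrow> nat \<Rightarrow> nat graph \<Rightarrow> nat core set" where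
  "small_cores k n T =
     {\<Omega>. is_core k n T \<Omega> \<and> card (verts (underlying \<Omega>)) \<le> k * (n - 1) + 1}"

definition isomorphic_cores :: "nat \<Rightarrow> nat \<Rightarrow> nat graph \<Rightarrow> nat core rel" where
  "isomorphic_cores k n T =
     {(\<Omega>, \<Omega>'). \<Omega> \<in> small_cores k n T \<and> \<Omega>' \<in> small_cores k n T \<and> (\<exists>g. core_iso k g \<Omega> \<Omega>')}"

definition core_classes :: "nat \<Rightarrow> nat \<Rightarrow> nat graph \<Rightarrow> nat core set set" where
  "core_classes k n T = small_cores k n T // isomorphic_cores k n T"


section \<open>Lift counts\<close>

definition block_families :: "'v set \<Rightarrow> nat \<Rightarrow> ('v \<Rightarrow> nat set) set" where
  "block_families V m =
     {B \<in> V \<rightarrow>\<^sub>E Pow {1..m}. (\<forall>x \<in> V. B x \<noteq> {}) \<and> disjoint_family_on B V \<and> (\<Union>x \<in> V. B x) = {1..m}}"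

definition lift_count :: "nat \<Rightarrow> nat \<Rightarrow> nat \<Rightarrow> 'v core \<Rightarrow> ('v \<Rightarrow> nat set) \<Rightarrow> nat" where
  "lift_count k n m \<Omega> B =
     (let P = mark_partition \<Omega> in
      card {\<theta> \<in> P \<rightarrow>\<^sub>E {1..m}. inj_on \<theta> P \<and> (\<forall>C \<in> P. \<theta> C \<in> B (place \<Omega> C)) \<and>
              (\<forall>a \<in> {1..k}. strict_mono_on {1..n} (\<lambda>j. \<theta> (class_of P a j)))})"

text \<open>The exponent is an integer: it equals \<open>-1\<close> for a block of size 1 at an isolated vertex.\<close>

definition L_rig :: "nat \<Rightarrow> nat \<Rightarrow> nat \<Rightarrow> 'v core \<Rightarrow> real" where
  "L_rig k n m \<Omega> =
     (let H = underlying \<Omega> in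
      \<Sum>B \<in> block_families (verts H) m.
        real (lift_count k n m \<Omega> B) *
        (\<Prod>x \<in> verts H. real (card (B x)) powi (int (card (B x)) - 2 + int (degree H x))))"

end

theory Submission
  imports Defs
begin

text \<open>
  The first part is an edge count. An edge of the host \<open>U\<close> that is not contracted joins two
  different blocks of at least one of the \<open>k\<close> displays. The blocks of a display are connected and
  the quotient is the tree \<open>T\<close>, so each display has exactly \<open>n - 1\<close> edges between different blocks
  (\<open>quotient_tree\<close>). Hence at most \<open>k (n - 1)\<close> edges remain, and the contracted tree has at most one
  vertex more.

  For the identity, call a contraction \<open>f\<close> of \<open>U\<close> onto the underlying tree of a core \<open>\<Omega>\<close> together with
  an admissible map \<open>\<theta>\<close> from the survivor classes to \<open>[m]\<close> a lift of \<open>\<Omega>\<close> to \<open>U\<close>. The sum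
  \<open>L_rig\<close> is the number of lifts of \<open>\<Omega>\<close> to all hosts (\<open>L_rig_eq_card_lifts\<close>), since the number of
  trees that contract onto \<open>H\<close> with given blocks of sizes \<open>b\<^sub>x\<close> is the product of the powers of the
  \<open>b\<^sub>x\<close> with exponents \<open>b\<^sub>x - 2 + d\<^sub>x\<close>, where \<open>d\<^sub>x\<close> is the degree of \<open>x\<close> (\<open>card_trees_over\<close>):
  such a tree consists of a tree on each block, counted by Cayley's formula, and one edge
  between the blocks of \<open>x\<close> and \<open>y\<close> for every edge \<open>xy\<close> of \<open>H\<close>. Cayley's formula itself follows
  from the number of trees that contain a given forest, by double counting the pairs of such a tree
  and one of its further edges (\<open>card_trees_containing_forest\<close>).

  A lift of \<open>\<Omega>\<close> determines an ordered tuple of distinct displays in its host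
  (\<open>lift_display_tuple\<close>). Conversely, contracting the common blocks of a tuple of displays yields
  a canonical core, which is small by the first part, and the lifts of \<open>\<Omega>\<close> that give this tuple
  correspond to the isomorphisms from the canonical core to \<open>\<Omega>\<close> (\<open>card_lifts_of_tuple\<close>): the blocks
  of any lift are forced to be the components of the common contraction, and an isomorphism just
  names them by the vertices of \<open>\<Omega>\<close>. If there is an isomorphism at all, there are as many as
  automorphisms of \<open>\<Omega>\<close>. Thus \<open>L_rig\<close> divided by the number of automorphisms counts the tuples whose
  canonical core is isomorphic to \<open>\<Omega>\<close>, and summing over the classes counts every tuple once.
\<close>

section \<open>Connected components and forests\<close>

definition component :: "'v set \<Rightarrow> 'v set set \<Rightarrow> 'v \<Rightarrow> 'v set" where
  "component V E x = {y \<in> V. (x, y) \<in> (adj E)\<^sup>*}"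

definition components :: "'v set \<Rightarrow> 'v set set \<Rightarrow> 'v set set" where
  "components V E = component V E ` V"

lemma adj_iff [simp]: "(x, y) \<in> adj E \<longleftrightarrow> {x, y} \<in> E"
  by (simp add: adj_def)

lemma sym_adj: "sym (adj E)"
  by (auto simp: sym_def insert_commute)

lemma reach_sym: "(x, y) \<in> (adj E)\<^sup>* \<Longrightarrow> (y, x) \<in> (adj E)\<^sup>*"
  using sym_rtrancl[OF sym_adj] by (rule symD)

lemma adj_mono: "E \<subseteq> F \<Longrightarrow> adj E \<subseteq> adj F"
  by auto

lemma reach_mono: "E \<subseteq> F \<Longrightarrow> (x, y) \<in> (adj E)\<^sup>* \<Longrightarrow> (x, y) \<in> (adj F)\<^sup>*"
  using rtrancl_mono[OF adj_mono] by blast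

lemma adj_insert: "adj (insert {u, v} E) = insert (u, v) (insert (v, u) (adj E))"
  by (auto simp: doubleton_eq_iff)

lemma reach_insert:
  "(x, y) \<in> (adj (insert {u, v} E))\<^sup>* \<longleftrightarrow>
     (x, y) \<in> (adj E)\<^sup>* \<or>
     (x, u) \<in> (adj E)\<^sup>* \<and> (v, y) \<in> (adj E)\<^sup>* \<or>
     (x, v) \<in> (adj E)\<^sup>* \<and> (u, y) \<in> (adj E)\<^sup>*"
  unfolding adj_insert rtrancl_insert
  by (auto intro: rtrancl_trans reach_sym)

lemma reach_insert_connected:
  assumes "(u, v) \<in> (adj E)\<^sup>*"
  shows "(x, y) \<in> (adj (insert {u, v} E))\<^sup>* \<longleftrightarrow> (x, y) \<in> (adj E)\<^sup>*"
  unfolding reach_insert using assms by (meson reach_sym rtrancl_trans)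

lemma simple_graph_Graph:
  "simple_graph (Graph V E) \<longleftrightarrow>
     finite V \<and> (\<forall>e\<in>E. \<exists>x y. e = {x, y} \<and> x \<in> V \<and> y \<in> V \<and> x \<noteq> y)"
  by (auto simp: simple_graph_def)

lemma simple_edgeE:
  assumes "simple_graph G" "e \<in> edges G"
  obtains x y where "e = {x, y}" "x \<in> verts G" "y \<in> verts G" "x \<noteq> y"
  using assms by (auto simp: simple_graph_def)

lemma simple_edgeD:
  assumes "simple_graph G" "{x, y} \<in> edges G"
  shows "x \<in> verts G" "y \<in> verts G" "x \<noteq> y"
  using assms(1) simple_edgeE[OF assms] by (auto simp: doubleton_eq_iff)

lemma simple_card_edge: "simple_graph G \<Longrightarrow> e \<in> edges G \<Longrightarrow> card e = 2"
  by (erule simple_edgeE) auto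

lemma simple_finite_edges: "simple_graph G \<Longrightarrow> finite (edges G)"
proof -
  assume s: "simple_graph G"
  then have "edges G \<subseteq> Pow (verts G)" "finite (verts G)"
    by (auto simp: simple_graph_def)
  then show ?thesis by (meson finite_Pow_iff finite_subset)
qed

lemma simple_graph_subset:
  "simple_graph (Graph V E) \<Longrightarrow> F \<subseteq> E \<Longrightarrow> simple_graph (Graph V F)"
  by (auto simp: simple_graph_Graph)

lemma component_self: "x \<in> V \<Longrightarrow> x \<in> component V E x"
  by (simp add: component_def)

lemma component_eq_iff:
  assumes "x \<in> V" "y \<in> V"
  shows "component V E x = component V E y \<longleftrightarrow> (x, y) \<in> (adj E)\<^sup>*"
proof
  assume "component V E x = component V E y"
  then have "y \<in> component V E x" using assms by (simp add: component_self)
  then show "(x, y) \<in> (adj E)\<^sup>*" by (simp add: component_def)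
next
  assume "(x, y) \<in> (adj E)\<^sup>*"
  then show "component V E x = component V E y"
    unfolding component_def by (auto intro: rtrancl_trans dest: reach_sym)
qed

lemma component_eqI: "y \<in> component V E x \<Longrightarrow> x \<in> V \<Longrightarrow> component V E y = component V E x"
  by (metis (no_types, lifting) component_def component_eq_iff mem_Collect_eq)

lemma finite_components: "finite V \<Longrightarrow> finite (components V E)"
  by (simp add: components_def)

lemma Union_components: "\<Union> (components V E) = V"
  by (auto simp: components_def component_def)

lemma disjoint_components:
  assumes "C \<in> components V E" "D \<in> components V E" "C \<noteq> D"
  shows "C \<inter> D = {}"
proof (rule equals0I)
  fix z assume z: "z \<in> C \<inter> D"
  obtain x y where "x \<in> V" and C: "C = component V E x" and "y \<in> V" and D: "D = component V E y"
    using assms by (auto simp: components_def)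
  then have "component V E z = C" "component V E z = D"
    using z component_eqI[of z V E x] component_eqI[of z V E y] by simp_all
  then show False using assms(3) by simp
qed

lemma component_insert:
  assumes "u \<in> V" "v \<in> V" "x \<in> V"
  shows "component V (insert {u, v} E) x =
    (if (x, u) \<in> (adj E)\<^sup>* \<or> (x, v) \<in> (adj E)\<^sup>* then component V E u \<union> component V E v
     else component V E x)"
  unfolding component_def reach_insert
  by (auto intro: rtrancl_trans dest: reach_sym)

lemma components_insert:
  assumes uv: "u \<in> V" "v \<in> V"
  shows "components V (insert {u, v} E) =
    insert (component V E u \<union> component V E v)
      (components V E - {component V E u, component V E v})" (is "?l = ?r")
proof
  show "?l \<subseteq> ?r"
  proof
    fix C assume "C \<in> ?l"
    then obtain x where x: "x \<in> V" "C = component V (insert {u, v} E) x"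
      by (auto simp: components_def)
    show "C \<in> ?r"
    proof (cases "(x, u) \<in> (adj E)\<^sup>* \<or> (x, v) \<in> (adj E)\<^sup>*")
      case True
      then show ?thesis using x uv by (simp add: component_insert)
    next
      case False
      then have Cx: "C = component V E x" using x uv by (simp add: component_insert)
      moreover have "C \<noteq> component V E u" "C \<noteq> component V E v"
        unfolding Cx using False x(1) uv by (simp_all add: component_eq_iff)
      ultimately show ?thesis using x by (simp add: components_def)
    qed
  qed
  show "?r \<subseteq> ?l"
  proof
    fix C assume C: "C \<in> ?r"
    show "C \<in> ?l"
    proof (cases "C = component V E u \<union> component V E v")
      case True
      then have "C = component V (insert {u, v} E) u" using uv by (simp add: component_insert)
      then show ?thesis using uv by (simp add: components_def)
    next
      case False
      then obtain x where x: "x \<in> V" "C = component V E x"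
        and "C \<noteq> component V E u" "C \<noteq> component V E v"
        using C by (auto simp: components_def)
      then have "C = component V (insert {u, v} E) x"
        using uv by (simp add: component_insert component_eq_iff)
      then show ?thesis using x by (simp add: components_def)
    qed
  qed
qed

lemma components_insert_fresh:
  assumes uv: "u \<in> V" "v \<in> V" and nr: "(u, v) \<notin> (adj E)\<^sup>*"
  shows "component V E u \<union> component V E v \<notin> components V E"
    and "component V E u \<noteq> component V E v"
proof -
  show "component V E u \<noteq> component V E v" using assms by (simp add: component_eq_iff)
  show "component V E u \<union> component V E v \<notin> components V E"
  proof
    assume "component V E u \<union> component V E v \<in> components V E"
    then obtain w where w: "w \<in> V" "component V E u \<union> component V E v = component V E w"
      by (auto simp: components_def)
    then have "u \<in> component V E w" "v \<in> component V E w" using uv component_self by fast+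
    then show False using nr by (auto simp: component_def intro: rtrancl_trans dest: reach_sym)
  qed
qed

text \<open>A new edge between two components merges exactly these two. Together with
  \<open>components_insert_connected\<close> (an edge inside a component changes nothing) this turns statements
  about trees and forests into counting of components against edges.\<close>

lemma card_components_insert:
  assumes "finite V" "u \<in> V" "v \<in> V" "(u, v) \<notin> (adj E)\<^sup>*"
  shows "Suc (card (components V (insert {u, v} E))) = card (components V E)"
proof -
  note fr = components_insert_fresh[OF assms(2-)]
  have fin: "finite (components V E)" using assms(1) by (rule finite_components)
  have in2: "{component V E u, component V E v} \<subseteq> components V E"
    using assms by (auto simp: components_def)
  have "card (components V E - {component V E u, component V E v}) = card (components V E) - 2"
    using fr(2) in2 by (simp add: card_Diff_subset)
  moreover have "2 \<le> card (components V E)"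
    using card_mono[OF fin in2] fr(2) by simp
  ultimately show ?thesis
    using fr fin by (simp add: components_insert[OF assms(2,3)])
qed

lemma components_insert_connected:
  "(u, v) \<in> (adj E)\<^sup>* \<Longrightarrow> components V (insert {u, v} E) = components V E"
  by (simp add: components_def component_def reach_insert_connected)

lemma components_empty: "components V {} = (\<lambda>x. {x}) ` V"
proof -
  have "adj ({} :: 'a set set) = {}" by auto
  then show ?thesis by (auto simp: components_def component_def)
qed

lemma card_components_add:
  assumes "simple_graph (Graph V E)" "F \<subseteq> E"
  shows "card (components V F) \<le> card (components V E) + card (E - F)"
proof -
  have finE: "finite E" using simple_finite_edges[OF assms(1)] by simp
  have "finite D \<Longrightarrow> D \<subseteq> E - F \<Longrightarrow>
    card (components V F) \<le> card (components V (F \<union> D)) + card D" for D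
  proof (induction D rule: finite_induct)
    case empty
    then show ?case by simp
  next
    case (insert e D)
    then have "e \<in> E" by auto
    then obtain u v where e: "e = {u, v}" "u \<in> V" "v \<in> V"
      using assms(1) by (auto simp: simple_graph_Graph)
    have "finite V" using assms(1) by (simp add: simple_graph_def)
    then have "card (components V (F \<union> D)) \<le> card (components V (insert e (F \<union> D))) + 1"
      using e card_components_insert components_insert_connected
      by (metis Suc_eq_plus1 le_add1 order_refl)
    then show ?case using insert by simp
  qed
  from this[of "E - F"] show ?thesis using assms(2) finE by (simp add: Un_absorb1)
qed

lemma card_components_edges:
  assumes "simple_graph (Graph V E)"
  shows "card V \<le> card (components V E) + card E"
  using card_components_add[OF assms, of "{}"]
  by (simp add: components_empty card_image)

text \<open>Acyclicity by counting: every graph has at least \<open>|V| - |E|\<close> components, and equality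
  says that every edge, when it was added, joined two components. In this form acyclicity passes
  to subgraphs and quotients by arithmetic alone, with no manipulation of cycles.\<close>

definition forest :: "'v set \<Rightarrow> 'v set set \<Rightarrow> bool" where
  "forest V E \<longleftrightarrow> simple_graph (Graph V E) \<and> card (components V E) + card E = card V"

text \<open>Each of the missing edges raises the number of components by at most one, so an excess of
  components in the subgraph would already be present in the forest.\<close>

lemma forest_subset:
  assumes "forest V E" "F \<subseteq> E"
  shows "forest V F"
proof -
  have s: "simple_graph (Graph V E)" and sF: "simple_graph (Graph V F)"
    using assms by (auto simp: forest_def intro: simple_graph_subset)
  have fin: "finite E" using simple_finite_edges[OF s] by simp
  have "card (E - F) = card E - card F" "card F \<le> card E"
    using assms(2) fin by (auto simp: card_Diff_subset finite_subset card_mono)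
  then show ?thesis
    using card_components_add[OF s assms(2)] card_components_edges[OF sF] assms(1) sF
    unfolding forest_def by linarith
qed

lemma simple_graph_insert:
  "simple_graph (Graph V E) \<Longrightarrow> u \<in> V \<Longrightarrow> v \<in> V \<Longrightarrow> u \<noteq> v \<Longrightarrow> simple_graph (Graph V (insert {u, v} E))"
  by (auto simp: simple_graph_Graph)

lemma forest_insert:
  assumes "forest V E" "u \<in> V" "v \<in> V" "(u, v) \<notin> (adj E)\<^sup>*"
  shows "forest V (insert {u, v} E)"
proof -
  have s: "simple_graph (Graph V E)" using assms by (simp add: forest_def)
  have "u \<noteq> v" "{u, v} \<notin> E" using assms(4) by auto
  moreover have "finite E" "finite V"
    using simple_finite_edges[OF s] s by (auto simp: simple_graph_def)
  ultimately show ?thesis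
    using card_components_insert[of V u v E] assms simple_graph_insert[OF s, of u v]
    by (simp add: forest_def)
qed

lemma forest_bridge:
  assumes "forest V E" "{u, v} \<in> E"
  shows "(u, v) \<notin> (adj (E - {{u, v}}))\<^sup>*"
proof
  assume r: "(u, v) \<in> (adj (E - {{u, v}}))\<^sup>*"
  have "forest V (E - {{u, v}})" using forest_subset assms by blast
  moreover have "insert {u, v} (E - {{u, v}}) = E" using assms(2) by auto
  ultimately have "card (E - {{u, v}}) = card E"
    using components_insert_connected[OF r, of V] assms(1)
    unfolding forest_def by simp
  moreover have "finite E"
    using simple_finite_edges[of "Graph V E"] assms(1) by (simp add: forest_def)
  ultimately show False using assms(2)
    by (metis card_Diff1_less less_irrefl)
qed

lemma forest_bridge_sub:
  assumes "forest V E" "{u, v} \<in> E" "F \<subseteq> E" "{u, v} \<notin> F"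
  shows "(u, v) \<notin> (adj F)\<^sup>*"
  using forest_bridge[OF assms(1,2)] reach_mono[of F "E - {{u, v}}"] assms by blast

text \<open>Loops are cut off while the walk is built: a vertex that comes up for the second time
  truncates the path at its first occurrence.\<close>

lemma rtrancl_distinct_path:
  assumes "(x, y) \<in> r\<^sup>*"
  obtains xs where "xs \<noteq> []" "hd xs = x" "last xs = y" "distinct xs"
    "\<And>i. Suc i < length xs \<Longrightarrow> (xs ! i, xs ! Suc i) \<in> r"
proof -
  have "\<exists>xs. xs \<noteq> [] \<and> hd xs = x \<and> last xs = y \<and> distinct xs \<and>
    (\<forall>i. Suc i < length xs \<longrightarrow> (xs ! i, xs ! Suc i) \<in> r)"
    using assms
  proof (induction rule: rtrancl_induct)
    case base
    show ?case by (rule exI[of _ "[x]"]) auto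
  next
    case (step y z)
    then obtain xs where xs: "xs \<noteq> []" "hd xs = x" "last xs = y" "distinct xs"
      "\<forall>i. Suc i < length xs \<longrightarrow> (xs ! i, xs ! Suc i) \<in> r" by blast
    show ?case
    proof (cases "z \<in> set xs")
      case True
      then obtain i where i: "i < length xs" "xs ! i = z" by (auto simp: in_set_conv_nth)
      have "last (take (Suc i) xs) = z" using i by (simp add: take_Suc_conv_app_nth)
      then show ?thesis
        using xs i by (intro exI[of _ "take (Suc i) xs"]) (auto simp: distinct_take)
    next
      case False
      have "((xs @ [z]) ! i, (xs @ [z]) ! Suc i) \<in> r" if "Suc i < length (xs @ [z])" for i
      proof (cases "Suc i < length xs")
        case True
        then show ?thesis using xs(5) by (simp add: nth_append)
      next
        case False
        then have "i = length xs - 1" "Suc i = length xs" using that by auto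
        then show ?thesis using xs(1,3) step(2) by (simp add: nth_append last_conv_nth)
      qed
      then show ?thesis using xs False by (intro exI[of _ "xs @ [z]"]) auto
    qed
  qed
  with that show ?thesis by blast
qed

lemma is_cycle_mono: "is_cycle (Graph V F) xs \<Longrightarrow> F \<subseteq> E \<Longrightarrow> is_cycle (Graph V E) xs"
  by (auto simp: is_cycle_def)

text \<open>A path without repetitions from \<open>x\<close> to \<open>y\<close> is closed up by the new edge. It has at least
  three vertices since \<open>x \<noteq> y\<close> and the edge itself is not in \<open>F\<close>.\<close>

lemma reachable_edge_imp_cycle:
  assumes r: "(x, y) \<in> (adj F)\<^sup>*" and e: "{x, y} \<notin> F" "x \<noteq> y"
  shows "\<exists>xs. is_cycle (Graph V (insert {x, y} F)) xs"
proof -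
  obtain xs where xs: "xs \<noteq> []" "hd xs = x" "last xs = y" "distinct xs"
    "\<And>i. Suc i < length xs \<Longrightarrow> (xs ! i, xs ! Suc i) \<in> adj F"
    using r by (rule rtrancl_distinct_path) blast
  have len: "length xs \<ge> 3"
  proof (rule ccontr)
    assume "\<not> length xs \<ge> 3"
    then have "length xs = 1 \<or> length xs = 2" using xs(1)
      by (metis One_nat_def Suc_1 Suc_leI le_neq_implies_less length_greater_0_conv not_less_eq_eq numeral_3_eq_3)
    then show False
    proof
      assume "length xs = 1"
      then show False using xs(2,3) e(2) by (auto simp: length_Suc_conv)
    next
      assume l: "length xs = 2"
      then obtain a b where "xs = [a, b]" by (auto simp: length_Suc_conv numeral_2_eq_2)
      then show False using xs(5)[of 0] xs(2,3) e(1) by simp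
    qed
  qed
  have "{xs ! i, xs ! (Suc i mod length xs)} \<in> insert {x, y} F" if i: "i < length xs" for i
  proof (cases "Suc i = length xs")
    case True
    then have "i = length xs - 1" by simp
    then have "xs ! i = y" "xs ! (Suc i mod length xs) = x"
      using xs(1-3) by (auto simp: last_conv_nth hd_conv_nth)
    then show ?thesis by (simp add: insert_commute)
  next
    case False
    then show ?thesis using i xs(5)[of i] by simp
  qed
  then have "is_cycle (Graph V (insert {x, y} F)) xs"
    using len xs(4) by (simp add: is_cycle_def)
  then show ?thesis by blast
qed

text \<open>The closing edge of a cycle is bypassed by the rest of the cycle; three vertices are
  needed for the closing edge to differ from all the others.\<close>

lemma cycle_imp_reachable_edge:
  assumes c: "is_cycle (Graph V E) xs"
  obtains x y where "{x, y} \<in> E" "(x, y) \<in> (adj (E - {{x, y}}))\<^sup>*"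
proof -
  define l where "l = length xs"
  have l3: "l \<ge> 3" and d: "distinct xs"
    and ed: "\<And>i. i < l \<Longrightarrow> {xs ! i, xs ! (Suc i mod l)} \<in> E"
    using c by (auto simp: is_cycle_def l_def)
  have "xs \<noteq> []" using l3 by (auto simp: l_def)
  define e where "e = {xs ! (l - 1), xs ! 0}"
  have "e \<in> E" using ed[of "l - 1"] l3 by (simp add: e_def)
  have step: "{xs ! i, xs ! Suc i} \<in> E - {e}" if "Suc i < l" for i
  proof -
    have lt: "0 < length xs" "i < length xs" "Suc i < length xs" "l - 1 < length xs"
      using that l3 unfolding l_def by linarith+
    have "xs ! i = xs ! (l - 1) \<longleftrightarrow> i = l - 1" "xs ! i = xs ! 0 \<longleftrightarrow> i = 0"
      "xs ! Suc i = xs ! (l - 1) \<longleftrightarrow> Suc i = l - 1" "xs ! Suc i = xs ! 0 \<longleftrightarrow> Suc i = 0"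
      using lt by (simp_all only: nth_eq_iff_index_eq[OF d])
    moreover have "i \<noteq> l - 1" "\<not> (i = 0 \<and> Suc i = l - 1)" using that l3 by linarith+
    ultimately have "{xs ! i, xs ! Suc i} \<noteq> e"
      by (simp add: e_def doubleton_eq_iff)
    then show ?thesis using ed[of i] that by simp
  qed
  have "i < l \<Longrightarrow> (xs ! 0, xs ! i) \<in> (adj (E - {e}))\<^sup>*" for i
  proof (induction i)
    case (Suc i)
    then show ?case using step[of i] by (auto intro: rtrancl_into_rtrancl)
  qed simp
  from this[of "l - 1"] have "(xs ! (l - 1), xs ! 0) \<in> (adj (E - {e}))\<^sup>*"
    using l3 by (auto intro: reach_sym)
  with that \<open>e \<in> E\<close> show ?thesis by (simp add: e_def)
qed

text \<open>The bridge from the list-based notion of a cycle to counting. If the counting fails, then,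
  adding the edges one at a time, some edge joins two vertices that are already connected, and such
  an edge closes a cycle.\<close>

lemma no_cycle_iff_forest:
  assumes s: "simple_graph (Graph V E)"
  shows "(\<nexists>xs. is_cycle (Graph V E) xs) \<longleftrightarrow> forest V E"
proof
  assume "forest V E"
  then show "\<nexists>xs. is_cycle (Graph V E) xs"
    by (metis cycle_imp_reachable_edge forest_bridge)
next
  have "finite E" using simple_finite_edges[OF s] by simp
  then show "\<nexists>xs. is_cycle (Graph V E) xs \<Longrightarrow> forest V E"
    using s
  proof (induction E rule: finite_induct)
    case empty
    then show ?case by (simp add: forest_def components_empty card_image)
  next
    case (insert e F)
    obtain x y where e: "e = {x, y}" "x \<in> V" "y \<in> V" "x \<noteq> y"
      using insert.prems(2) by (auto simp: simple_graph_Graph)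
    have "forest V F"
      using insert.IH insert.prems is_cycle_mono[of V F _ "insert e F"]
        simple_graph_subset[OF insert.prems(2), of F] by blast
    moreover have "(x, y) \<notin> (adj F)\<^sup>*"
      using reachable_edge_imp_cycle[of x y F V] insert.prems(1) insert.hyps(2) e by blast
    ultimately show ?case using forest_insert[of V F x y] e by simp
  qed
qed

lemma connected_graph_iff_components:
  "connected_graph (Graph V E) \<longleftrightarrow> components V E = {V}"
proof
  assume c: "connected_graph (Graph V E)"
  then have "component V E x = V" if "x \<in> V" for x
    using that by (auto simp: connected_graph_def component_def)
  then show "components V E = {V}" using c by (auto simp: components_def connected_graph_def)
next
  assume a: "components V E = {V}"
  then have "V \<noteq> {}" by (auto simp: components_def)
  moreover have "component V E x = V" if "x \<in> V" for x
    using a that by (auto simp: components_def)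
  ultimately show "connected_graph (Graph V E)"
    by (auto simp: connected_graph_def component_def)
qed

lemma connected_graph_iff_card:
  assumes "V \<noteq> {}"
  shows "connected_graph (Graph V E) \<longleftrightarrow> card (components V E) = 1"
proof -
  have "\<Union> (components V E) = V" by (rule Union_components)
  then show ?thesis
    unfolding connected_graph_iff_components by (auto simp: card_1_singleton_iff)
qed

lemma connected_card_le:
  assumes "simple_graph G" "connected_graph G"
  shows "card (verts G) \<le> card (edges G) + 1"
  using card_components_edges[of "verts G" "edges G"] assms connected_graph_iff_components[of "verts G" "edges G"]
  by simp

text \<open>The criterion by which quotients and assembled graphs below are shown to be trees:
  connectedness is checked directly, and acyclicity is replaced by an edge count.\<close>

lemma is_tree_iff_card:
  "is_tree G \<longleftrightarrow> simple_graph G \<and> connected_graph G \<and> card (verts G) = card (edges G) + 1"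
  using no_cycle_iff_forest[of "verts G" "edges G"]
    connected_graph_iff_components[of "verts G" "edges G"]
  by (auto simp: is_tree_def forest_def)

lemma is_tree_iff_forest:
  "is_tree (Graph V E) \<longleftrightarrow> forest V E \<and> connected_graph (Graph V E)"
  using no_cycle_iff_forest by (auto simp: is_tree_def forest_def)

section \<open>Trees containing a given forest, and Cayley's formula\<close>

text \<open>Pairs are ordered below because a sum over \<^term>\<open>V \<times> V\<close> factors through the components;
  the price is this factor two.\<close>

lemma card_adj:
  assumes "finite A" "\<And>e. e \<in> A \<Longrightarrow> card e = 2"
  shows "finite (adj A) \<and> card (adj A) = 2 * card A"
  using assms
proof (induction A rule: finite_induct)
  case empty
  have "adj ({} :: 'a set set) = {}" by auto
  then show ?case by simp
next
  case (insert e A)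
  have "card e = 2" using insert.prems by simp
  then obtain u v where e: "e = {u, v}" "u \<noteq> v" by (auto simp: card_2_iff)
  have "(u, v) \<notin> adj A" "(v, u) \<notin> adj A" using insert.hyps(2) e by (auto simp: insert_commute)
  then show ?case using insert e by (simp add: adj_insert)
qed

lemma component_fiber:
  assumes "C \<in> components V E"
  shows "{x \<in> V. component V E x = C} = C"
proof -
  obtain y where y: "y \<in> V" "C = component V E y" using assms by (auto simp: components_def)
  have "component V E x = C \<longleftrightarrow> x \<in> C" if "x \<in> V" for x
    using that y component_eqI[of x V E y] component_self[of x V E] by auto
  moreover have "C \<subseteq> V" using y by (auto simp: component_def)
  ultimately show ?thesis by blast
qed

lemma sum_over_components:
  fixes h :: "'v set \<Rightarrow> real"
  assumes "finite V"
  shows "(\<Sum>x\<in>V. h (component V E x)) = (\<Sum>C\<in>components V E. real (card C) * h C)"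
proof -
  have "(\<Sum>x\<in>V. h (component V E x)) =
      (\<Sum>C\<in>components V E. \<Sum>x\<in>{x \<in> V. component V E x = C}. h (component V E x))"
    unfolding components_def by (rule sum.image_gen[OF assms])
  also have "\<dots> = (\<Sum>C\<in>components V E. \<Sum>x\<in>{x \<in> V. component V E x = C}. h C)"
    by (intro sum.cong) auto
  also have "\<dots> = (\<Sum>C\<in>components V E. real (card C) * h C)"
    by (intro sum.cong) (simp_all add: component_fiber)
  finally show ?thesis .
qed

definition trees_containing :: "'v set \<Rightarrow> 'v set set \<Rightarrow> 'v set set set" where
  "trees_containing V F = {E. F \<subseteq> E \<and> is_tree (Graph V E)}"

lemma finite_trees_containing: "finite V \<Longrightarrow> finite (trees_containing V F)"
  by (rule finite_subset[of _ "Pow (Pow V)"])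
     (auto simp: trees_containing_def is_tree_def simple_graph_def)

lemma sum_pairs_of_components:
  fixes b :: "'c \<Rightarrow> real"
  assumes "finite K"
  shows "(\<Sum>C\<in>K. \<Sum>D\<in>K. if C \<noteq> D then b C + b D else 0) = 2 * (real (card K) - 1) * sum b K"
proof -
  have "(\<Sum>D\<in>K. if C \<noteq> D then b C + b D else 0) = (real (card K) - 2) * b C + sum b K"
    if "C \<in> K" for C
  proof -
    have "(\<Sum>D\<in>K. if C \<noteq> D then b C + b D else 0) = (\<Sum>D\<in>K. (b C + b D) - (if D = C then 2 * b C else 0))"
      by (intro sum.cong) auto
    also have "\<dots> = real (card K) * b C + sum b K - 2 * b C"
      using assms that by (simp add: sum_subtractf sum.distrib)
    finally show ?thesis by (simp add: algebra_simps)
  qed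
  then have "(\<Sum>C\<in>K. \<Sum>D\<in>K. if C \<noteq> D then b C + b D else 0) =
      (\<Sum>C\<in>K. (real (card K) - 2) * b C + sum b K)"
    by (intro sum.cong) auto
  also have "\<dots> = 2 * (real (card K) - 1) * sum b K"
    by (simp add: sum.distrib flip: sum_distrib_left) (simp add: algebra_simps)
  finally show ?thesis .
qed

text \<open>In the double count below, joining the components \<open>C\<close> and \<open>D\<close> multiplies the product of the
  component sizes by \<open>(|C| + |D|) / (|C| |D|)\<close>. There are \<open>|C| |D|\<close> pairs \<open>(u, v)\<close> joining
  \<open>C\<close> to \<open>D\<close>, so the denominators cancel and only \<open>|C| + |D|\<close>, summed over ordered pairs of
  distinct components, remains.\<close>

lemma sum_pairs_join_components:
  assumes fin: "finite V"
  shows "(\<Sum>(u, v)\<in>{p \<in> V \<times> V. p \<notin> (adj F)\<^sup>*}.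
            real (card (component V F u \<union> component V F v)) /
            (real (card (component V F u)) * real (card (component V F v)))) =
         2 * (real (card (components V F)) - 1) * real (card V)"
proof -
  let ?K = "components V F"
  let ?b = "\<lambda>C. real (card C)"
  let ?g = "\<lambda>C D. if C \<noteq> D then (?b C + ?b D) / (?b C * ?b D) else 0"
  have finK: "finite ?K" using fin by (rule finite_components)
  have finC: "finite C" "C \<noteq> {}" if "C \<in> ?K" for C
    using that fin by (auto simp: components_def component_def)
  have pos: "?b C > 0" if "C \<in> ?K" for C using finC[OF that] by (simp add: card_gt_0_iff)
  have cK: "component V F x \<in> ?K" if "x \<in> V" for x using that by (simp add: components_def)
  have "(\<Sum>(u, v)\<in>{p \<in> V \<times> V. p \<notin> (adj F)\<^sup>*}.
            real (card (component V F u \<union> component V F v)) /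
            (real (card (component V F u)) * real (card (component V F v)))) =
        (\<Sum>(u, v)\<in>V \<times> V. ?g (component V F u) (component V F v))"
  proof (rule sum.mono_neutral_cong_left)
    fix p assume "p \<in> {p \<in> V \<times> V. p \<notin> (adj F)\<^sup>*}"
    then obtain u v where p: "p = (u, v)" "u \<in> V" "v \<in> V" "(u, v) \<notin> (adj F)\<^sup>*" by auto
    then have ne: "component V F u \<noteq> component V F v" by (simp add: component_eq_iff)
    then have "component V F u \<inter> component V F v = {}"
      using disjoint_components cK p by metis
    then have "card (component V F u \<union> component V F v) =
        card (component V F u) + card (component V F v)"
      using finC cK p by (simp add: card_Un_disjoint)
    then show "(case p of (u, v) \<Rightarrow> real (card (component V F u \<union> component V F v)) /
            (real (card (component V F u)) * real (card (component V F v)))) =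
        (case p of (u, v) \<Rightarrow> ?g (component V F u) (component V F v))"
      using ne p by simp
  qed (use fin in \<open>auto simp: component_eq_iff\<close>)
  also have "\<dots> = (\<Sum>u\<in>V. \<Sum>v\<in>V. ?g (component V F u) (component V F v))"
    using fin by (simp add: sum.cartesian_product)
  also have "\<dots> = (\<Sum>u\<in>V. \<Sum>D\<in>?K. ?b D * ?g (component V F u) D)"
    using fin by (subst sum_over_components) auto
  also have "\<dots> = (\<Sum>C\<in>?K. ?b C * (\<Sum>D\<in>?K. ?b D * ?g C D))"
    using fin by (rule sum_over_components[of V "\<lambda>C. \<Sum>D\<in>?K. ?b D * ?g C D"])
  also have "\<dots> = (\<Sum>C\<in>?K. \<Sum>D\<in>?K. if C \<noteq> D then ?b C + ?b D else 0)"
    unfolding sum_distrib_left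
  proof (intro sum.cong refl)
    fix C D assume "C \<in> ?K" "D \<in> ?K"
    then show "?b C * (?b D * ?g C D) = (if C \<noteq> D then ?b C + ?b D else 0)"
      using pos[of C] pos[of D] by (simp add: field_simps)
  qed
  also have "\<dots> = 2 * (real (card ?K) - 1) * sum ?b ?K"
    by (rule sum_pairs_of_components[OF finK])
  also have "sum ?b ?K = real (card V)"
    using sum_over_components[OF fin, of "\<lambda>_. 1" F] by simp
  finally show ?thesis .
qed

lemma prod_components_insert:
  assumes "finite V" "u \<in> V" "v \<in> V" "(u, v) \<notin> (adj F)\<^sup>*"
  shows "(\<Prod>C\<in>components V (insert {u, v} F). real (card C)) =
    (\<Prod>C\<in>components V F. real (card C)) *
      (real (card (component V F u \<union> component V F v)) /
       (real (card (component V F u)) * real (card (component V F v))))"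
proof -
  let ?Cu = "component V F u" and ?Cv = "component V F v" and ?K = "components V F"
  note fr = components_insert_fresh[OF assms(2-)]
  have fin: "finite ?K" using assms(1) by (rule finite_components)
  have "u \<in> ?Cu" "v \<in> ?Cv" "finite ?Cu" "finite ?Cv"
    using assms by (auto simp: component_self component_def)
  then have pos: "card ?Cu \<noteq> 0" "card ?Cv \<noteq> 0" by auto
  have "?K = insert ?Cu (insert ?Cv (?K - {?Cu, ?Cv}))"
    using assms by (auto simp: components_def)
  then have "(\<Prod>C\<in>?K. real (card C)) =
      (\<Prod>C\<in>insert ?Cu (insert ?Cv (?K - {?Cu, ?Cv})). real (card C))" by simp
  also have "\<dots> = real (card ?Cu) * (real (card ?Cv) * (\<Prod>C\<in>?K - {?Cu, ?Cv}. real (card C)))"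
    using fin fr by simp
  finally have "(\<Prod>C\<in>?K. real (card C)) =
      real (card ?Cu) * (real (card ?Cv) * (\<Prod>C\<in>?K - {?Cu, ?Cv}. real (card C)))" .
  moreover have "(\<Prod>C\<in>components V (insert {u, v} F). real (card C)) =
      real (card (?Cu \<union> ?Cv)) * (\<Prod>C\<in>?K - {?Cu, ?Cv}. real (card C))"
    using fin fr by (simp add: components_insert[OF assms(2,3)])
  ultimately show ?thesis using pos by simp
qed

text \<open>Count the pairs of a tree \<open>E \<supseteq> F\<close> and an oriented edge of \<open>E\<close> outside \<open>F\<close>. A tree on \<open>n\<close>
  vertices has \<open>n - 1\<close> edges, and \<open>F\<close> has \<open>n - c\<close> of them for \<open>c\<close> components, which leaves
  \<open>c - 1\<close> edges with two orientations. The trees that contain a given new edge are the trees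
  containing the forest enlarged by it.\<close>

lemma trees_containing_double_count:
  assumes F: "forest V F" and ne: "V \<noteq> {}"
  shows "2 * (card (components V F) - 1) * card (trees_containing V F) =
    (\<Sum>(u, v)\<in>{p \<in> V \<times> V. p \<notin> (adj F)\<^sup>*}. card (trees_containing V (insert {u, v} F)))"
proof -
  let ?T = "trees_containing V"
  define P where "P = {p \<in> V \<times> V. p \<notin> (adj F)\<^sup>*}"
  have s: "simple_graph (Graph V F)" using F by (simp add: forest_def)
  then have fin: "finite V" by (simp add: simple_graph_def)
  have finP: "finite P" unfolding P_def using fin by simp
  have finT: "finite (?T E)" for E using fin by (rule finite_trees_containing)
  have new: "card {p \<in> P. {fst p, snd p} \<in> E} = 2 * (card (components V F) - 1)"
    if E: "E \<in> ?T F" for E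
  proof -
    have FE: "F \<subseteq> E" and tr: "is_tree (Graph V E)" using E by (auto simp: trees_containing_def)
    then have fE: "forest V E" by (simp add: is_tree_iff_forest)
    have sE: "simple_graph (Graph V E)" using fE by (simp add: forest_def)
    have "p \<in> adj (E - F)" if "p \<in> P" "{fst p, snd p} \<in> E" for p
      using that by (cases p) (auto simp: P_def)
    moreover have "p \<in> P \<and> {fst p, snd p} \<in> E" if "p \<in> adj (E - F)" for p
    proof -
      obtain u v where p: "p = (u, v)" by force
      then have "{u, v} \<in> E" "{u, v} \<notin> F" using that by auto
      then show ?thesis
        using p forest_bridge_sub[OF fE _ FE] simple_edgeD[OF sE] by (auto simp: P_def)
    qed
    ultimately have "{p \<in> P. {fst p, snd p} \<in> E} = adj (E - F)" by blast
    moreover have "card (adj (E - F)) = 2 * card (E - F)"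
      using card_adj[of "E - F"] simple_finite_edges[OF sE] simple_card_edge[OF sE] by auto
    moreover have "card (E - F) = card E - card F"
      using FE simple_finite_edges[OF s] by (simp add: card_Diff_subset)
    moreover have "card V = card E + 1" using tr by (simp add: is_tree_iff_card)
    moreover have "card (components V F) + card F = card V" using F by (simp add: forest_def)
    ultimately show ?thesis by simp
  qed
  have old: "?T (insert {fst p, snd p} F) = {E \<in> ?T F. {fst p, snd p} \<in> E}" for p
    by (auto simp: trees_containing_def)
  have "(\<Sum>p\<in>P. card (?T (insert {fst p, snd p} F))) =
      (\<Sum>p\<in>P. \<Sum>E\<in>?T F. if {fst p, snd p} \<in> E then 1 else 0)"
    unfolding old using finT by (simp add: sum.If_cases Int_def)
  also have "\<dots> = (\<Sum>E\<in>?T F. \<Sum>p\<in>P. if {fst p, snd p} \<in> E then 1 else 0)"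
    by (rule sum.swap)
  also have "\<dots> = (\<Sum>E\<in>?T F. card {p \<in> P. {fst p, snd p} \<in> E})"
    using finP by (simp add: sum.If_cases Int_def)
  also have "\<dots> = 2 * (card (components V F) - 1) * card (?T F)"
    using new by simp
  finally show ?thesis by (simp add: P_def case_prod_beta)
qed

text \<open>The number of trees on \<open>n\<close> vertices containing a forest with component sizes
  \<open>b\<^sub>1, \<dots>, b\<^sub>c\<close> is \<open>n\<^sup>c\<^sup>-\<^sup>2 b\<^sub>1 \<dots> b\<^sub>c\<close>, by induction on \<open>c\<close> through the
  double count. This form, stronger than the count of all trees, is the one that the induction can
  carry. The factor \<open>n\<^sup>2\<close> on the left avoids the exponent \<open>c - 2\<close>, which is negative for \<open>c = 1\<close>.\<close>

theorem card_trees_containing_forest: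
  assumes "forest V F" "V \<noteq> {}"
  shows "real (card V) ^ 2 * real (card (trees_containing V F)) =
    real (card V) ^ card (components V F) * (\<Prod>C\<in>components V F. real (card C))"
  using assms
proof (induction "card (components V F)" arbitrary: F rule: less_induct)
  case (less F)
  let ?K = "components V F" and ?T = "trees_containing V"
  let ?n = "real (card V)"
  have s: "simple_graph (Graph V F)" using less.prems(1) by (simp add: forest_def)
  then have fin: "finite V" by (simp add: simple_graph_def)
  have finK: "finite ?K" using fin by (rule finite_components)
  moreover have "?K \<noteq> {}" using less.prems(2) by (auto simp: components_def)
  ultimately have "card ?K > 0" by (simp add: card_gt_0_iff)
  then consider "card ?K = 1" | "card ?K > 1" by linarith
  then show ?case
  proof cases
    case 1
    then have con: "connected_graph (Graph V F)"
      using less.prems(2) by (simp add: connected_graph_iff_card)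
    then have trF: "is_tree (Graph V F)" using less.prems(1) by (simp add: is_tree_iff_forest)
    have "E = F" if "F \<subseteq> E" "is_tree (Graph V E)" for E
    proof -
      have "card E = card F" using trF that(2) by (simp add: is_tree_iff_card)
      moreover have "finite E"
        using that(2) simple_finite_edges[of "Graph V E"] by (simp add: is_tree_iff_card)
      ultimately show ?thesis using that(1) card_subset_eq by metis
    qed
    then have "?T F = {F}" using trF by (auto simp: trees_containing_def)
    moreover have "?K = {V}" using con by (simp add: connected_graph_iff_components)
    ultimately show ?thesis by (simp add: power2_eq_square)
  next
    case 2
    let ?c = "card ?K" and ?P = "{p \<in> V \<times> V. p \<notin> (adj F)\<^sup>*}"
    let ?w = "\<lambda>u v. real (card (component V F u \<union> component V F v)) /
            (real (card (component V F u)) * real (card (component V F v)))"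
    have IH: "?n\<^sup>2 * real (card (?T (insert {u, v} F))) =
        ?n ^ (?c - 1) * ((\<Prod>C\<in>?K. real (card C)) * ?w u v)"
      if "(u, v) \<in> ?P" for u v
    proof -
      have uv: "u \<in> V" "v \<in> V" "(u, v) \<notin> (adj F)\<^sup>*" using that by auto
      have c: "card (components V (insert {u, v} F)) = ?c - 1"
        using card_components_insert[OF fin uv] by simp
      then show ?thesis
        using less.hyps[of "insert {u, v} F"] forest_insert[OF less.prems(1) uv] less.prems(2) 2
        by (simp add: prod_components_insert[OF fin uv])
    qed
    have "2 * (real ?c - 1) * (?n\<^sup>2 * real (card (?T F))) =
        ?n\<^sup>2 * real (2 * (?c - 1) * card (?T F))"
      using 2 by (simp add: of_nat_diff)
    also have "\<dots> = (\<Sum>(u, v)\<in>?P. ?n\<^sup>2 * real (card (?T (insert {u, v} F))))"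
      unfolding trees_containing_double_count[OF less.prems]
      by (simp add: sum_distrib_left case_prod_beta)
    also have "\<dots> = (\<Sum>(u, v)\<in>?P. ?n ^ (?c - 1) * ((\<Prod>C\<in>?K. real (card C)) * ?w u v))"
      using IH by (intro sum.cong) auto
    also have "\<dots> = ?n ^ (?c - 1) * (\<Prod>C\<in>?K. real (card C)) * (\<Sum>(u, v)\<in>?P. ?w u v)"
      by (simp add: sum_distrib_left case_prod_beta mult.assoc)
    also have "\<dots> = ?n ^ (?c - 1) * (\<Prod>C\<in>?K. real (card C)) * (2 * (real ?c - 1) * ?n)"
      unfolding sum_pairs_join_components[OF fin] ..
    also have "\<dots> = 2 * (real ?c - 1) * (?n ^ ?c * (\<Prod>C\<in>?K. real (card C)))"
      using 2 by (simp add: power_eq_if)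
    finally show ?thesis using 2 by simp
  qed
qed

text \<open>The empty forest has \<open>n\<close> components of size one.\<close>

theorem cayley_formula:
  assumes "finite V" "V \<noteq> {}"
  shows "real (card {E. is_tree (Graph V E)}) = real (card V) powi (int (card V) - 2)"
proof -
  have sg: "forest V {}"
    using assms by (simp add: forest_def simple_graph_def components_empty card_image)
  have n: "real (card V) \<noteq> 0" using assms by simp
  have "real (card V) ^ 2 * real (card {E. is_tree (Graph V E)}) = real (card V) ^ card V"
    using card_trees_containing_forest[OF sg assms(2)]
    by (simp add: trees_containing_def components_empty card_image prod.reindex)
  then have "real (card {E. is_tree (Graph V E)}) = real (card V) ^ card V / real (card V) ^ 2"
    using n by (simp add: field_simps)
  also have "\<dots> = real (card V) powi (int (card V) - 2)"
    using n by (simp add: power_int_diff)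
  finally show ?thesis .
qed

section \<open>Contractions with connected fibers\<close>

definition fiber :: "('v \<Rightarrow> 'w) \<Rightarrow> 'v set \<Rightarrow> 'w \<Rightarrow> 'v set" where
  "fiber f V y = {x \<in> V. f x = y}"

text \<open>The condition of \<open>contracts_onto\<close> on the fibers, separated from the target so
  that it can be used before the quotient is known to be a tree.\<close>

definition connected_fibers :: "('v \<Rightarrow> 'w) \<Rightarrow> 'v graph \<Rightarrow> bool" where
  "connected_fibers f G \<longleftrightarrow> (\<forall>y \<in> f ` verts G. connected_graph (induced G (fiber f (verts G) y)))"

lemma contracts_onto_iff:
  "contracts_onto f G H \<longleftrightarrow> connected_fibers f G \<and> quotient_graph f G = H"
  by (auto simp: contracts_onto_def connected_fibers_def fiber_def quotient_graph_def)

lemma verts_induced [simp]: "verts (induced G S) = S"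
  and edges_induced [simp]: "edges (induced G S) = {e \<in> edges G. e \<subseteq> S}"
  by (simp_all add: induced_def)

lemma verts_quotient [simp]: "verts (quotient_graph f G) = f ` verts G"
  and edges_quotient: "edges (quotient_graph f G) = {f ` e | e. e \<in> edges G \<and> card (f ` e) = 2}"
  by (simp_all add: quotient_graph_def)

lemma simple_induced:
  assumes "simple_graph G" "S \<subseteq> verts G"
  shows "simple_graph (induced G S)"
proof -
  have "\<exists>x y. e = {x, y} \<and> x \<in> S \<and> y \<in> S \<and> x \<noteq> y" if "e \<in> edges G" "e \<subseteq> S" for e
    using simple_edgeE[OF assms(1) that(1)] that(2) by (metis insert_subset)
  moreover have "finite S"
    using assms by (auto simp: simple_graph_def intro: finite_subset)
  ultimately show ?thesis unfolding induced_def simple_graph_Graph by blast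
qed

lemma induced_verts: "simple_graph G \<Longrightarrow> induced G (verts G) = G"
  by (cases G) (auto simp: simple_graph_def induced_def)

lemma simple_quotient:
  assumes "simple_graph G"
  shows "simple_graph (quotient_graph f G)"
proof -
  have "\<exists>x y. f ` e = {x, y} \<and> x \<in> f ` verts G \<and> y \<in> f ` verts G \<and> x \<noteq> y"
    if e: "e \<in> edges G" "card (f ` e) = 2" for e
  proof -
    obtain u v where uv: "e = {u, v}" "u \<in> verts G" "v \<in> verts G"
      using simple_edgeE[OF assms e(1)] by metis
    then have "f u \<noteq> f v" using e(2) by auto
    then show ?thesis using uv by auto
  qed
  then show ?thesis
    using assms unfolding quotient_graph_def simple_graph_Graph by (auto simp: simple_graph_def)
qed

lemma quotient_edge_iff:
  assumes "simple_graph G"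
  shows "{s, t} \<in> edges (quotient_graph f G) \<longleftrightarrow>
    s \<noteq> t \<and> (\<exists>u v. {u, v} \<in> edges G \<and> f u = s \<and> f v = t)"
proof
  assume a: "{s, t} \<in> edges (quotient_graph f G)"
  then obtain e where e: "{s, t} = f ` e" "e \<in> edges G" "card (f ` e) = 2"
    by (auto simp: edges_quotient)
  obtain u v where uv: "e = {u, v}" using simple_edgeE[OF assms e(2)] by metis
  then have "s = f u \<and> t = f v \<or> s = f v \<and> t = f u" using e(1) by (auto simp: doubleton_eq_iff)
  moreover have "s \<noteq> t" using e(3) unfolding e(1)[symmetric] by auto
  moreover have "{v, u} \<in> edges G" "{u, v} \<in> edges G" using e uv by (auto simp: insert_commute)
  ultimately show "s \<noteq> t \<and> (\<exists>u v. {u, v} \<in> edges G \<and> f u = s \<and> f v = t)" by blast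
next
  assume "s \<noteq> t \<and> (\<exists>u v. {u, v} \<in> edges G \<and> f u = s \<and> f v = t)"
  then obtain u v where "s \<noteq> t" "{u, v} \<in> edges G" "f u = s" "f v = t" by blast
  then have "f ` {u, v} = {s, t}" "{u, v} \<in> edges G" "card (f ` {u, v}) = 2" by auto
  then show "{s, t} \<in> edges (quotient_graph f G)" unfolding edges_quotient by blast
qed

lemma reach_induced_image:
  assumes "simple_graph G" "(x, y) \<in> (adj {e \<in> edges G. e \<subseteq> S})\<^sup>*"
  shows "(f x, f y) \<in> (adj {e \<in> edges (quotient_graph f G). e \<subseteq> f ` S})\<^sup>*"
  using assms(2)
proof (induction rule: rtrancl_induct)
  case (step y z)
  have "f y = f z \<or> (f y, f z) \<in> adj {e \<in> edges (quotient_graph f G). e \<subseteq> f ` S}"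
    using step.hyps(2) by (auto simp: quotient_edge_iff[OF assms(1)])
  then show ?case using step.IH by (auto intro: rtrancl_into_rtrancl)
qed simp

lemma connected_image:
  assumes "simple_graph G" "connected_graph (induced G S)"
  shows "connected_graph (induced (quotient_graph f G) (f ` S))"
  using assms(2) reach_induced_image[OF assms(1), of _ _ S f]
  by (auto simp: connected_graph_def)

text \<open>A path in the quotient lifts: each of its edges comes from an edge of \<open>G\<close>, and the ends of
  consecutive lifted edges lie in a common fiber, where they are connected.\<close>

lemma connected_preimage:
  assumes s: "simple_graph G" and cf: "connected_fibers f G"
    and S: "S \<subseteq> f ` verts G" and con: "connected_graph (induced (quotient_graph f G) S)"
  shows "connected_graph (induced G {x \<in> verts G. f x \<in> S})"
proof -
  let ?S = "{x \<in> verts G. f x \<in> S}"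
  let ?R = "(adj {e \<in> edges G. e \<subseteq> ?S})\<^sup>*"
  have fib: "(x, y) \<in> ?R" if "x \<in> ?S" "y \<in> ?S" "f x = f y" for x y
  proof -
    have "(x, y) \<in> (adj {e \<in> edges G. e \<subseteq> fiber f (verts G) (f x)})\<^sup>*"
      using cf that by (auto simp: connected_fibers_def connected_graph_def fiber_def)
    then show ?thesis
      by (rule reach_mono[rotated]) (use that in \<open>auto simp: fiber_def\<close>)
  qed
  have lift: "\<forall>y\<in>verts G. f y = t \<longrightarrow> (x, y) \<in> ?R"
    if "(s, t) \<in> (adj {e \<in> edges (quotient_graph f G). e \<subseteq> S})\<^sup>*" "x \<in> ?S" "f x = s" for s t x
    using that(1)
  proof (induction rule: rtrancl_induct)
    case base
    then show ?case using fib that by auto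
  next
    case (step t t')
    show ?case
    proof (intro ballI impI)
      fix y assume y: "y \<in> verts G" "f y = t'"
      obtain u v where uv: "{u, v} \<in> edges G" "f u = t" "f v = t'" and tS: "t \<in> S" "t' \<in> S"
        using step.hyps(2) by (auto simp: quotient_edge_iff[OF s])
      then have V: "u \<in> ?S" "v \<in> ?S" using simple_edgeD[OF s uv(1)] by auto
      then have "(x, u) \<in> ?R" using step.IH uv by auto
      moreover have "(u, v) \<in> ?R" using uv V by auto
      moreover have "(v, y) \<in> ?R" using fib V y uv by auto
      ultimately show "(x, y) \<in> ?R" by (meson rtrancl_trans)
    qed
  qed
  have "?S \<noteq> {}" using S con by (auto simp: connected_graph_def)
  moreover have "(x, y) \<in> ?R" if "x \<in> ?S" "y \<in> ?S" for x y
  proof -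
    have "(f x, f y) \<in> (adj {e \<in> edges (quotient_graph f G). e \<subseteq> S})\<^sup>*"
      using con that by (auto simp: connected_graph_def)
    then show ?thesis using lift that by blast
  qed
  ultimately show ?thesis by (simp add: connected_graph_def)
qed

lemma connected_quotient:
  assumes "simple_graph G" "connected_graph G"
  shows "connected_graph (quotient_graph f G)"
  using connected_image[OF assms(1), of "verts G" f] induced_verts[OF assms(1)]
    induced_verts[OF simple_quotient[OF assms(1), of f]] assms(2) by simp

lemma connected_of_quotient:
  assumes "simple_graph G" "connected_fibers f G" "connected_graph (quotient_graph f G)"
  shows "connected_graph G"
proof -
  have "{x \<in> verts G. f x \<in> f ` verts G} = verts G" by auto
  then show ?thesis
    using connected_preimage[OF assms(1,2), of "f ` verts G"] induced_verts[OF assms(1)]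
      induced_verts[OF simple_quotient[OF assms(1), of f]] assms(3) by simp
qed

lemma quotient_graph_comp:
  assumes "simple_graph G"
  shows "quotient_graph g (quotient_graph f G) = quotient_graph (g \<circ> f) G"
proof -
  have card2: "card (f ` e) = 2" if "e \<in> edges G" "card (g ` f ` e) = 2" for e
  proof -
    have "card e = 2" using that(1) assms simple_card_edge by blast
    then have "finite e" using card.infinite by fastforce
    then have "card (f ` e) \<le> 2" "2 \<le> card (f ` e)"
      using card_image_le[of e f] card_image_le[of "f ` e" g] that \<open>card e = 2\<close> by auto
    then show ?thesis by simp
  qed
  have "edges (quotient_graph g (quotient_graph f G)) = edges (quotient_graph (g \<circ> f) G)"
  proof (intro equalityI subsetI)
    fix h assume "h \<in> edges (quotient_graph g (quotient_graph f G))"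
    then obtain e where "e \<in> edges G" "h = g ` f ` e" "card (g ` f ` e) = 2"
      unfolding edges_quotient by blast
    then have "e \<in> edges G \<and> h = (g \<circ> f) ` e \<and> card ((g \<circ> f) ` e) = 2"
      by (simp add: image_comp)
    then show "h \<in> edges (quotient_graph (g \<circ> f) G)" unfolding edges_quotient by blast
  next
    fix h assume "h \<in> edges (quotient_graph (g \<circ> f) G)"
    then obtain e where e: "e \<in> edges G" "h = (g \<circ> f) ` e" "card ((g \<circ> f) ` e) = 2"
      unfolding edges_quotient by blast
    then have "h = g ` f ` e \<and> card (g ` f ` e) = 2" "card (f ` e) = 2"
      using card2[of e] by (simp_all add: image_comp)
    then show "h \<in> edges (quotient_graph g (quotient_graph f G))"
      unfolding edges_quotient using e(1) by blast
  qed
  moreover have "verts (quotient_graph g (quotient_graph f G)) = verts (quotient_graph (g \<circ> f) G)"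
    by (auto simp: image_comp)
  ultimately show ?thesis by (rule graph.expand[OF conjI, rotated])
qed

lemma simple_edges_subset: "simple_graph G \<Longrightarrow> e \<in> edges G \<Longrightarrow> e \<subseteq> verts G"
  by (auto simp: simple_graph_def)

lemma quotient_graph_cong:
  assumes "simple_graph G" "\<And>x. x \<in> verts G \<Longrightarrow> f x = g x"
  shows "quotient_graph f G = quotient_graph g G"
proof -
  have "f ` e = g ` e" if "e \<in> edges G" for e
    using simple_edges_subset[OF assms(1) that] assms(2) by (intro image_cong) auto
  then have "{f ` e |e. e \<in> edges G \<and> card (f ` e) = 2} = {g ` e |e. e \<in> edges G \<and> card (g ` e) = 2}"
    by metis
  moreover have "f ` verts G = g ` verts G" using assms(2) by (intro image_cong) auto
  ultimately show ?thesis by (simp add: quotient_graph_def)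
qed

lemma connected_fibers_cong:
  assumes "\<And>x. x \<in> verts G \<Longrightarrow> f x = g x"
  shows "connected_fibers f G = connected_fibers g G"
proof -
  have "f ` verts G = g ` verts G" using assms by (intro image_cong) auto
  moreover have "fiber f (verts G) y = fiber g (verts G) y" for y
    using assms by (auto simp: fiber_def)
  ultimately show ?thesis by (simp add: connected_fibers_def)
qed

lemma contracts_onto_cong:
  assumes "simple_graph G" "\<And>x. x \<in> verts G \<Longrightarrow> f x = g x"
  shows "contracts_onto f G H = contracts_onto g G H"
  using connected_fibers_cong[of G f g] quotient_graph_cong[OF assms(1), of f g] assms(2)
  by (simp add: contracts_onto_iff)

lemma contracts_onto_comp:
  assumes s: "simple_graph G" and f: "contracts_onto f G H" and g: "contracts_onto g H T"
  shows "contracts_onto (g \<circ> f) G T"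
proof -
  have cf: "connected_fibers f G" and Q: "quotient_graph f G = H" using f by (auto simp: contracts_onto_iff)
  have cg: "connected_fibers g H" and T: "quotient_graph g H = T" using g by (auto simp: contracts_onto_iff)
  have "connected_graph (induced G (fiber (g \<circ> f) (verts G) y))" if "y \<in> (g \<circ> f) ` verts G" for y
  proof -
    let ?S = "fiber g (verts H) y"
    have vH: "verts H = f ` verts G" using Q by auto
    have "connected_graph (induced (quotient_graph f G) ?S)"
      using cg that unfolding connected_fibers_def Q vH by auto
    moreover have "?S \<subseteq> f ` verts G" using vH by (auto simp: fiber_def)
    ultimately have "connected_graph (induced G {x \<in> verts G. f x \<in> ?S})"
      using connected_preimage[OF s cf] by blast
    moreover have "{x \<in> verts G. f x \<in> ?S} = fiber (g \<circ> f) (verts G) y"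
      using vH by (auto simp: fiber_def)
    ultimately show ?thesis by simp
  qed
  then show ?thesis
    using Q T quotient_graph_comp[OF s, of g f] by (simp add: contracts_onto_iff connected_fibers_def)
qed

text \<open>The image of a connected set is connected, so the fibers of \<open>g\<close>, which are the images of the
  fibers of \<open>g \<circ> f\<close>, are connected.\<close>

lemma contracts_onto_factor:
  assumes s: "simple_graph G" and gf: "contracts_onto (g \<circ> f) G T"
  shows "contracts_onto g (quotient_graph f G) T"
proof -
  have "connected_graph (induced (quotient_graph f G) (fiber g (f ` verts G) y))"
    if "y \<in> g ` f ` verts G" for y
  proof -
    have "connected_graph (induced G (fiber (g \<circ> f) (verts G) y))"
      using gf that by (auto simp: contracts_onto_iff connected_fibers_def)
    then have "connected_graph (induced (quotient_graph f G) (f ` fiber (g \<circ> f) (verts G) y))"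
      by (rule connected_image[OF s])
    moreover have "f ` fiber (g \<circ> f) (verts G) y = fiber g (f ` verts G) y"
      by (auto simp: fiber_def)
    ultimately show ?thesis by simp
  qed
  then show ?thesis
    using gf quotient_graph_comp[OF s, of g f] by (simp add: contracts_onto_iff connected_fibers_def)
qed

definition cross_edges :: "('v \<Rightarrow> 'w) \<Rightarrow> 'v graph \<Rightarrow> 'v set set" where
  "cross_edges f G = {e \<in> edges G. card (f ` e) = 2}"

lemma edges_quotient_cross: "edges (quotient_graph f G) = (`) f ` cross_edges f G"
  by (auto simp: edges_quotient cross_edges_def)

lemma card_verts_fibers:
  "finite V \<Longrightarrow> (\<Sum>y\<in>f ` V. card (fiber f V y)) = card V"
  using sum.image_gen[of V "\<lambda>_. 1::nat" f] by (simp add: fiber_def)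

lemma edges_split_fibers:
  assumes "simple_graph G"
  shows "edges G - cross_edges f G = (\<Union>y\<in>f ` verts G. {e \<in> edges G. e \<subseteq> fiber f (verts G) y})"
proof (intro equalityI subsetI)
  fix e assume e: "e \<in> edges G - cross_edges f G"
  then obtain u v where uv: "e = {u, v}" "u \<in> verts G" "v \<in> verts G"
    using simple_edgeE[OF assms, of e] by blast
  then have "f u = f v" using e by (auto simp: cross_edges_def card_insert_if split: if_splits)
  then show "e \<in> (\<Union>y\<in>f ` verts G. {e \<in> edges G. e \<subseteq> fiber f (verts G) y})"
    using e uv by (auto simp: fiber_def)
next
  fix e assume "e \<in> (\<Union>y\<in>f ` verts G. {e \<in> edges G. e \<subseteq> fiber f (verts G) y})"
  then obtain y where e: "e \<in> edges G" "e \<subseteq> fiber f (verts G) y" by auto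
  then have "f ` e \<subseteq> {y}" by (auto simp: fiber_def)
  then have "card (f ` e) \<le> card {y}" by (intro card_mono) auto
  then show "e \<in> edges G - cross_edges f G" using e by (auto simp: cross_edges_def)
qed

lemma card_edges_fibers:
  assumes s: "simple_graph G"
  shows "card (edges G) = card (cross_edges f G) +
    (\<Sum>y\<in>f ` verts G. card {e \<in> edges G. e \<subseteq> fiber f (verts G) y})"
proof -
  have finE: "finite (edges G)" using s by (rule simple_finite_edges)
  have finV: "finite (verts G)" using s by (simp add: simple_graph_def)
  have "disjoint_family_on (\<lambda>y. {e \<in> edges G. e \<subseteq> fiber f (verts G) y}) (f ` verts G)"
    unfolding disjoint_family_on_def
  proof (intro ballI impI equals0I)
    fix y z e assume "y \<noteq> z"
      and e: "e \<in> {e \<in> edges G. e \<subseteq> fiber f (verts G) y} \<inter> {e \<in> edges G. e \<subseteq> fiber f (verts G) z}"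
    then have "card e = 2" using simple_card_edge[OF s] by blast
    then obtain u where "u \<in> e" by fastforce
    then show False using e \<open>y \<noteq> z\<close> by (auto simp: fiber_def)
  qed
  then have "card (edges G - cross_edges f G) =
      (\<Sum>y\<in>f ` verts G. card {e \<in> edges G. e \<subseteq> fiber f (verts G) y})"
    unfolding edges_split_fibers[OF s] using finE finV
    by (intro card_UN_disjoint) (auto simp: disjoint_family_on_def)
  moreover have "card (edges G) = card (cross_edges f G) + card (edges G - cross_edges f G)"
    using finE by (subst card_Un_disjoint[symmetric])
      (auto simp: cross_edges_def intro!: arg_cong[of _ _ card])
  ultimately show ?thesis by simp
qed

text \<open>Each connected fiber of size \<open>b\<close> uses up at least \<open>b - 1\<close> of the edges.\<close>

lemma card_cross_edges_le:
  assumes t: "is_tree G" and cf: "connected_fibers f G"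
  shows "card (cross_edges f G) + 1 \<le> card (f ` verts G)"
proof -
  let ?V = "verts G"
  have s: "simple_graph G" using t by (simp add: is_tree_def)
  then have finV: "finite ?V" by (simp add: simple_graph_def)
  have le: "card (fiber f ?V y) \<le> card {e \<in> edges G. e \<subseteq> fiber f ?V y} + 1" if "y \<in> f ` ?V" for y
    using connected_card_le[OF simple_induced[OF s, of "fiber f ?V y"]] cf that
    by (auto simp: connected_fibers_def fiber_def)
  have "card ?V = (\<Sum>y\<in>f ` ?V. card (fiber f ?V y))" using card_verts_fibers[OF finV] by metis
  also have "\<dots> \<le> (\<Sum>y\<in>f ` ?V. card {e \<in> edges G. e \<subseteq> fiber f ?V y} + 1)"
    by (intro sum_mono le)
  also have "\<dots> = (\<Sum>y\<in>f ` ?V. card {e \<in> edges G. e \<subseteq> fiber f ?V y}) + card (f ` ?V)"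
    by (simp only: sum.distrib) simp
  finally show ?thesis
    using card_edges_fibers[OF s, of f] t by (simp add: is_tree_iff_card)
qed

text \<open>The quotient by \<open>w\<close> connected fibers is connected, so it has at least \<open>w - 1\<close> edges, while at most
  \<open>w - 1\<close> edges of the tree run between different fibers. Hence both bounds are equalities: the
  quotient is a tree, and no two edges of \<open>G\<close> are mapped to the same edge of it.\<close>

lemma quotient_tree:
  assumes t: "is_tree G" and cf: "connected_fibers f G"
  shows "is_tree (quotient_graph f G)"
    and "inj_on ((`) f) (cross_edges f G)"
    and "card (cross_edges f G) + 1 = card (f ` verts G)"
proof -
  let ?Q = "quotient_graph f G"
  have s: "simple_graph G" and c: "connected_graph G" using t by (auto simp: is_tree_def)
  have sQ: "simple_graph ?Q" and cQ: "connected_graph ?Q"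
    using s c simple_quotient connected_quotient by auto
  have fin: "finite (cross_edges f G)"
    using simple_finite_edges[OF s] by (simp add: cross_edges_def)
  have "card (edges ?Q) \<le> card (cross_edges f G)"
    unfolding edges_quotient_cross using fin by (rule card_image_le)
  moreover have "card (f ` verts G) \<le> card (edges ?Q) + 1"
    using connected_card_le[OF sQ cQ] by simp
  moreover note card_cross_edges_le[OF assms]
  ultimately have eq: "card (edges ?Q) = card (cross_edges f G)"
    "card (edges ?Q) + 1 = card (f ` verts G)" by auto
  then show "is_tree ?Q" using sQ cQ by (simp add: is_tree_iff_card)
  show "inj_on ((`) f) (cross_edges f G)"
    using eq(1) fin unfolding edges_quotient_cross by (intro eq_card_imp_inj_on) auto
  show "card (cross_edges f G) + 1 = card (f ` verts G)" using eq by simp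
qed

lemma tree_induced_connected:
  assumes t: "is_tree G" and "S \<subseteq> verts G" "connected_graph (induced G S)"
  shows "is_tree (induced G S)"
proof -
  have "simple_graph (induced G S)" using assms simple_induced by (auto simp: is_tree_def)
  moreover have "is_cycle (induced G S) xs \<Longrightarrow> is_cycle G xs" for xs
    by (auto simp: is_cycle_def)
  ultimately show ?thesis using assms by (auto simp: is_tree_def)
qed

section \<open>Trees with a prescribed contraction\<close>

definition pairs_over :: "('v \<Rightarrow> 'w) \<Rightarrow> 'v set \<Rightarrow> 'w set \<Rightarrow> 'v set set" where
  "pairs_over f M h = {e. e \<subseteq> M \<and> card e = 2 \<and> f ` e = h}"

lemma card_pairs_over:
  assumes "finite M" "card h = 2"
  shows "card (pairs_over f M h) = (\<Prod>x\<in>h. card (fiber f M x))"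
proof -
  obtain x y where h: "h = {x, y}" "x \<noteq> y" using assms(2) by (auto simp: card_2_iff)
  have "bij_betw (\<lambda>(i, j). {i, j}) (fiber f M x \<times> fiber f M y) (pairs_over f M h)"
  proof (rule bij_betw_imageI)
    show "inj_on (\<lambda>(i, j). {i, j}) (fiber f M x \<times> fiber f M y)"
      using h(2) by (auto simp: inj_on_def fiber_def doubleton_eq_iff)
    show "(\<lambda>(i, j). {i, j}) ` (fiber f M x \<times> fiber f M y) = pairs_over f M h"
    proof (intro equalityI subsetI)
      fix e assume "e \<in> (\<lambda>(i, j). {i, j}) ` (fiber f M x \<times> fiber f M y)"
      then show "e \<in> pairs_over f M h" using h
        by (auto simp: pairs_over_def fiber_def card_insert_if)
    next
      fix e assume e: "e \<in> pairs_over f M h"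
      then obtain i j where ij: "e = {i, j}" by (auto simp: pairs_over_def card_2_iff)
      then have "f i = x \<and> f j = y \<or> f i = y \<and> f j = x" "i \<in> M" "j \<in> M"
        using e h by (auto simp: pairs_over_def doubleton_eq_iff)
      then have "(i, j) \<in> fiber f M x \<times> fiber f M y \<or> (j, i) \<in> fiber f M x \<times> fiber f M y"
        by (auto simp: fiber_def)
      moreover have "e = (\<lambda>(i, j). {i, j}) (i, j)" "e = (\<lambda>(i, j). {i, j}) (j, i)"
        using ij by auto
      ultimately show "e \<in> (\<lambda>(i, j). {i, j}) ` (fiber f M x \<times> fiber f M y)"
        by blast
    qed
  qed
  then have "card (pairs_over f M h) = card (fiber f M x) * card (fiber f M y)"
    using bij_betw_same_card by (metis card_cartesian_product)
  then show ?thesis using h by simp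
qed

text \<open>A tree that contracts onto \<open>H\<close> is the same as a tree on each fiber together with one edge of the
  host above every edge of \<open>H\<close>; \<open>assemble\<close> and \<open>disassemble\<close> are the two directions of this
  correspondence.\<close>

definition trees_over :: "('v \<Rightarrow> 'w) \<Rightarrow> 'v set \<Rightarrow> 'w graph \<Rightarrow> 'v graph set" where
  "trees_over f M H = {U. is_tree U \<and> verts U = M \<and> contracts_onto f U H}"

definition assemble :: "'v set \<Rightarrow> 'w graph \<Rightarrow> ('w \<Rightarrow> 'v set set) \<times> ('w set \<Rightarrow> 'v set) \<Rightarrow> 'v graph" where
  "assemble M H = (\<lambda>(t, s). Graph M ((\<Union>x\<in>verts H. t x) \<union> s ` edges H))"

definition pieces :: "('v \<Rightarrow> 'w) \<Rightarrow> 'v set \<Rightarrow> 'w graph \<Rightarrow> (('w \<Rightarrow> 'v set set) \<times> ('w set \<Rightarrow> 'v set)) set" where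
  "pieces f M H = (\<Pi>\<^sub>E x\<in>verts H. {E. is_tree (Graph (fiber f M x) E)}) \<times> (\<Pi>\<^sub>E h\<in>edges H. pairs_over f M h)"

text \<open>The assembled graph is connected because its fibers and its quotient are, and it has
  \<open>\<Sum>(b\<^sub>x - 1) + (|H| - 1) = m - 1\<close> edges. The last two claims say that the pieces can be recovered.\<close>

lemma assemble_in_trees_over:
  assumes H: "is_tree H" and fin: "finite M" and f: "f ` M = verts H"
    and ts: "(t, s) \<in> pieces f M H"
  shows "assemble M H (t, s) \<in> trees_over f M H"
    and "\<And>x. x \<in> verts H \<Longrightarrow> {e \<in> edges (assemble M H (t, s)). e \<subseteq> fiber f M x} = t x"
    and "\<And>h. h \<in> edges H \<Longrightarrow> {e \<in> edges (assemble M H (t, s)). f ` e = h} = {s h}"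
proof -
  define U where "U = assemble M H (t, s)"
  have vU: "verts U = M" and eU: "edges U = (\<Union>x\<in>verts H. t x) \<union> s ` edges H"
    by (auto simp: U_def assemble_def)
  have sH: "simple_graph H" using H by (simp add: is_tree_def)
  have tt: "is_tree (Graph (fiber f M x) (t x))" if "x \<in> verts H" for x
    using ts that by (auto simp: pieces_def PiE_iff)
  have te: "e \<subseteq> fiber f M x" "card e = 2" "f ` e = {x}" if "x \<in> verts H" "e \<in> t x" for x e
  proof -
    have st: "simple_graph (Graph (fiber f M x) (t x))" using tt[OF that(1)] by (simp add: is_tree_def)
    then show *: "e \<subseteq> fiber f M x" using simple_edges_subset that(2) by fastforce
    show "card e = 2" using simple_card_edge[OF st] that(2) by simp
    then have "e \<noteq> {}" by auto
    then show "f ` e = {x}" using * by (auto simp: fiber_def)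
  qed
  have se: "s h \<subseteq> M" "card (s h) = 2" "f ` s h = h" "card h = 2" if "h \<in> edges H" for h
    using ts that simple_card_edge[OF sH] by (auto simp: pieces_def PiE_iff pairs_over_def)
  have fne: "fiber f M x \<noteq> {}" if "x \<in> verts H" for x using that[folded f] by (auto simp: fiber_def)
  show A: "{e \<in> edges (assemble M H (t, s)). e \<subseteq> fiber f M x} = t x" if x: "x \<in> verts H" for x
  proof (intro equalityI subsetI)
    fix e assume "e \<in> {e \<in> edges (assemble M H (t, s)). e \<subseteq> fiber f M x}"
    then have e: "e \<in> edges U" "f ` e \<subseteq> {x}" by (auto simp: U_def fiber_def)
    then have "card (f ` e) \<le> card {x}" by (intro card_mono) auto
    then have "e \<notin> s ` edges H" using se by fastforce
    then obtain y where "y \<in> verts H" "e \<in> t y" using e eU by auto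
    then show "e \<in> t x" using te(3)[of y e] e by auto
  next
    fix e assume "e \<in> t x"
    then show "e \<in> {e \<in> edges (assemble M H (t, s)). e \<subseteq> fiber f M x}"
      using te[OF x] x eU by (auto simp: U_def)
  qed
  show B: "{e \<in> edges (assemble M H (t, s)). f ` e = h} = {s h}" if h: "h \<in> edges H" for h
  proof -
    have "f ` e \<noteq> h" if "x \<in> verts H" "e \<in> t x" for x e
      using te(3)[OF that] se(4)[OF h] by auto
    then have "e = s h" if "e \<in> edges U" "f ` e = h" for e
      using that eU se(3) by auto
    then show ?thesis using se(3)[OF h] h eU by (auto simp: U_def)
  qed
  have sU: "simple_graph U"
  proof -
    have "e \<subseteq> M \<and> card e = 2" if "e \<in> edges U" for e
    proof (cases "e \<in> s ` edges H")
      case True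
      then show ?thesis using se by blast
    next
      case False
      then obtain x where x: "x \<in> verts H" "e \<in> t x" using \<open>e \<in> edges U\<close> eU by auto
      have "fiber f M x \<subseteq> M" by (auto simp: fiber_def)
      then show ?thesis using te(1,2)[OF x] by blast
    qed
    then have "\<exists>x y. e = {x, y} \<and> x \<in> M \<and> y \<in> M \<and> x \<noteq> y" if "e \<in> edges U" for e
      using that unfolding card_2_iff by (metis insert_subset)
    then show ?thesis using fin vU by (cases U) (auto simp: simple_graph_Graph)
  qed
  have ind: "induced U (fiber f M x) = Graph (fiber f M x) (t x)" if "x \<in> verts H" for x
    using A[OF that] by (simp add: induced_def U_def)
  have cf: "connected_fibers f U"
    unfolding connected_fibers_def vU f using ind tt by (auto simp: is_tree_def)
  have cross: "cross_edges f U = s ` edges H"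
    unfolding cross_edges_def eU using te(3) se by auto
  then have "edges (quotient_graph f U) = edges H"
    unfolding edges_quotient_cross using se(3) by (force simp: image_iff)
  then have Q: "quotient_graph f U = H"
    using f vU by (intro graph.expand) simp
  have cU: "connected_graph U"
    using connected_of_quotient[OF sU cf] Q H by (simp add: is_tree_def)
  have "inj_on s (edges H)" using se(3) by (metis inj_onI)
  then have "card (cross_edges f U) = card (edges H)" unfolding cross by (rule card_image)
  then have 1: "card (cross_edges f U) + 1 = card (verts H)" using H by (simp add: is_tree_iff_card)
  have 2: "card {e \<in> edges U. e \<subseteq> fiber f M x} + 1 = card (fiber f M x)" if "x \<in> verts H" for x
    using tt[OF that] A[OF that] by (simp add: is_tree_iff_card U_def)
  have "card M = (\<Sum>x\<in>verts H. card (fiber f M x))" using card_verts_fibers[OF fin, of f] f by simp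
  also have "\<dots> = (\<Sum>x\<in>verts H. card {e \<in> edges U. e \<subseteq> fiber f M x} + 1)"
    using 2 by simp
  also have "\<dots> = (\<Sum>x\<in>verts H. card {e \<in> edges U. e \<subseteq> fiber f M x}) + card (verts H)"
    by (simp only: sum.distrib) simp
  also have "\<dots> = card (edges U) + 1"
    using card_edges_fibers[OF sU, of f] 1 vU f by simp
  finally have "is_tree U" using sU cU vU by (simp add: is_tree_iff_card)
  then show "assemble M H (t, s) \<in> trees_over f M H"
    using vU cf Q by (simp add: trees_over_def contracts_onto_iff U_def)
qed

definition disassemble :: "('v \<Rightarrow> 'w) \<Rightarrow> 'v set \<Rightarrow> 'w graph \<Rightarrow> 'v graph \<Rightarrow> ('w \<Rightarrow> 'v set set) \<times> ('w set \<Rightarrow> 'v set)" where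
  "disassemble f M H U =
    ((\<lambda>x\<in>verts H. {e \<in> edges U. e \<subseteq> fiber f M x}), (\<lambda>h\<in>edges H. the_elem {e \<in> edges U. f ` e = h}))"

lemma disassemble_in_pieces:
  assumes H: "is_tree H" and f: "f ` M = verts H" and U: "U \<in> trees_over f M H"
  shows "disassemble f M H U \<in> pieces f M H" and "assemble M H (disassemble f M H U) = U"
proof -
  have tU: "is_tree U" and vU: "verts U = M" and cf: "connected_fibers f U"
    and Q: "quotient_graph f U = H"
    using U by (auto simp: trees_over_def contracts_onto_iff)
  have sU: "simple_graph U" using tU by (simp add: is_tree_def)
  have eH: "edges H = (`) f ` cross_edges f U" using edges_quotient_cross[of f U] Q by simp
  have sH: "simple_graph H" using H by (simp add: is_tree_def)
  have uniq: "\<exists>e. {e \<in> edges U. f ` e = h} = {e}" if h: "h \<in> edges H" for h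
  proof -
    obtain e where e: "e \<in> cross_edges f U" "f ` e = h" using h eH by auto
    have "e' = e" if "e' \<in> edges U" "f ` e' = h" for e'
    proof -
      have "e' \<in> cross_edges f U" using that simple_card_edge[OF sH h] by (simp add: cross_edges_def)
      then show ?thesis using quotient_tree(2)[OF tU cf] e that by (auto simp: inj_on_def)
    qed
    then have "{e \<in> edges U. f ` e = h} = {e}" using e by (auto simp: cross_edges_def)
    then show ?thesis by blast
  qed
  have el: "the_elem {e \<in> edges U. f ` e = h} \<in> edges U \<and> f ` the_elem {e \<in> edges U. f ` e = h} = h"
    if "h \<in> edges H" for h
  proof -
    obtain e where e: "{e \<in> edges U. f ` e = h} = {e}" using uniq[OF \<open>h \<in> edges H\<close>] by blast
    then have "e \<in> edges U" "f ` e = h" by auto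
    then show ?thesis unfolding e by simp
  qed
  have el_eq: "the_elem {e' \<in> edges U. f ` e' = f ` e} = e" if "e \<in> cross_edges f U" for e
  proof -
    have h: "f ` e \<in> edges H" using that eH by auto
    obtain e' where "{e' \<in> edges U. f ` e' = f ` e} = {e'}" using uniq[OF h] by blast
    moreover have "e \<in> {e' \<in> edges U. f ` e' = f ` e}" using that by (simp add: cross_edges_def)
    ultimately show ?thesis by simp
  qed
  have "is_tree (Graph (fiber f M x) {e \<in> edges U. e \<subseteq> fiber f M x})" if "x \<in> verts H" for x
  proof -
    have "connected_graph (induced U (fiber f M x))"
      using cf that f vU by (auto simp: connected_fibers_def)
    then have "is_tree (induced U (fiber f M x))"
      using tree_induced_connected[OF tU] vU by (auto simp: fiber_def)
    then show ?thesis by (simp add: induced_def)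
  qed
  moreover have "the_elem {e \<in> edges U. f ` e = h} \<in> pairs_over f M h" if "h \<in> edges H" for h
    using el[OF that] simple_card_edge[OF sU] simple_edges_subset[OF sU] vU
    by (auto simp: pairs_over_def)
  ultimately show "disassemble f M H U \<in> pieces f M H"
    by (auto simp: disassemble_def pieces_def)
  have "(\<lambda>h. the_elem {e \<in> edges U. f ` e = h}) ` edges H = cross_edges f U"
    unfolding eH using el_eq by (auto simp: image_iff)
  moreover have "(\<Union>x\<in>verts H. {e \<in> edges U. e \<subseteq> fiber f M x}) = edges U - cross_edges f U"
    using edges_split_fibers[OF sU, of f] vU f by simp
  moreover have "cross_edges f U \<subseteq> edges U" by (auto simp: cross_edges_def)
  ultimately show "assemble M H (disassemble f M H U) = U"
    using vU by (cases U) (auto simp: assemble_def disassemble_def)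
qed

text \<open>Cayley's formula contributes \<open>b\<^sub>x\<close> to the power \<open>b\<^sub>x - 2\<close> for every fiber. An edge
  \<open>xy\<close> of \<open>H\<close> has \<open>b\<^sub>x b\<^sub>y\<close> possible lifts, so that in the product over all edges every vertex
  \<open>x\<close> collects one factor \<open>b\<^sub>x\<close> for each edge at \<open>x\<close>.\<close>

theorem card_trees_over:
  assumes H: "is_tree H" and fin: "finite M" and f: "f ` M = verts H"
  shows "real (card (trees_over f M H)) =
    (\<Prod>x\<in>verts H. real (card (fiber f M x)) powi (int (card (fiber f M x)) - 2 + int (degree H x)))"
proof -
  let ?b = "\<lambda>x. card (fiber f M x)"
  have sH: "simple_graph H" using H by (simp add: is_tree_def)
  have finV: "finite (verts H)" and finE: "finite (edges H)"
    using sH simple_finite_edges[OF sH] by (auto simp: simple_graph_def)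
  have ne: "fiber f M x \<noteq> {}" "finite (fiber f M x)" if "x \<in> verts H" for x
    using that[folded f] fin by (auto simp: fiber_def)
  have "bij_betw (assemble M H) (pieces f M H) (trees_over f M H)"
  proof (rule bij_betw_byWitness[where f' = "disassemble f M H"])
    show "\<forall>a\<in>pieces f M H. disassemble f M H (assemble M H a) = a"
    proof
      fix a assume a: "a \<in> pieces f M H"
      obtain t s where ts: "a = (t, s)" by force
      note as = assemble_in_trees_over[OF H fin f a[unfolded ts]]
      have "t \<in> extensional (verts H)" "s \<in> extensional (edges H)"
        using a ts by (auto simp: pieces_def PiE_def)
      then show "disassemble f M H (assemble M H a) = a"
        unfolding ts disassemble_def
        by (auto simp: as(2,3) extensional_def restrict_def fun_eq_iff)
    qed
    show "\<forall>U\<in>trees_over f M H. assemble M H (disassemble f M H U) = U"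
      using disassemble_in_pieces[OF H f] by blast
    show "assemble M H ` pieces f M H \<subseteq> trees_over f M H"
      using assemble_in_trees_over(1)[OF H fin f] by auto
    show "disassemble f M H ` trees_over f M H \<subseteq> pieces f M H"
      using disassemble_in_pieces[OF H f] by blast
  qed
  then have "card (trees_over f M H) = card (pieces f M H)"
    using bij_betw_same_card by metis
  also have "\<dots> = (\<Prod>x\<in>verts H. card {E. is_tree (Graph (fiber f M x) E)}) *
      (\<Prod>h\<in>edges H. card (pairs_over f M h))"
    using finV finE by (simp add: pieces_def card_cartesian_product card_PiE)
  also have "(\<Prod>h\<in>edges H. card (pairs_over f M h)) = (\<Prod>h\<in>edges H. \<Prod>x\<in>{x\<in>verts H. x \<in> h}. ?b x)"
  proof (intro prod.cong refl)
    fix h assume h: "h \<in> edges H"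
    have "{x \<in> verts H. x \<in> h} = h" using simple_edges_subset[OF sH h] by auto
    then show "card (pairs_over f M h) = (\<Prod>x\<in>{x \<in> verts H. x \<in> h}. ?b x)"
      using card_pairs_over[OF fin simple_card_edge[OF sH h], of f] by simp
  qed
  also have "\<dots> = (\<Prod>x\<in>verts H. \<Prod>h\<in>{h \<in> edges H. x \<in> h}. ?b x)"
    by (rule prod.swap_restrict[OF finE finV])
  also have "\<dots> = (\<Prod>x\<in>verts H. ?b x ^ degree H x)" by (simp add: degree_def)
  finally have "real (card (trees_over f M H)) =
      (\<Prod>x\<in>verts H. real (card {E. is_tree (Graph (fiber f M x) E)}) * real (?b x) ^ degree H x)"
    by (simp add: prod.distrib)
  also have "\<dots> = (\<Prod>x\<in>verts H. real (?b x) powi (int (?b x) - 2 + int (degree H x)))"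
  proof (intro prod.cong refl)
    fix x assume x: "x \<in> verts H"
    have "real (?b x) \<noteq> 0" using ne[OF x] by simp
    then show "real (card {E. is_tree (Graph (fiber f M x) E)}) * real (?b x) ^ degree H x =
        real (?b x) powi (int (?b x) - 2 + int (degree H x))"
      using cayley_formula[OF ne(2,1)[OF x]] by (simp add: power_int_add)
  qed
  finally show ?thesis .
qed

section \<open>Counting tuples of displays\<close>

lemma prod_falling: "(\<Prod>i = 0..<k. N - i) = fact k * (N choose k)"
proof (induction k)
  case (Suc k)
  have "Suc k * (N choose Suc k) = (N - k) * (N choose k)"
    by (metis binomial_absorb_comp binomial_absorption)
  then have "fact (Suc k) * (N choose Suc k) = fact k * ((N - k) * (N choose k))"
    by (metis fact_Suc mult.assoc mult.left_commute of_nat_id)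
  then show ?case using Suc by (simp add: algebra_simps)
qed simp

lemma card_injective_tuples:
  assumes "finite D"
  shows "card {\<delta> \<in> {1..k} \<rightarrow>\<^sub>E D. inj_on \<delta> {1..k}} = fact k * (card D choose k)"
  using card_inj_on_subset_funcset[of "{1..k}" D "{1..k}"] assms by (simp add: prod_falling)

lemma finite_labeled_trees: "finite (labeled_trees m)"
proof (rule finite_subset)
  show "labeled_trees m \<subseteq> Graph {1..m} ` Pow (Pow {1..m})"
  proof
    fix U assume "U \<in> labeled_trees m"
    then have "U = Graph {1..m} (edges U)" "edges U \<subseteq> Pow {1..m}"
      using simple_edges_subset[of U] by (cases U; force simp: labeled_trees_def is_tree_def)+
    then show "U \<in> Graph {1..m} ` Pow (Pow {1..m})" by blast
  qed
qed simp

lemma finite_displays: "finite (displays n m T U)"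
proof (rule finite_subset)
  show "displays n m T U \<subseteq> Pow {1..m} \<times> ({1..m} \<rightarrow>\<^sub>E {1..m})"
  proof
    fix d assume "d \<in> displays n m T U"
    then have "fst d \<subseteq> {1..m}" "snd d \<in> {1..m} \<rightarrow>\<^sub>E fst d" by (auto simp: displays_def)
    then have "fst d \<in> Pow {1..m}" "snd d \<in> {1..m} \<rightarrow>\<^sub>E {1..m}"
      using PiE_mono[of "{1..m}" "\<lambda>_. fst d" "\<lambda>_. {1..m}"] by blast+
    then show "d \<in> Pow {1..m} \<times> ({1..m} \<rightarrow>\<^sub>E {1..m})" by (simp add: mem_Times_iff)
  qed
qed (simp add: finite_PiE)

lemma finite_display_tuples: "finite (display_tuples k n m T U)"
  by (rule finite_subset[of _ "{1..k} \<rightarrow>\<^sub>E displays n m T U"])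
     (auto simp: display_tuples_def finite_displays intro!: finite_PiE)

lemma card_all_display_tuples:
  "card (SIGMA U : labeled_trees m. display_tuples k n m T U) = fact k * Ck k n T m"
proof -
  have "card (display_tuples k n m T U) = fact k * (card (displays n m T U) choose k)" for U
    unfolding display_tuples_def by (rule card_injective_tuples[OF finite_displays])
  then show ?thesis
    by (simp add: card_SigmaI finite_labeled_trees finite_display_tuples Ck_def display_count_def
        sum_distrib_left)
qed

section \<open>Survivors and labels of a display\<close>

lemma rank_in_less:
  assumes "finite R" "s \<in> R" "r < s"
  shows "rank_in R r < rank_in R s"
proof -
  have "{t \<in> R. t \<le> r} \<subset> {t \<in> R. t \<le> s}"
  proof
    show "{t \<in> R. t \<le> r} \<noteq> {t \<in> R. t \<le> s}"
      using assms(2,3) by (metis (mono_tags, lifting) le_refl linorder_not_le mem_Collect_eq)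
  qed (use assms(3) in auto)
  then show ?thesis unfolding rank_in_def using assms(1) by (intro psubset_card_mono) auto
qed

lemma rank_in_inj: "finite R \<Longrightarrow> inj_on (rank_in R) R"
  by (metis inj_onI linorder_neqE_nat nat_less_le rank_in_less)

lemma rank_in_image: "finite R \<Longrightarrow> rank_in R ` R = {1..card R}"
proof -
  assume fin: "finite R"
  have "rank_in R r \<in> {1..card R}" if "r \<in> R" for r
  proof -
    have "{s \<in> R. s \<le> r} \<noteq> {}" using that by auto
    then show ?thesis using fin by (auto simp: rank_in_def card_gt_0_iff Suc_le_eq intro!: card_mono)
  qed
  then show ?thesis
    using fin card_image[OF rank_in_inj[OF fin]] by (intro card_subset_eq) auto
qed

lemma rank_in_enumeration:
  assumes "strict_mono_on {1..n} g" "j \<in> {1..n}"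
  shows "rank_in (g ` {1..n}) (g j) = j"
proof -
  have "{s \<in> g ` {1..n}. s \<le> g j} = g ` {1..j}"
    using assms strict_mono_on_leD[OF assms(1)] strict_mono_onD[OF assms(1)] 
    by (auto simp: image_iff) (metis atLeastAtMost_iff linorder_not_le)+
  moreover have "inj_on g {1..j}"
    by (rule inj_on_subset[OF strict_mono_on_imp_inj_on[OF assms(1)]]) (use assms(2) in auto)
  ultimately show ?thesis by (simp add: rank_in_def card_image)
qed

text \<open>\<open>survivor d j\<close> is \<open>r\<^sub>j\<close> when the survivors of \<open>d\<close> are \<open>r\<^sub>1 < \<dots> < r\<^sub>n\<close>, and
  \<open>label d x\<close> is the target vertex onto which the display contracts the host vertex \<open>x\<close>.\<close>

definition survivor :: "nat set \<times> (nat \<Rightarrow> nat) \<Rightarrow> nat \<Rightarrow> nat" where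
  "survivor d j = inv_into (fst d) (rank_in (fst d)) j"

definition label :: "nat set \<times> (nat \<Rightarrow> nat) \<Rightarrow> nat \<Rightarrow> nat" where
  "label d x = rank_in (fst d) (snd d x)"

lemma survivor_in: "finite (fst d) \<Longrightarrow> j \<in> {1..card (fst d)} \<Longrightarrow> survivor d j \<in> fst d"
  unfolding survivor_def by (intro inv_into_into) (simp add: rank_in_image)

lemma rank_survivor: "finite (fst d) \<Longrightarrow> j \<in> {1..card (fst d)} \<Longrightarrow> rank_in (fst d) (survivor d j) = j"
  unfolding survivor_def by (intro f_inv_into_f) (simp add: rank_in_image)

lemma survivor_rank: "finite (fst d) \<Longrightarrow> r \<in> fst d \<Longrightarrow> survivor d (rank_in (fst d) r) = r"
  unfolding survivor_def by (simp add: inv_into_f_f rank_in_inj)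

lemma survivor_strict_mono:
  assumes "finite (fst d)"
  shows "strict_mono_on {1..card (fst d)} (survivor d)"
proof (rule strict_mono_onI)
  fix i j assume ij: "i \<in> {1..card (fst d)}" "j \<in> {1..card (fst d)}" "i < j"
  show "survivor d i < survivor d j"
  proof (rule ccontr)
    assume "\<not> survivor d i < survivor d j"
    then have "rank_in (fst d) (survivor d j) \<le> rank_in (fst d) (survivor d i)"
      using rank_in_less[OF assms survivor_in[OF assms ij(1)], of "survivor d j"]
      by (cases "survivor d j = survivor d i") auto
    then show False using ij rank_survivor[OF assms] by simp
  qed
qed

lemma survivor_enumeration:
  assumes "strict_mono_on {1..n} g" "j \<in> {1..n}" "fst d = g ` {1..n}"
  shows "survivor d j = g j"
  using survivor_rank[of d "g j"] rank_in_enumeration[OF assms(1,2)] assms by simp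

text \<open>Ranks are injective on the survivors, so the fibers of the retraction are those of the
  labeling, and a display is a contraction of the host onto the target with a chosen representative
  in each fiber.\<close>

lemma displays_iff:
  assumes "verts U = {1..m}"
  shows "d \<in> displays n m T U \<longleftrightarrow>
    fst d \<subseteq> {1..m} \<and> card (fst d) = n \<and> snd d \<in> {1..m} \<rightarrow>\<^sub>E fst d \<and> (\<forall>r\<in>fst d. snd d r = r) \<and>
    contracts_onto (label d) U T"
proof -
  obtain R q where d: "d = (R, q)" by force
  have "contracts_onto (label d) U T \<longleftrightarrow>
      (\<forall>r \<in> R. connected_graph (induced U {x \<in> {1..m}. q x = r})) \<and>
      quotient_graph (\<lambda>x. rank_in R (q x)) U = T"
    if R: "R \<subseteq> {1..m}" and q: "q \<in> {1..m} \<rightarrow>\<^sub>E R" and ret: "\<forall>r \<in> R. q r = r"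
  proof -
    have fin: "finite R" using R finite_subset by blast
    have lab: "label d = (\<lambda>x. rank_in R (q x))" by (simp add: label_def d fun_eq_iff)
    have "q ` {1..m} = R"
    proof
      show "q ` {1..m} \<subseteq> R" using q by auto
      show "R \<subseteq> q ` {1..m}" using R ret by (metis image_iff subset_iff)
    qed
    then have im: "label d ` verts U = rank_in R ` R" using assms lab by (metis image_image)
    have "fiber (label d) (verts U) (rank_in R r) = {x \<in> {1..m}. q x = r}" if "r \<in> R" for r
    proof -
      have "rank_in R (q x) = rank_in R r \<longleftrightarrow> q x = r" if "x \<in> {1..m}" for x
        using inj_on_eq_iff[OF rank_in_inj[OF fin]] \<open>r \<in> R\<close> PiE_mem[OF q that] by blast
      then show ?thesis unfolding fiber_def lab assms by blast
    qed
    then have "connected_fibers (label d) U \<longleftrightarrow>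
        (\<forall>r \<in> R. connected_graph (induced U {x \<in> {1..m}. q x = r}))"
      unfolding connected_fibers_def im by simp
    then show ?thesis by (simp add: contracts_onto_iff lab)
  qed
  then show ?thesis by (auto simp: displays_def d)
qed

section \<open>The common contraction of a tuple of displays\<close>

text \<open>A path along \<open>F\<close> never leaves its component. The map \<open>f\<close> may be any naming of the components;
  it is used for the components themselves and for their minimal elements.\<close>

lemma connected_fibers_of_components:
  assumes s: "simple_graph G" and F: "F \<subseteq> edges G"
    and f: "\<And>x y. x \<in> verts G \<Longrightarrow> y \<in> verts G \<Longrightarrow> f x = f y \<longleftrightarrow> (x, y) \<in> (adj F)\<^sup>*"
  shows "connected_fibers f G"
  unfolding connected_fibers_def
proof
  fix c assume "c \<in> f ` verts G"
  let ?S = "fiber f (verts G) c"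
  have path: "y \<in> verts G \<and> (x, y) \<in> (adj {e \<in> edges G. e \<subseteq> ?S})\<^sup>*"
    if "x \<in> ?S" "(x, y) \<in> (adj F)\<^sup>*" for x y
    using that(2)
  proof (induction rule: rtrancl_induct)
    case base
    then show ?case using that by (simp add: fiber_def)
  next
    case (step y z)
    have e: "{y, z} \<in> edges G" using step.hyps(2) F by auto
    then have V: "y \<in> verts G" "z \<in> verts G" using simple_edgeD[OF s] by blast+
    have xV: "x \<in> verts G" "f x = c" using that(1) by (auto simp: fiber_def)
    have "(x, z) \<in> (adj F)\<^sup>*" using step.hyps by (rule rtrancl_into_rtrancl)
    then have "f x = f y" "f x = f z" using f[OF xV(1) V(1)] f[OF xV(1) V(2)] step.hyps(1) by simp_all
    then have "(y, z) \<in> adj {e \<in> edges G. e \<subseteq> ?S}"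
      using e V xV by (auto simp: fiber_def)
    then show ?case using step.IH V by (auto intro: rtrancl_into_rtrancl)
  qed
  have "?S \<noteq> {}" using \<open>c \<in> f ` verts G\<close> by (auto simp: fiber_def)
  moreover have "(x, y) \<in> (adj {e \<in> edges G. e \<subseteq> ?S})\<^sup>*" if "x \<in> ?S" "y \<in> ?S" for x y
  proof -
    have "(x, y) \<in> (adj F)\<^sup>*" using that f[of x y] by (simp add: fiber_def)
    then show ?thesis using path[OF that(1)] by blast
  qed
  ultimately show "connected_graph (induced G ?S)" by (simp add: connected_graph_def)
qed

lemma constant_on_reach:
  assumes f: "\<And>x y. {x, y} \<in> F \<Longrightarrow> f x = f y"
    and "(x, y) \<in> (adj F)\<^sup>*"
  shows "f x = f y"
  using assms(2) by (induction rule: rtrancl_induct) (auto dest: f)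

locale display_tuple =
  fixes k n m :: nat and T U :: "nat graph" and \<delta> :: "nat \<Rightarrow> nat set \<times> (nat \<Rightarrow> nat)"
  assumes T: "T \<in> labeled_trees n" and U: "U \<in> labeled_trees m"
    and \<delta>: "\<delta> \<in> display_tuples k n m T U"
begin

abbreviation "F \<equiv> common_block_edges k U \<delta>"

lemma tree_U: "is_tree U" and verts_U: "verts U = {1..m}" and simple_U: "simple_graph U"
  using U by (auto simp: labeled_trees_def is_tree_def)

lemma verts_T: "verts T = {1..n}"
  using T by (simp add: labeled_trees_def)

lemma display: 
  assumes "a \<in> {1..k}"
  shows "\<delta> a \<in> displays n m T U"
    and "fst (\<delta> a) \<subseteq> {1..m}" and "card (fst (\<delta> a)) = n" and "finite (fst (\<delta> a))"
    and "snd (\<delta> a) \<in> {1..m} \<rightarrow>\<^sub>E fst (\<delta> a)" and "\<And>r. r \<in> fst (\<delta> a) \<Longrightarrow> snd (\<delta> a) r = r"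
    and "contracts_onto (label (\<delta> a)) U T"
proof -
  show *: "\<delta> a \<in> displays n m T U" using \<delta> assms by (auto simp: display_tuples_def)
  show R: "fst (\<delta> a) \<subseteq> {1..m}" and "card (fst (\<delta> a)) = n"
    and "snd (\<delta> a) \<in> {1..m} \<rightarrow>\<^sub>E fst (\<delta> a)" and "\<And>r. r \<in> fst (\<delta> a) \<Longrightarrow> snd (\<delta> a) r = r"
    and "contracts_onto (label (\<delta> a)) U T"
    using * unfolding displays_iff[OF verts_U] by blast+
  show "finite (fst (\<delta> a))" using R finite_subset by blast
qed

lemma display_in: "a \<in> {1..k} \<Longrightarrow> x \<in> {1..m} \<Longrightarrow> snd (\<delta> a) x \<in> fst (\<delta> a)"
  using display(5) by blast

lemma label_eq_iff:
  "a \<in> {1..k} \<Longrightarrow> x \<in> {1..m} \<Longrightarrow> y \<in> {1..m} \<Longrightarrow>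
    label (\<delta> a) x = label (\<delta> a) y \<longleftrightarrow> snd (\<delta> a) x = snd (\<delta> a) y"
  using rank_in_inj[OF display(4)] display_in by (auto simp: label_def inj_on_def)

lemma label_in: "a \<in> {1..k} \<Longrightarrow> x \<in> {1..m} \<Longrightarrow> label (\<delta> a) x \<in> {1..n}"
  using rank_in_image[OF display(4)] display_in display(3) by (fastforce simp: label_def)

lemma common_edge_iff:
  "{x, y} \<in> F \<longleftrightarrow> {x, y} \<in> edges U \<and> (\<forall>a\<in>{1..k}. label (\<delta> a) x = label (\<delta> a) y)"
proof -
  have "{x, y} \<in> F \<longleftrightarrow> {x, y} \<in> edges U \<and> (\<forall>a\<in>{1..k}. snd (\<delta> a) x = snd (\<delta> a) y)"
    by (auto simp: common_block_edges_def doubleton_eq_iff insert_commute)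
  then show ?thesis
    using label_eq_iff simple_edgeD(1,2)[OF simple_U, of x y] verts_U by auto
qed

lemma F_sub: "F \<subseteq> edges U"
  by (auto simp: common_block_edges_def)

lemma label_reach: "(x, y) \<in> (adj F)\<^sup>* \<Longrightarrow> a \<in> {1..k} \<Longrightarrow> label (\<delta> a) x = label (\<delta> a) y"
  by (rule constant_on_reach[of F]) (auto simp: common_edge_iff)

lemma card_cross_label:
  assumes a: "a \<in> {1..k}"
  shows "card (cross_edges (label (\<delta> a)) U) = n - 1"
proof -
  have cf: "connected_fibers (label (\<delta> a)) U" and Q: "quotient_graph (label (\<delta> a)) U = T"
    using display(7)[OF a] by (auto simp: contracts_onto_iff)
  have "label (\<delta> a) ` verts U = {1..n}" using Q verts_T verts_quotient by metis
  then show ?thesis using quotient_tree(3)[OF tree_U cf] by simp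
qed

text \<open>An edge that survives the common contraction is separated by one of the \<open>k\<close> displays, and
  each display separates \<open>n - 1\<close> edges, the number of edges of \<open>T\<close>.\<close>

lemma card_components_F: "card (components {1..m} F) \<le> k * (n - 1) + 1"
proof -
  have fin: "finite (edges U)" using simple_finite_edges[OF simple_U] .
  have "edges U - F \<subseteq> (\<Union>a\<in>{1..k}. cross_edges (label (\<delta> a)) U)"
  proof
    fix e assume e: "e \<in> edges U - F"
    then obtain x y where xy: "e = {x, y}" using simple_edgeE[OF simple_U, of e] by blast
    then obtain a where "a \<in> {1..k}" "label (\<delta> a) x \<noteq> label (\<delta> a) y"
      using e common_edge_iff by blast
    then have "e \<in> cross_edges (label (\<delta> a)) U"
      using e xy by (auto simp: cross_edges_def)
    then show "e \<in> (\<Union>a\<in>{1..k}. cross_edges (label (\<delta> a)) U)"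
      using \<open>a \<in> {1..k}\<close> by blast
  qed
  then have "card (edges U - F) \<le> card (\<Union>a\<in>{1..k}. cross_edges (label (\<delta> a)) U)"
    using fin by (intro card_mono) (auto simp: cross_edges_def)
  also have "\<dots> \<le> (\<Sum>a\<in>{1..k}. card (cross_edges (label (\<delta> a)) U))"
    by (rule card_UN_le) simp
  also have "\<dots> = k * (n - 1)" using card_cross_label by simp
  finally have 1: "card (edges U - F) \<le> k * (n - 1)" .
  have fU: "forest {1..m} (edges U)"
    using tree_U verts_U is_tree_iff_forest[of "{1..m}" "edges U"] by (cases U) simp
  then have "card (components {1..m} F) + card F = m"
    using forest_subset[OF fU F_sub] by (simp add: forest_def)
  moreover have "m = card (edges U) + 1" using tree_U verts_U by (simp add: is_tree_iff_card)
  moreover have "card (edges U - F) = card (edges U) - card F" "card F \<le> card (edges U)"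
    using F_sub fin by (auto simp: card_Diff_subset finite_subset card_mono)
  ultimately show ?thesis using 1 by linarith
qed

lemma contract_edges_eq: "contract_edges U F = quotient_graph (component {1..m} F) U"
proof -
  have "(\<lambda>x. {y \<in> verts U. (x, y) \<in> (adj F)\<^sup>*}) = component {1..m} F"
    by (rule ext) (simp add: component_def verts_U)
  then show ?thesis by (simp add: contract_edges_def)
qed

lemma contract_common_tree:
  "is_tree (contract_edges U F)"
  "card (verts (contract_edges U F)) \<le> k * (n - 1) + 1"
proof -
  have "connected_fibers (component {1..m} F) U"
    using connected_fibers_of_components[OF simple_U F_sub] component_eq_iff verts_U by metis
  then show "is_tree (contract_edges U F)"
    unfolding contract_edges_eq using quotient_tree(1)[OF tree_U] by blast
  show "card (verts (contract_edges U F)) \<le> k * (n - 1) + 1"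
    using card_components_F by (simp add: contract_edges_eq verts_U components_def)
qed

end

section \<open>Lift counts as numbers of lifts\<close>

text \<open>A family of blocks indexed by the vertices of the underlying tree is encoded by the map
  \<open>f\<close> that sends every host vertex to the index of its block. A lift of a core to the host \<open>U\<close>
  is then a contraction of \<open>U\<close> onto the underlying tree with a compatible choice of survivors.\<close>

definition lift_maps :: "nat \<Rightarrow> nat \<Rightarrow> nat \<Rightarrow> 'v core \<Rightarrow> (nat \<Rightarrow> 'v) \<Rightarrow> (mark set \<Rightarrow> nat) set" where
  "lift_maps k n m \<Omega> f =
    {\<theta> \<in> mark_partition \<Omega> \<rightarrow>\<^sub>E {1..m}. inj_on \<theta> (mark_partition \<Omega>) \<and>
      (\<forall>C\<in>mark_partition \<Omega>. f (\<theta> C) = place \<Omega> C) \<and>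
      (\<forall>a\<in>{1..k}. strict_mono_on {1..n} (\<lambda>j. \<theta> (class_of (mark_partition \<Omega>) a j)))}"

definition lifts :: "nat \<Rightarrow> nat \<Rightarrow> nat \<Rightarrow> 'v core \<Rightarrow> nat graph \<Rightarrow> ((nat \<Rightarrow> 'v) \<times> (mark set \<Rightarrow> nat)) set" where
  "lifts k n m \<Omega> U =
    (SIGMA f : {f \<in> {1..m} \<rightarrow>\<^sub>E verts (underlying \<Omega>). contracts_onto f U (underlying \<Omega>)}.
       lift_maps k n m \<Omega> f)"

lemma bij_betw_block_families:
  "bij_betw (\<lambda>f. \<lambda>x\<in>V. fiber f {1..m} x) {f \<in> {1..m} \<rightarrow>\<^sub>E V. f ` {1..m} = V} (block_families V m)"
proof (rule bij_betw_imageI)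
  let ?B = "\<lambda>f. \<lambda>x\<in>V. fiber f {1..m} x"
  show "inj_on ?B {f \<in> {1..m} \<rightarrow>\<^sub>E V. f ` {1..m} = V}"
  proof (rule inj_onI)
    fix f g assume f: "f \<in> {f \<in> {1..m} \<rightarrow>\<^sub>E V. f ` {1..m} = V}"
      and g: "g \<in> {f \<in> {1..m} \<rightarrow>\<^sub>E V. f ` {1..m} = V}" and eq: "?B f = ?B g"
    show "f = g"
    proof (rule PiE_ext[of f "{1..m}" "\<lambda>_. V" g])
      fix i assume i: "i \<in> {1..m}"
      then have "f i \<in> V" using f by auto
      then have "fiber f {1..m} (f i) = fiber g {1..m} (f i)" using fun_cong[OF eq, of "f i"] by simp
      moreover have "i \<in> fiber f {1..m} (f i)" using i by (simp add: fiber_def)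
      ultimately have "i \<in> fiber g {1..m} (f i)" by simp
      then show "f i = g i" by (simp add: fiber_def)
    qed (use f g in auto)
  qed
  show "?B ` {f \<in> {1..m} \<rightarrow>\<^sub>E V. f ` {1..m} = V} = block_families V m"
  proof (intro equalityI subsetI)
    fix B assume "B \<in> ?B ` {f \<in> {1..m} \<rightarrow>\<^sub>E V. f ` {1..m} = V}"
    then obtain f where f: "f \<in> {1..m} \<rightarrow>\<^sub>E V" "f ` {1..m} = V" "B = ?B f" by auto
    have "fiber f {1..m} x \<noteq> {}" if "x \<in> V" for x using that f(2) by (auto simp: fiber_def)
    moreover have "disjoint_family_on B V" using f(3) by (auto simp: disjoint_family_on_def fiber_def)
    moreover have "(\<Union>x\<in>V. B x) = {1..m}"
      using f by (auto simp: fiber_def)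
    moreover have "B \<in> V \<rightarrow>\<^sub>E Pow {1..m}" using f(3) by (auto simp: fiber_def)
    ultimately show "B \<in> block_families V m" using f(3) by (simp add: block_families_def)
  next
    fix B assume "B \<in> block_families V m"
    then have B: "B \<in> V \<rightarrow>\<^sub>E Pow {1..m}" "\<And>x. x \<in> V \<Longrightarrow> B x \<noteq> {}" "disjoint_family_on B V"
      "(\<Union>x \<in> V. B x) = {1..m}"
      by (auto simp: block_families_def)
    define f where "f = (\<lambda>i\<in>{1..m}. THE x. x \<in> V \<and> i \<in> B x)"
    have f_eq: "f i = x" if "x \<in> V" "i \<in> B x" for i x
    proof -
      have "i \<in> {1..m}" using that B(4) by auto
      moreover have "(THE x. x \<in> V \<and> i \<in> B x) = x"
        using that B(3) by (intro the_equality) (auto simp: disjoint_family_on_def)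
      ultimately show ?thesis by (simp add: f_def)
    qed
    have ex: "\<exists>x\<in>V. i \<in> B x \<and> f i = x" if "i \<in> {1..m}" for i
      using that f_eq B(4) by blast
    have "f \<in> {1..m} \<rightarrow>\<^sub>E V" using ex by (auto simp: f_def)
    moreover have "f ` {1..m} = V"
    proof (intro equalityI subsetI)
      fix x assume x: "x \<in> V"
      then obtain i where "i \<in> B x" using B(2) by blast
      moreover have "i \<in> {1..m}" using B(4) x calculation by blast
      ultimately show "x \<in> f ` {1..m}" using f_eq[OF x] by blast
    qed (use ex in auto)
    moreover have "B = ?B f"
    proof (rule extensionalityI[of _ V])
      fix x assume x: "x \<in> V"
      have "B x = fiber f {1..m} x"
        using ex f_eq[OF x] B(4) x by (auto simp: fiber_def)
      then show "B x = ?B f x" using x by simp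
    qed (use B(1) in \<open>auto simp: PiE_def\<close>)
    ultimately show "B \<in> ?B ` {f \<in> {1..m} \<rightarrow>\<^sub>E V. f ` {1..m} = V}" by blast
  qed
qed

lemma finite_lift_maps: "finite (mark_partition \<Omega>) \<Longrightarrow> finite (lift_maps k n m \<Omega> f)"
  by (rule finite_subset[of _ "mark_partition \<Omega> \<rightarrow>\<^sub>E {1..m}"])
     (auto simp: lift_maps_def intro!: finite_PiE)

text \<open>For a fixed block family the product in \<open>L_rig\<close> counts the hosts that contract onto the
  underlying tree along these blocks. Exchanging the order of summation groups the pairs of a host
  and a lift by the host.\<close>

theorem L_rig_eq_card_lifts:
  assumes H: "is_tree (underlying \<Omega>)" and P: "finite (mark_partition \<Omega>)"
    and pl: "place \<Omega> \<in> mark_partition \<Omega> \<rightarrow> verts (underlying \<Omega>)"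
  shows "L_rig k n m \<Omega> = (\<Sum>U\<in>labeled_trees m. real (card (lifts k n m \<Omega> U)))"
proof -
  let ?H = "underlying \<Omega>" and ?M = "{1..m}"
  let ?V = "verts ?H"
  let ?Fs = "{f \<in> ?M \<rightarrow>\<^sub>E ?V. f ` ?M = ?V}"
  have finV: "finite ?V" using H by (simp add: is_tree_def simple_graph_def)
  then have finF: "finite ?Fs" by (simp add: finite_PiE)
  have lc: "lift_count k n m \<Omega> (\<lambda>x\<in>?V. fiber f ?M x) = card (lift_maps k n m \<Omega> f)" for f
    unfolding lift_count_def lift_maps_def Let_def
    by (intro arg_cong[of _ _ card] Collect_cong) (use pl in \<open>auto simp: fiber_def Pi_iff PiE_iff\<close>)
  have trees: "trees_over f ?M ?H = {U \<in> labeled_trees m. contracts_onto f U ?H}" for f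
    by (auto simp: trees_over_def labeled_trees_def)
  have "L_rig k n m \<Omega> = (\<Sum>f\<in>?Fs. real (lift_count k n m \<Omega> (\<lambda>x\<in>?V. fiber f ?M x)) *
        (\<Prod>x\<in>?V. real (card ((\<lambda>x\<in>?V. fiber f ?M x) x)) powi
          (int (card ((\<lambda>x\<in>?V. fiber f ?M x) x)) - 2 + int (degree ?H x))))"
    unfolding L_rig_def Let_def by (rule sum.reindex_bij_betw[OF bij_betw_block_families, symmetric])
  also have "\<dots> = (\<Sum>f\<in>?Fs. real (card (lift_maps k n m \<Omega> f)) * real (card (trees_over f ?M ?H)))"
  proof (rule sum.cong[OF refl])
    fix f assume "f \<in> ?Fs"
    then have "f ` ?M = ?V" by simp
    then show "real (lift_count k n m \<Omega> (\<lambda>x\<in>?V. fiber f ?M x)) *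
        (\<Prod>x\<in>?V. real (card ((\<lambda>x\<in>?V. fiber f ?M x) x)) powi
          (int (card ((\<lambda>x\<in>?V. fiber f ?M x) x)) - 2 + int (degree ?H x))) =
      real (card (lift_maps k n m \<Omega> f)) * real (card (trees_over f ?M ?H))"
      using card_trees_over[OF H, of ?M f] unfolding lc by (simp cong: prod.cong)
  qed
  also have "\<dots> = (\<Sum>f\<in>?Fs. \<Sum>U\<in>labeled_trees m.
      if contracts_onto f U ?H then real (card (lift_maps k n m \<Omega> f)) else 0)"
    unfolding trees using finite_labeled_trees
    by (intro sum.cong refl) (simp add: sum.If_cases Int_def)
  also have "\<dots> = (\<Sum>U\<in>labeled_trees m. \<Sum>f\<in>?Fs.
      if contracts_onto f U ?H then real (card (lift_maps k n m \<Omega> f)) else 0)"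
    by (rule sum.swap)
  also have "\<dots> = (\<Sum>U\<in>labeled_trees m. real (card (lifts k n m \<Omega> U)))"
  proof (rule sum.cong[OF refl])
    fix U assume "U \<in> labeled_trees m"
    then have vU: "verts U = ?M" by (simp add: labeled_trees_def)
    have eq: "{f \<in> ?M \<rightarrow>\<^sub>E ?V. contracts_onto f U ?H} = {f \<in> ?Fs. contracts_onto f U ?H}"
      using vU by (auto simp: contracts_onto_def)
    have "real (card (lifts k n m \<Omega> U)) =
        (\<Sum>f\<in>{f \<in> ?Fs. contracts_onto f U ?H}. real (card (lift_maps k n m \<Omega> f)))"
      unfolding lifts_def eq using finite_lift_maps[OF P]
      by (subst card_SigmaI[OF finite_subset[OF _ finF]]) auto
    also have "\<dots> = (\<Sum>f\<in>?Fs. if contracts_onto f U ?H then real (card (lift_maps k n m \<Omega> f)) else 0)"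
      using finF by (rule sum.inter_filter)
    finally show "(\<Sum>f\<in>?Fs. if contracts_onto f U ?H then real (card (lift_maps k n m \<Omega> f)) else 0) =
        real (card (lifts k n m \<Omega> U))" by simp
  qed
  finally show ?thesis .
qed

section \<open>Isomorphisms of cores\<close>

lemma is_coreD:
  assumes "is_core k n T \<Omega>"
  shows "is_tree (underlying \<Omega>)"
    and "proj \<Omega> \<in> {1..k} \<rightarrow>\<^sub>E (verts (underlying \<Omega>) \<rightarrow>\<^sub>E {1..n})"
    and "\<And>a. a \<in> {1..k} \<Longrightarrow> contracts_onto (proj \<Omega> a) (underlying \<Omega>) T"
    and "\<And>x y. {x, y} \<in> edges (underlying \<Omega>) \<Longrightarrow> \<exists>a\<in>{1..k}. proj \<Omega> a x \<noteq> proj \<Omega> a y"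
    and "partition_on ({1..k} \<times> {1..n}) (mark_partition \<Omega>)"
    and "place \<Omega> \<in> mark_partition \<Omega> \<rightarrow>\<^sub>E verts (underlying \<Omega>)"
    and "\<And>a j. a \<in> {1..k} \<Longrightarrow> j \<in> {1..n} \<Longrightarrow>
           proj \<Omega> a (place \<Omega> (class_of (mark_partition \<Omega>) a j)) = j"
    and "\<And>a. a \<in> {1..k} \<Longrightarrow> inj_on (class_of (mark_partition \<Omega>) a) {1..n}"
    and "\<And>a b. a \<in> {1..k} \<Longrightarrow> b \<in> {1..k} \<Longrightarrow> a \<noteq> b \<Longrightarrow> proj \<Omega> a \<noteq> proj \<Omega> b \<or>
           (\<exists>j\<in>{1..n}. class_of (mark_partition \<Omega>) a j \<noteq> class_of (mark_partition \<Omega>) b j)"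
  using assms unfolding is_core_def Let_def by blast+

lemma class_of_eq:
  assumes "partition_on M P" "C \<in> P" "(a, j) \<in> C"
  shows "class_of P a j = C"
  unfolding class_of_def
proof (rule the_equality)
  fix D assume "D \<in> P \<and> (a, j) \<in> D"
  then show "D = C" using assms partition_onD2[OF assms(1)] by (auto simp: disjoint_def)
qed (use assms in simp)

lemma class_of_in:
  assumes "partition_on M P" "(a, j) \<in> M"
  shows "class_of P a j \<in> P" "(a, j) \<in> class_of P a j"
proof -
  obtain C where "C \<in> P" "(a, j) \<in> C" using partition_onD1[OF assms(1)] assms(2) by blast
  then show "class_of P a j \<in> P" "(a, j) \<in> class_of P a j" using class_of_eq[OF assms(1)] by auto
qed

lemma class_cases:
  assumes "partition_on ({1..k} \<times> {1..n}) P" "C \<in> P"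
  obtains a j where "a \<in> {1..k}" "j \<in> {1..n}" "C = class_of P a j"
proof -
  have "C \<noteq> {}" "C \<subseteq> {1..k} \<times> {1..n}"
    using partition_onD3[OF assms(1)] partition_onD1[OF assms(1)] assms(2) by auto
  then obtain a j where "(a, j) \<in> C" "a \<in> {1..k}" "j \<in> {1..n}" by fast
  then show ?thesis using that class_of_eq[OF assms] by simp
qed

text \<open>What the formal properties of isomorphisms need from a core: edges and places lie in the
  vertex set, so that only the values of an isomorphism on the vertex set matter.\<close>

definition regular_core :: "'v core \<Rightarrow> bool" where
  "regular_core \<Omega> \<longleftrightarrow> simple_graph (underlying \<Omega>) \<and> place \<Omega> \<in> mark_partition \<Omega> \<rightarrow> verts (underlying \<Omega>)"

lemma is_core_regular: "is_core k n T \<Omega> \<Longrightarrow> regular_core \<Omega>"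
  using is_coreD(1,6)[of k n T \<Omega>] by (auto simp: regular_core_def is_tree_def)

lemma core_iso_bij: "core_iso k g \<Omega> \<Omega>' \<Longrightarrow> bij_betw g (verts (underlying \<Omega>)) (verts (underlying \<Omega>'))"
  by (simp add: core_iso_def graph_iso_def)

lemma core_iso_comp:
  assumes g: "core_iso k g \<Omega> \<Omega>'" and h: "core_iso k h \<Omega>' \<Omega>''"
  shows "core_iso k (h \<circ> g) \<Omega> \<Omega>''"
proof -
  have "(`) (h \<circ> g) ` edges (underlying \<Omega>) = (`) h ` (`) g ` edges (underlying \<Omega>)"
    by (simp add: image_image image_comp)
  moreover have "g x \<in> verts (underlying \<Omega>')" if "x \<in> verts (underlying \<Omega>)" for x
    using core_iso_bij[OF g] that by (auto simp: bij_betw_def)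
  ultimately show ?thesis
    using assms bij_betw_trans[OF core_iso_bij[OF g] core_iso_bij[OF h]]
    by (simp add: core_iso_def graph_iso_def)
qed

lemma core_iso_cong:
  assumes r: "regular_core \<Omega>" and eq: "\<And>x. x \<in> verts (underlying \<Omega>) \<Longrightarrow> g x = h x"
    and g: "core_iso k g \<Omega> \<Omega>'"
  shows "core_iso k h \<Omega> \<Omega>'"
proof -
  have "g ` e = h ` e" if "e \<in> edges (underlying \<Omega>)" for e
    using r simple_edges_subset[OF _ that] eq by (intro image_cong) (auto simp: regular_core_def)
  then have "(`) g ` edges (underlying \<Omega>) = (`) h ` edges (underlying \<Omega>)"
    by (rule image_cong[OF refl])
  moreover have "bij_betw h (verts (underlying \<Omega>)) (verts (underlying \<Omega>'))"
    using core_iso_bij[OF g] eq bij_betw_cong by metis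
  moreover have "place \<Omega> C \<in> verts (underlying \<Omega>)" if "C \<in> mark_partition \<Omega>" for C
    using r that by (auto simp: regular_core_def)
  ultimately show ?thesis
    using g eq by (simp add: core_iso_def graph_iso_def)
qed

lemma core_iso_inv:
  assumes r: "regular_core \<Omega>" and g: "core_iso k g \<Omega> \<Omega>'"
  shows "core_iso k (inv_into (verts (underlying \<Omega>)) g) \<Omega>' \<Omega>"
proof -
  let ?V = "verts (underlying \<Omega>)" and ?V' = "verts (underlying \<Omega>')"
  let ?h = "inv_into ?V g"
  have b: "bij_betw g ?V ?V'" using g by (rule core_iso_bij)
  have inv: "?h (g x) = x" if "x \<in> ?V" for x using b that by (simp add: bij_betw_inv_into_left)
  have "?h ` g ` e = e" if "e \<in> edges (underlying \<Omega>)" for e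
  proof -
    have "e \<subseteq> ?V" using r simple_edges_subset[OF _ that] by (auto simp: regular_core_def)
    then show ?thesis using inv by (force simp: image_image)
  qed
  then have "(`) ?h ` (`) g ` edges (underlying \<Omega>) = edges (underlying \<Omega>)"
    by (simp add: image_image)
  then have "(`) ?h ` edges (underlying \<Omega>') = edges (underlying \<Omega>)"
    using g by (simp add: core_iso_def graph_iso_def)
  moreover have "proj \<Omega> a (?h y) = proj \<Omega>' a y" if a: "a \<in> {1..k}" and y: "y \<in> ?V'" for a y
  proof -
    obtain x where "x \<in> ?V" "y = g x" using b y by (auto simp: bij_betw_def)
    then show ?thesis using g inv a by (simp add: core_iso_def)
  qed
  moreover have "?h (place \<Omega>' C) = place \<Omega> C" if "C \<in> mark_partition \<Omega>'" for C
  proof -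
    have "C \<in> mark_partition \<Omega>" using g that by (simp add: core_iso_def)
    moreover from this have "place \<Omega> C \<in> ?V" using r by (auto simp: regular_core_def)
    moreover have "place \<Omega>' C = g (place \<Omega> C)" using g calculation(1) by (simp add: core_iso_def)
    ultimately show ?thesis using inv by simp
  qed
  ultimately show ?thesis
    using g bij_betw_inv_into[OF b] by (simp add: core_iso_def graph_iso_def)
qed

definition core_isos :: "nat \<Rightarrow> 'v core \<Rightarrow> 'w core \<Rightarrow> ('v \<Rightarrow> 'w) set" where
  "core_isos k \<Omega> \<Omega>' = {g \<in> extensional (verts (underlying \<Omega>)). core_iso k g \<Omega> \<Omega>'}"

text \<open>Composition with a fixed isomorphism turns automorphisms into isomorphisms.\<close>

lemma card_core_isos:
  assumes r: "regular_core \<Omega>" and r': "regular_core \<Omega>'" and h: "core_iso k h \<Omega> \<Omega>'"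
  shows "card (core_isos k \<Omega> \<Omega>') = card (core_aut k \<Omega>')"
proof -
  let ?V = "verts (underlying \<Omega>)" and ?V' = "verts (underlying \<Omega>')"
  let ?i = "inv_into ?V h"
  have b: "bij_betw h ?V ?V'" using h by (rule core_iso_bij)
  have hi: "h (?i y) = y" "?i y \<in> ?V" if "y \<in> ?V'" for y
    using b that by (auto simp: bij_betw_inv_into_right bij_betw_def inv_into_into)
  have ih: "?i (h x) = x" "h x \<in> ?V'" if "x \<in> ?V" for x
    using b that by (auto simp: bij_betw_inv_into_left bij_betw_def)
  have "bij_betw (\<lambda>\<alpha>. \<lambda>x\<in>?V. \<alpha> (h x)) (core_aut k \<Omega>') (core_isos k \<Omega> \<Omega>')"
  proof (rule bij_betw_byWitness[where f' = "\<lambda>g. \<lambda>y\<in>?V'. g (?i y)"])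
    show "\<forall>\<alpha>\<in>core_aut k \<Omega>'. (\<lambda>y\<in>?V'. (\<lambda>x\<in>?V. \<alpha> (h x)) (?i y)) = \<alpha>"
      using hi by (auto simp: core_aut_def extensional_def restrict_def fun_eq_iff)
    show "\<forall>g\<in>core_isos k \<Omega> \<Omega>'. (\<lambda>x\<in>?V. (\<lambda>y\<in>?V'. g (?i y)) (h x)) = g"
      using ih by (auto simp: core_isos_def extensional_def restrict_def fun_eq_iff)
    show "(\<lambda>\<alpha>. \<lambda>x\<in>?V. \<alpha> (h x)) ` core_aut k \<Omega>' \<subseteq> core_isos k \<Omega> \<Omega>'"
    proof (rule image_subsetI)
      fix \<alpha> assume "\<alpha> \<in> core_aut k \<Omega>'"
      then have "core_iso k (\<alpha> \<circ> h) \<Omega> \<Omega>'" using core_iso_comp[OF h] by (auto simp: core_aut_def)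
      then have "core_iso k (\<lambda>x\<in>?V. \<alpha> (h x)) \<Omega> \<Omega>'"
        by (rule core_iso_cong[OF r, rotated]) simp
      then show "(\<lambda>x\<in>?V. \<alpha> (h x)) \<in> core_isos k \<Omega> \<Omega>'" by (simp add: core_isos_def)
    qed
    show "(\<lambda>g. \<lambda>y\<in>?V'. g (?i y)) ` core_isos k \<Omega> \<Omega>' \<subseteq> core_aut k \<Omega>'"
    proof (rule image_subsetI)
      fix g assume "g \<in> core_isos k \<Omega> \<Omega>'"
      then have "core_iso k (g \<circ> ?i) \<Omega>' \<Omega>'"
        using core_iso_comp[OF core_iso_inv[OF r h]] by (auto simp: core_isos_def)
      then have "core_iso k (\<lambda>y\<in>?V'. g (?i y)) \<Omega>' \<Omega>'"
        by (rule core_iso_cong[OF r', rotated]) simp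
      then show "(\<lambda>y\<in>?V'. g (?i y)) \<in> core_aut k \<Omega>'" by (simp add: core_aut_def)
    qed
  qed
  then show ?thesis using bij_betw_same_card by metis
qed

lemma core_iso_id: "core_iso k id \<Omega> \<Omega>"
  by (simp add: core_iso_def graph_iso_def)

lemma card_core_aut_pos:
  assumes "regular_core \<Omega>"
  shows "card (core_aut k \<Omega>) > 0"
proof -
  let ?V = "verts (underlying \<Omega>)"
  have "finite ?V" using assms by (simp add: regular_core_def simple_graph_def)
  moreover have "core_aut k \<Omega> \<subseteq> ?V \<rightarrow>\<^sub>E ?V"
    by (auto simp: core_aut_def core_iso_def graph_iso_def bij_betw_def PiE_def)
  ultimately have "finite (core_aut k \<Omega>)" by (meson finite_PiE finite_subset)
  moreover have "core_iso k (\<lambda>x\<in>?V. x) \<Omega> \<Omega>"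
    using core_iso_id by (rule core_iso_cong[OF assms, rotated]) simp
  then have "(\<lambda>x\<in>?V. x) \<in> core_aut k \<Omega>" by (simp add: core_aut_def)
  ultimately show ?thesis by (auto simp: card_gt_0_iff)
qed

section \<open>Finiteness of the set of isomorphism classes\<close>

lemma small_regular: "\<Omega> \<in> small_cores k n T \<Longrightarrow> regular_core \<Omega>"
  by (auto simp: small_cores_def intro: is_core_regular)

lemma equiv_isomorphic_cores: "equiv (small_cores k n T) (isomorphic_cores k n T)"
proof (rule equivI)
  show "isomorphic_cores k n T \<subseteq> small_cores k n T \<times> small_cores k n T"
    by (auto simp: isomorphic_cores_def)
  show "refl_on (small_cores k n T) (isomorphic_cores k n T)"
    using core_iso_id by (auto simp: refl_on_def isomorphic_cores_def)
  show "sym (isomorphic_cores k n T)"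
    using core_iso_inv small_regular by (fastforce simp: sym_def isomorphic_cores_def)
  show "trans (isomorphic_cores k n T)"
    using core_iso_comp unfolding trans_def isomorphic_cores_def by blast
qed

text \<open>A core with at most \<open>N\<close> vertices is isomorphic to one on an initial segment of \<open>{..<N}\<close>, of which
  there are finitely many because its edges and its partition lie in fixed finite sets and its maps are extensional.\<close>

definition relabel :: "nat \<Rightarrow> ('v \<Rightarrow> 'w) \<Rightarrow> 'v core \<Rightarrow> 'w core" where
  "relabel k g \<Omega> = Core
     (Graph (g ` verts (underlying \<Omega>)) ((`) g ` edges (underlying \<Omega>)))
     (\<lambda>a\<in>{1..k}. \<lambda>y\<in>g ` verts (underlying \<Omega>). proj \<Omega> a (inv_into (verts (underlying \<Omega>)) g y))
     (mark_partition \<Omega>)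
     (\<lambda>C\<in>mark_partition \<Omega>. g (place \<Omega> C))"

lemma core_iso_relabel:
  assumes "inj_on g (verts (underlying \<Omega>))"
  shows "core_iso k g \<Omega> (relabel k g \<Omega>)"
  using assms by (auto simp: core_iso_def relabel_def graph_iso_def bij_betw_def)

text \<open>Cores with equal relabeled copies are isomorphic, so the finitely many codes bound the
  number of classes.\<close>

lemma finite_core_classes: "finite (core_classes k n T)"
proof -
  let ?N = "k * (n - 1) + 1" and ?S = "small_cores k n T" and ?R = "isomorphic_cores k n T"
  let ?M = "{1..k} \<times> {1..n}"
  define num where "num \<Omega> = (SOME g. bij_betw g (verts (underlying \<Omega>)) {..<card (verts (underlying \<Omega>))})"
    for \<Omega> :: "nat core"
  define code where "code \<Omega> = relabel k (num \<Omega>) \<Omega>" for \<Omega>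
  let ?W = "(\<lambda>(V, E, p, P, b). Core (Graph V E) p P b) `
      (SIGMA V : Pow {..<?N}. Pow (Pow V) \<times> ({1..k} \<rightarrow>\<^sub>E (V \<rightarrow>\<^sub>E {1..n})) \<times>
        (SIGMA P : Pow (Pow ?M). P \<rightarrow>\<^sub>E V))"
  have fV: "finite V" if "V \<in> Pow {..<?N}" for V using that finite_subset by blast
  have fP: "finite P" if "P \<in> Pow (Pow ?M)" for P :: "mark set set"
    using that finite_subset[of P "Pow ?M"] by simp
  have "finite ?W"
    by (intro finite_imageI finite_SigmaI finite_cartesian_product finite_PiE)
       (use fV fP in auto)
  have num: "bij_betw (num \<Omega>) (verts (underlying \<Omega>)) {..<card (verts (underlying \<Omega>))}"
    if "\<Omega> \<in> ?S" for \<Omega>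
  proof -
    have "finite (verts (underlying \<Omega>))"
      using small_regular[OF that] by (simp add: regular_core_def simple_graph_def)
    then have "\<exists>g. bij_betw g (verts (underlying \<Omega>)) {..<card (verts (underlying \<Omega>))}"
      by (intro finite_same_card_bij) auto
    then show ?thesis unfolding num_def by (rule someI_ex)
  qed
  have code_W: "code \<Omega> \<in> ?W" if "\<Omega> \<in> ?S" for \<Omega>
  proof -
    have c: "is_core k n T \<Omega>" and le: "card (verts (underlying \<Omega>)) \<le> ?N"
      using that by (auto simp: small_cores_def)
    let ?g = "num \<Omega>" and ?V = "verts (underlying \<Omega>)"
    have inj: "inj_on ?g ?V" and im: "?g ` ?V = {..<card ?V}"
      using num[OF that] by (auto simp: bij_betw_def)
    have sub: "?g ` ?V \<in> Pow {..<?N}" using le by (auto simp: im)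
    have "e \<subseteq> ?V" if "e \<in> edges (underlying \<Omega>)" for e
      using is_core_regular[OF c] simple_edges_subset[OF _ that] by (auto simp: regular_core_def)
    then have E: "(`) ?g ` edges (underlying \<Omega>) \<in> Pow (Pow (?g ` ?V))" by blast
    have P: "mark_partition \<Omega> \<in> Pow (Pow ?M)"
      using partition_onD1[OF is_coreD(5)[OF c]] by auto
    have p: "(\<lambda>a\<in>{1..k}. \<lambda>y\<in>?g ` ?V. proj \<Omega> a (inv_into ?V ?g y)) \<in> {1..k} \<rightarrow>\<^sub>E (?g ` ?V \<rightarrow>\<^sub>E {1..n})"
    proof (intro restrict_PiE_iff[THEN iffD2] ballI)
      fix a y assume a: "a \<in> {1..k}" and "y \<in> ?g ` ?V"
      then have "inv_into ?V ?g y \<in> ?V" by (auto intro: inv_into_into)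
      moreover have "proj \<Omega> a \<in> ?V \<rightarrow>\<^sub>E {1..n}" using is_coreD(2)[OF c] a by blast
      ultimately show "proj \<Omega> a (inv_into ?V ?g y) \<in> {1..n}" by blast
    qed
    have b: "(\<lambda>C\<in>mark_partition \<Omega>. ?g (place \<Omega> C)) \<in> mark_partition \<Omega> \<rightarrow>\<^sub>E ?g ` ?V"
      using is_coreD(6)[OF c] by auto
    show ?thesis
      unfolding code_def relabel_def
      by (rule image_eqI[where x = "(?g ` ?V, (`) ?g ` edges (underlying \<Omega>),
          (\<lambda>a\<in>{1..k}. \<lambda>y\<in>?g ` ?V. proj \<Omega> a (inv_into ?V ?g y)), mark_partition \<Omega>,
          (\<lambda>C\<in>mark_partition \<Omega>. ?g (place \<Omega> C)))"]) (use sub E P p b in auto)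
  qed
  have rel: "(\<Omega>, \<Omega>') \<in> ?R" if "\<Omega> \<in> ?S" "\<Omega>' \<in> ?S" "code \<Omega> = code \<Omega>'" for \<Omega> \<Omega>'
  proof -
    have "core_iso k (num \<Omega>) \<Omega> (code \<Omega>)" "core_iso k (num \<Omega>') \<Omega>' (code \<Omega>')"
      using that num core_iso_relabel unfolding code_def bij_betw_def by blast+
    then have "core_iso k (inv_into (verts (underlying \<Omega>')) (num \<Omega>') \<circ> num \<Omega>) \<Omega> \<Omega>'"
      using core_iso_comp core_iso_inv[OF small_regular[OF that(2)]] that(3) by metis
    then show ?thesis using that by (auto simp: isomorphic_cores_def)
  qed
  have "finite ((\<lambda>\<Omega>. ?R `` {\<Omega>}) ` ?S)"
  proof (rule finite_subset)
    show "(\<lambda>\<Omega>. ?R `` {\<Omega>}) ` ?S \<subseteq> (\<lambda>w. ?R `` {SOME \<Omega>. \<Omega> \<in> ?S \<and> code \<Omega> = w}) ` ?W"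
    proof (rule image_subsetI)
      fix \<Omega> assume S: "\<Omega> \<in> ?S"
      define \<Omega>' where "\<Omega>' = (SOME \<Omega>'. \<Omega>' \<in> ?S \<and> code \<Omega>' = code \<Omega>)"
      have "\<Omega>' \<in> ?S \<and> code \<Omega>' = code \<Omega>" unfolding \<Omega>'_def by (rule someI) (use S in simp)
      then have "?R `` {\<Omega>} = ?R `` {\<Omega>'}"
        using equiv_class_eq[OF equiv_isomorphic_cores] rel S by metis
      then show "?R `` {\<Omega>} \<in> (\<lambda>w. ?R `` {SOME \<Omega>. \<Omega> \<in> ?S \<and> code \<Omega> = w}) ` ?W"
        using code_W[OF S] by (intro image_eqI[where x = "code \<Omega>"]) (simp_all add: \<Omega>'_def)
    qed
  qed (use \<open>finite ?W\<close> in simp)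
  moreover have "core_classes k n T = (\<lambda>\<Omega>. ?R `` {\<Omega>}) ` ?S"
    by (auto simp: core_classes_def quotient_def)
  ultimately show ?thesis by simp
qed

section \<open>The tuple of displays given by a lift\<close>

text \<open>The host vertices \<open>\<theta> C\<^sub>a\<^sub>j\<close> become the survivors of the \<open>a\<close>-th display, and a vertex of the
  block of \<open>v\<close> is retracted to the survivor that represents the label of \<open>v\<close> in the \<open>a\<close>-th
  projection.\<close>

definition lift_display ::
  "nat \<Rightarrow> nat \<Rightarrow> nat \<Rightarrow> 'v core \<Rightarrow> (nat \<Rightarrow> 'v) \<times> (mark set \<Rightarrow> nat) \<Rightarrow> nat \<Rightarrow> nat set \<times> (nat \<Rightarrow> nat)" where
  "lift_display k n m \<Omega> = (\<lambda>(f, \<theta>). \<lambda>a\<in>{1..k}.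
     ((\<lambda>j. \<theta> (class_of (mark_partition \<Omega>) a j)) ` {1..n},
      \<lambda>x\<in>{1..m}. \<theta> (class_of (mark_partition \<Omega>) a (proj \<Omega> a (f x)))))"

lemma liftsD:
  assumes "(f, \<theta>) \<in> lifts k n m \<Omega> U"
  shows "f \<in> {1..m} \<rightarrow>\<^sub>E verts (underlying \<Omega>)" "contracts_onto f U (underlying \<Omega>)"
    "\<theta> \<in> mark_partition \<Omega> \<rightarrow>\<^sub>E {1..m}" "inj_on \<theta> (mark_partition \<Omega>)"
    "\<And>C. C \<in> mark_partition \<Omega> \<Longrightarrow> f (\<theta> C) = place \<Omega> C"
    "\<And>a. a \<in> {1..k} \<Longrightarrow> strict_mono_on {1..n} (\<lambda>j. \<theta> (class_of (mark_partition \<Omega>) a j))"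
  using assms by (auto simp: lifts_def lift_maps_def)

text \<open>The projections and the partition of the core can be read off from the displays of a lift:
  the labels are the values of the projections, and survivors agree exactly when their marks lie in
  the same class. Distinctness of the displays is then the condition that any two of them differ
  in the core.\<close>

lemma
  assumes core: "is_core k n T \<Omega>" and U: "U \<in> labeled_trees m"
    and l: "(f, \<theta>) \<in> lifts k n m \<Omega> U"
  shows survivor_lift: "\<And>a j. a \<in> {1..k} \<Longrightarrow> j \<in> {1..n} \<Longrightarrow>
      survivor (lift_display k n m \<Omega> (f, \<theta>) a) j = \<theta> (class_of (mark_partition \<Omega>) a j)"
    and label_lift: "\<And>a x. a \<in> {1..k} \<Longrightarrow> x \<in> {1..m} \<Longrightarrow>
      label (lift_display k n m \<Omega> (f, \<theta>) a) x = proj \<Omega> a (f x)"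
    and lift_display_tuple: "lift_display k n m \<Omega> (f, \<theta>) \<in> display_tuples k n m T U"
proof -
  let ?P = "mark_partition \<Omega>" and ?d = "lift_display k n m \<Omega> (f, \<theta>)" and ?V = "verts (underlying \<Omega>)"
  let ?g = "\<lambda>a j. \<theta> (class_of ?P a j)"
  note co = is_coreD[OF core] and li = liftsD[OF l]
  have sU: "simple_graph U" and vU: "verts U = {1..m}"
    using U by (auto simp: labeled_trees_def is_tree_def)
  have fst: "fst (?d a) = ?g a ` {1..n}" if "a \<in> {1..k}" for a
    using that by (simp add: lift_display_def)
  have snd: "snd (?d a) x = ?g a (proj \<Omega> a (f x))" if "a \<in> {1..k}" "x \<in> {1..m}" for a x
    using that by (simp add: lift_display_def)
  have pr: "proj \<Omega> a (f x) \<in> {1..n}" if "a \<in> {1..k}" "x \<in> {1..m}" for a x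
    using co(2) li(1) that by blast
  have cl: "class_of ?P a j \<in> ?P" if "a \<in> {1..k}" "j \<in> {1..n}" for a j
    using class_of_in(1)[OF co(5)] that by blast
  show sv: "survivor (?d a) j = ?g a j" if "a \<in> {1..k}" "j \<in> {1..n}" for a j
    using survivor_enumeration[OF li(6) that(2) fst] that(1) by blast
  show lab: "label (?d a) x = proj \<Omega> a (f x)" if "a \<in> {1..k}" "x \<in> {1..m}" for a x
    unfolding label_def fst[OF that(1)] snd[OF that]
    using rank_in_enumeration[OF li(6)[OF that(1)] pr[OF that]] .
  have disp: "?d a \<in> displays n m T U" if a: "a \<in> {1..k}" for a
    unfolding displays_iff[OF vU]
  proof (intro conjI ballI)
    show sub: "fst (?d a) \<subseteq> {1..m}" unfolding fst[OF a] using cl[OF a] li(3) by blast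
    show "card (fst (?d a)) = n" unfolding fst[OF a]
      using card_image[OF strict_mono_on_imp_inj_on[OF li(6)[OF a]]] by simp
    show "snd (?d a) \<in> {1..m} \<rightarrow>\<^sub>E fst (?d a)"
      using pr[OF a] a by (auto simp: lift_display_def)
    fix r assume "r \<in> fst (?d a)"
    then obtain j where j: "j \<in> {1..n}" "r = ?g a j" unfolding fst[OF a] by blast
    have "r \<in> {1..m}" using sub \<open>r \<in> fst (?d a)\<close> by blast
    then have "snd (?d a) r = ?g a (proj \<Omega> a (f r))" by (rule snd[OF a])
    also have "f r = place \<Omega> (class_of ?P a j)" unfolding j(2) by (rule li(5)[OF cl[OF a j(1)]])
    also have "proj \<Omega> a \<dots> = j" by (rule co(7)[OF a j(1)])
    finally show "snd (?d a) r = r" using j(2) by simp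
  next
    have "contracts_onto (proj \<Omega> a \<circ> f) U T"
      using contracts_onto_comp[OF sU li(2) co(3)[OF a]] .
    then show "contracts_onto (label (?d a)) U T"
      by (subst contracts_onto_cong[OF sU, of _ "proj \<Omega> a \<circ> f"]) (use lab[OF a] vU in simp_all)
  qed
  have "inj_on ?d {1..k}"
  proof (rule inj_onI, rule ccontr)
    fix a b assume a: "a \<in> {1..k}" and b: "b \<in> {1..k}" and eq: "?d a = ?d b" and "a \<noteq> b"
    have "proj \<Omega> a = proj \<Omega> b"
    proof (rule PiE_ext)
      show "proj \<Omega> a \<in> ?V \<rightarrow>\<^sub>E {1..n}" "proj \<Omega> b \<in> ?V \<rightarrow>\<^sub>E {1..n}" using co(2) a b by blast+
      fix v assume "v \<in> ?V"
      then obtain x where "x \<in> {1..m}" "v = f x"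
        using li(2) vU unfolding contracts_onto_def by blast
      then show "proj \<Omega> a v = proj \<Omega> b v" using lab a b eq by metis
    qed
    moreover have "class_of ?P a j = class_of ?P b j" if "j \<in> {1..n}" for j
    proof -
      have "?g a j = ?g b j" using sv[OF a that] sv[OF b that] eq by simp
      then show ?thesis using inj_onD[OF li(4)] cl[OF a that] cl[OF b that] by blast
    qed
    ultimately show False using co(9)[OF a b \<open>a \<noteq> b\<close>] by blast
  qed
  moreover have "?d \<in> {1..k} \<rightarrow>\<^sub>E displays n m T U"
    using disp by (auto simp: lift_display_def restrict_def PiE_iff extensional_def)
  ultimately show "?d \<in> display_tuples k n m T U" by (simp add: display_tuples_def)
qed

section \<open>The canonical core of a tuple of displays\<close>

text \<open>The intervals \<^term>\<open>{1..m}\<close> of hosts, marks and labels occur below inside the terms to be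
  rewritten; rewriting \<open>1\<close> to \<^term>\<open>Suc 0\<close> would hide them from the rewrite rules.\<close>

declare One_nat_def [simp del]

text \<open>Components are named by their minimal elements, so that the contracted tree has natural
  numbers as vertices, and its vertices are host vertices whose labels are at hand.\<close>

definition component_rep :: "nat set \<Rightarrow> nat set set \<Rightarrow> nat \<Rightarrow> nat" where
  "component_rep V E x = Min (component V E x)"

lemma component_rep_in: "finite V \<Longrightarrow> x \<in> V \<Longrightarrow> component_rep V E x \<in> component V E x"
  unfolding component_rep_def
  by (rule Min_in) (auto simp: component_def)

lemma component_rep:
  assumes "finite V" "x \<in> V"
  shows "component_rep V E x \<in> V" "(x, component_rep V E x) \<in> (adj E)\<^sup>*"
    "component_rep V E (component_rep V E x) = component_rep V E x"
    "y \<in> V \<Longrightarrow> component_rep V E x = component_rep V E y \<longleftrightarrow> (x, y) \<in> (adj E)\<^sup>*"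
proof -
  have in_comp: "component_rep V E z \<in> component V E z" if "z \<in> V" for z
    using component_rep_in[OF assms(1) that] .
  then show V: "component_rep V E x \<in> V" and r: "(x, component_rep V E x) \<in> (adj E)\<^sup>*"
    using assms(2) by (auto simp: component_def)
  have "component V E (component_rep V E x) = component V E x"
    using component_eqI[OF in_comp assms(2)] assms(2) by blast
  then show "component_rep V E (component_rep V E x) = component_rep V E x"
    by (simp add: component_rep_def)
  assume y: "y \<in> V"
  show "component_rep V E x = component_rep V E y \<longleftrightarrow> (x, y) \<in> (adj E)\<^sup>*"
  proof
    assume "component_rep V E x = component_rep V E y"
    then have "(y, component_rep V E x) \<in> (adj E)\<^sup>*"
      using in_comp[OF y] by (simp add: component_def)
    then show "(x, y) \<in> (adj E)\<^sup>*" using r by (meson reach_sym rtrancl_trans)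
  next
    assume "(x, y) \<in> (adj E)\<^sup>*"
    then have "component V E x = component V E y" using component_eq_iff[OF assms(2) y] by blast
    then show "component_rep V E x = component_rep V E y" by (simp add: component_rep_def)
  qed
qed

definition mark_survivor :: "(nat \<Rightarrow> nat set \<times> (nat \<Rightarrow> nat)) \<Rightarrow> mark \<Rightarrow> nat" where
  "mark_survivor \<delta> \<mu> = survivor (\<delta> (fst \<mu>)) (snd \<mu>)"

definition mark_class :: "nat \<Rightarrow> nat \<Rightarrow> (nat \<Rightarrow> nat set \<times> (nat \<Rightarrow> nat)) \<Rightarrow> nat \<Rightarrow> mark set" where
  "mark_class k n \<delta> r = {\<mu> \<in> {1..k} \<times> {1..n}. mark_survivor \<delta> \<mu> = r}"

text \<open>Marks are equivalent when their survivors are the same host vertex; \<open>class_survivor\<close> recovers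
  this vertex from the class.\<close>

definition survivor_partition :: "nat \<Rightarrow> nat \<Rightarrow> (nat \<Rightarrow> nat set \<times> (nat \<Rightarrow> nat)) \<Rightarrow> mark set set" where
  "survivor_partition k n \<delta> = mark_class k n \<delta> ` mark_survivor \<delta> ` ({1..k} \<times> {1..n})"

definition class_survivor :: "(nat \<Rightarrow> nat set \<times> (nat \<Rightarrow> nat)) \<Rightarrow> mark set \<Rightarrow> nat" where
  "class_survivor \<delta> C = the_elem (mark_survivor \<delta> ` C)"

text \<open>Contract the edges that lie in common blocks. The labels are constant on the contracted
  components and descend to the projections, and every survivor class is placed at the component
  of its host vertex.\<close>

definition canonical_core ::
  "nat \<Rightarrow> nat \<Rightarrow> nat \<Rightarrow> nat graph \<Rightarrow> (nat \<Rightarrow> nat set \<times> (nat \<Rightarrow> nat)) \<Rightarrow> nat core" where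
  "canonical_core k n m U \<delta> =
    (let rep = component_rep {1..m} (common_block_edges k U \<delta>) in
     Core (quotient_graph rep U)
       (\<lambda>a\<in>{1..k}. \<lambda>v\<in>rep ` verts U. label (\<delta> a) v)
       (survivor_partition k n \<delta>)
       (\<lambda>C\<in>survivor_partition k n \<delta>. rep (class_survivor \<delta> C)))"

lemma partition_survivor_partition:
  "partition_on ({1..k} \<times> {1..n}) (survivor_partition k n \<delta>)"
proof (rule partition_onI)
  show "\<Union> (survivor_partition k n \<delta>) = {1..k} \<times> {1..n}"
    unfolding survivor_partition_def mark_class_def by blast
  show "disjnt C D" if "C \<in> survivor_partition k n \<delta>" "D \<in> survivor_partition k n \<delta>" "C \<noteq> D" for C D
    using that by (auto simp: survivor_partition_def mark_class_def disjnt_def)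
  show "{} \<notin> survivor_partition k n \<delta>"
    unfolding survivor_partition_def mark_class_def by blast
qed

lemma class_of_survivor_partition:
  assumes "a \<in> {1..k}" "j \<in> {1..n}"
  shows "class_of (survivor_partition k n \<delta>) a j = mark_class k n \<delta> (survivor (\<delta> a) j)"
proof (rule class_of_eq[OF partition_survivor_partition])
  have m: "(a, j) \<in> {1..k} \<times> {1..n}" and s: "survivor (\<delta> a) j = mark_survivor \<delta> (a, j)"
    using assms by (auto simp: mark_survivor_def)
  then show "mark_class k n \<delta> (survivor (\<delta> a) j) \<in> survivor_partition k n \<delta>"
    unfolding survivor_partition_def by blast
  show "(a, j) \<in> mark_class k n \<delta> (survivor (\<delta> a) j)"
    using m s by (simp add: mark_class_def)
qed

lemma class_survivor_class_of:
  assumes "a \<in> {1..k}" "j \<in> {1..n}"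
  shows "class_survivor \<delta> (class_of (survivor_partition k n \<delta>) a j) = survivor (\<delta> a) j"
proof -
  have "mark_survivor \<delta> ` mark_class k n \<delta> (survivor (\<delta> a) j) = {survivor (\<delta> a) j}"
    using assms by (force simp: mark_class_def mark_survivor_def)
  then show ?thesis
    unfolding class_survivor_def class_of_survivor_partition[OF assms] by simp
qed

lemma class_of_survivor_eq_iff:
  assumes "a \<in> {1..k}" "j \<in> {1..n}" "b \<in> {1..k}" "l \<in> {1..n}"
  shows "class_of (survivor_partition k n \<delta>) a j = class_of (survivor_partition k n \<delta>) b l \<longleftrightarrow>
    survivor (\<delta> a) j = survivor (\<delta> b) l"
  by (metis assms class_of_survivor_partition class_survivor_class_of)

lemma partition_eq_of_class_of:
  assumes P: "partition_on ({1..k} \<times> {1..n}) P" and Q: "partition_on ({1..k} \<times> {1..n}) Q"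
    and eq: "\<And>a j b l. a \<in> {1..k} \<Longrightarrow> j \<in> {1..n} \<Longrightarrow> b \<in> {1..k} \<Longrightarrow> l \<in> {1..n} \<Longrightarrow>
      class_of P a j = class_of P b l \<longleftrightarrow> class_of Q a j = class_of Q b l"
  shows "P = Q"
proof -
  have cl: "class_of P a j = {(b, l) \<in> {1..k} \<times> {1..n}. class_of P b l = class_of P a j}"
    if P: "partition_on ({1..k} \<times> {1..n}) P" and aj: "(a, j) \<in> {1..k} \<times> {1..n}" for P a j
  proof -
    have "(b, l) \<in> class_of P a j \<longleftrightarrow> class_of P b l = class_of P a j"
      if "(b, l) \<in> {1..k} \<times> {1..n}" for b l
      using class_of_in[OF P that] class_of_in[OF P aj] class_of_eq[OF P] by metis
    moreover have "class_of P a j \<subseteq> {1..k} \<times> {1..n}"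
      using class_of_in(1)[OF P aj] partition_onD1[OF P] by blast
    ultimately show ?thesis by blast
  qed
  have same: "class_of P a j = class_of Q a j" if aj: "a \<in> {1..k}" "j \<in> {1..n}" for a j
  proof -
    have "class_of P a j = {(b, l) \<in> {1..k} \<times> {1..n}. class_of P b l = class_of P a j}"
      using cl[OF P] aj by blast
    also have "\<dots> = {(b, l) \<in> {1..k} \<times> {1..n}. class_of Q b l = class_of Q a j}"
      using eq[OF _ _ aj] by blast
    also have "\<dots> = class_of Q a j" using cl[OF Q, of a j] aj by blast
    finally show ?thesis .
  qed
  have img: "P = (\<lambda>(a, j). class_of P a j) ` ({1..k} \<times> {1..n})"
    if P: "partition_on ({1..k} \<times> {1..n}) P" for P
  proof (intro equalityI subsetI)
    fix C assume "C \<in> P"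
    then obtain a j where "a \<in> {1..k}" "j \<in> {1..n}" "C = class_of P a j" by (rule class_cases[OF P])
    then show "C \<in> (\<lambda>(a, j). class_of P a j) ` ({1..k} \<times> {1..n})" by blast
  qed (use class_of_in(1)[OF P] in auto)
  have "(\<lambda>(a, j). class_of P a j) ` ({1..k} \<times> {1..n}) = (\<lambda>(a, j). class_of Q a j) ` ({1..k} \<times> {1..n})"
    using same by (intro image_cong) auto
  then show ?thesis using img[OF P] img[OF Q] by simp
qed

context display_tuple
begin

abbreviation "rep \<equiv> component_rep {1..m} F"
abbreviation "\<Omega>\<^sub>0 \<equiv> canonical_core k n m U \<delta>"
abbreviation "P\<^sub>0 \<equiv> survivor_partition k n \<delta>"

lemma canonical_core_simps [simp]:
  "underlying \<Omega>\<^sub>0 = quotient_graph rep U"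
  "proj \<Omega>\<^sub>0 = (\<lambda>a\<in>{1..k}. \<lambda>v\<in>rep ` {1..m}. label (\<delta> a) v)"
  "mark_partition \<Omega>\<^sub>0 = P\<^sub>0"
  "place \<Omega>\<^sub>0 = (\<lambda>C\<in>P\<^sub>0. rep (class_survivor \<delta> C))"
  by (simp_all add: canonical_core_def Let_def verts_U)

lemmas rep = component_rep[where V = "{1..m}" and E = F, OF finite_atLeastAtMost]

lemma label_rep: "x \<in> {1..m} \<Longrightarrow> a \<in> {1..k} \<Longrightarrow> label (\<delta> a) (rep x) = label (\<delta> a) x"
  using label_reach[OF rep(2)] by simp

lemma survivor_mem: "a \<in> {1..k} \<Longrightarrow> j \<in> {1..n} \<Longrightarrow> survivor (\<delta> a) j \<in> fst (\<delta> a)"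
  using survivor_in display(3,4) by simp

lemma survivor_le_m: "a \<in> {1..k} \<Longrightarrow> j \<in> {1..n} \<Longrightarrow> survivor (\<delta> a) j \<in> {1..m}"
  using survivor_mem display(2) by blast

lemma survivor_mono: "a \<in> {1..k} \<Longrightarrow> strict_mono_on {1..n} (survivor (\<delta> a))"
  using survivor_strict_mono[of "\<delta> a"] display(3,4) by simp

lemma label_survivor: "a \<in> {1..k} \<Longrightarrow> j \<in> {1..n} \<Longrightarrow> label (\<delta> a) (survivor (\<delta> a) j) = j"
  using survivor_mem display(6) rank_survivor[of "\<delta> a" j] display(3,4) by (simp add: label_def)

lemma survivor_label: "a \<in> {1..k} \<Longrightarrow> x \<in> {1..m} \<Longrightarrow> survivor (\<delta> a) (label (\<delta> a) x) = snd (\<delta> a) x"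
  using survivor_rank[OF display(4)] display_in by (simp add: label_def)

lemma fst_display: "a \<in> {1..k} \<Longrightarrow> fst (\<delta> a) = survivor (\<delta> a) ` {1..n}"
  using survivor_rank[OF display(4)] rank_in_image[OF display(4)] display(3) survivor_mem
  by (auto simp: image_iff) (metis atLeastAtMost_iff image_eqI One_nat_def)

lemma class_survivor_mem:
  assumes "C \<in> P\<^sub>0"
  shows "class_survivor \<delta> C \<in> {1..m}"
  using class_cases[OF partition_survivor_partition assms] class_survivor_class_of survivor_le_m
  by metis

text \<open>The retraction sends a vertex to the survivor whose rank is its label, so survivors and labels
  determine a display, and the displays of the tuple are distinct.\<close>

lemma display_eqI:
  assumes a: "a \<in> {1..k}" and b: "b \<in> {1..k}"
    and s: "\<And>j. j \<in> {1..n} \<Longrightarrow> survivor (\<delta> a) j = survivor (\<delta> b) j"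
    and l: "\<And>x. x \<in> {1..m} \<Longrightarrow> label (\<delta> a) x = label (\<delta> b) x"
  shows "a = b"
proof -
  have f: "fst (\<delta> a) = fst (\<delta> b)" unfolding fst_display[OF a] fst_display[OF b] using s by simp
  have "snd (\<delta> a) = snd (\<delta> b)"
  proof (rule PiE_ext[OF display(5)[OF a]])
    show "snd (\<delta> b) \<in> {1..m} \<rightarrow>\<^sub>E fst (\<delta> a)" unfolding f by (rule display(5)[OF b])
    fix x assume x: "x \<in> {1..m}"
    then show "snd (\<delta> a) x = snd (\<delta> b) x"
      using survivor_label[OF a x] survivor_label[OF b x] s l[OF x] label_in[OF b x] by metis
  qed
  with f have "\<delta> a = \<delta> b" by (rule prod_eqI)
  moreover have "inj_on \<delta> {1..k}" using \<delta> by (simp add: display_tuples_def)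
  ultimately show ?thesis using a b by (simp add: inj_onD)
qed

lemma connected_fibers_rep: "connected_fibers rep U"
  by (rule connected_fibers_of_components[OF simple_U F_sub]) (use rep(4) verts_U in simp)

text \<open>The order of the classes is acyclic because it is compatible with the order of their
  survivors in the host. An edge of the contracted tree comes from an edge outside the
  common blocks, which some display separates.\<close>

lemma canonical_core_is_core: "is_core k n T \<Omega>\<^sub>0"
  unfolding is_core_def Let_def canonical_core_simps
proof (intro conjI ballI allI impI)
  let ?H = "quotient_graph rep U"
  have sH: "simple_graph ?H" using simple_quotient[OF simple_U] .
  have vH: "verts ?H = rep ` {1..m}" by (simp add: verts_U)
  have repV: "rep x \<in> rep ` {1..m}" if "x \<in> {1..m}" for x using that by blast
  show "is_tree ?H" using quotient_tree(1)[OF tree_U connected_fibers_rep] .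
  have lab_in: "label (\<delta> a) v \<in> {1..n}" if "a \<in> {1..k}" "v \<in> rep ` {1..m}" for a v
    using that label_in rep(1) by blast
  then show "(\<lambda>a\<in>{1..k}. \<lambda>v\<in>rep ` {1..m}. label (\<delta> a) v) \<in> {1..k} \<rightarrow>\<^sub>E (verts ?H \<rightarrow>\<^sub>E {1..n})"
    unfolding vH by simp
  show "contracts_onto ((\<lambda>a\<in>{1..k}. \<lambda>v\<in>rep ` {1..m}. label (\<delta> a) v) a) ?H T" if a: "a \<in> {1..k}" for a
  proof -
    have "contracts_onto (label (\<delta> a) \<circ> rep) U T"
      using contracts_onto_cong[OF simple_U, of "label (\<delta> a) \<circ> rep" "label (\<delta> a)"]
        label_rep a verts_U display(7)[OF a] by simp
    then have "contracts_onto (label (\<delta> a)) ?H T" by (rule contracts_onto_factor[OF simple_U])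
    then show ?thesis
      by (subst contracts_onto_cong[OF sH, of _ "label (\<delta> a)"]) (use a vH in simp_all)
  qed
  show "\<exists>a\<in>{1..k}. (\<lambda>a\<in>{1..k}. \<lambda>v\<in>rep ` {1..m}. label (\<delta> a) v) a x \<noteq>
      (\<lambda>a\<in>{1..k}. \<lambda>v\<in>rep ` {1..m}. label (\<delta> a) v) a y" if xy: "{x, y} \<in> edges ?H" for x y
  proof -
    obtain u v where uv: "{u, v} \<in> edges U" "rep u = x" "rep v = y" "x \<noteq> y"
      using xy quotient_edge_iff[OF simple_U] by metis
    have V: "u \<in> {1..m}" "v \<in> {1..m}" using simple_edgeD[OF simple_U uv(1)] verts_U by auto
    have "{u, v} \<notin> F"
    proof
      assume "{u, v} \<in> F"
      then have "(u, v) \<in> (adj F)\<^sup>*" by auto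
      then show False using rep(4)[OF V] uv by simp
    qed
    then obtain a where a: "a \<in> {1..k}" "label (\<delta> a) u \<noteq> label (\<delta> a) v"
      using uv(1) common_edge_iff by blast
    then have "label (\<delta> a) x \<noteq> label (\<delta> a) y" using label_rep V uv by metis
    then show ?thesis using a(1) V uv by (intro bexI[of _ a]) auto
  qed
  show "partition_on ({1..k} \<times> {1..n}) P\<^sub>0" by (rule partition_survivor_partition)
  show "(\<lambda>C\<in>P\<^sub>0. rep (class_survivor \<delta> C)) \<in> P\<^sub>0 \<rightarrow>\<^sub>E verts ?H"
    unfolding vH using class_survivor_mem by auto
  fix a assume a: "a \<in> {1..k}"
  show "inj_on (class_of P\<^sub>0 a) {1..n}"
  proof (rule inj_onI)
    fix i j assume ij: "i \<in> {1..n}" "j \<in> {1..n}" "class_of P\<^sub>0 a i = class_of P\<^sub>0 a j"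
    then have "survivor (\<delta> a) i = survivor (\<delta> a) j" using class_of_survivor_eq_iff a by metis
    then show "i = j" using label_survivor[OF a] ij by metis
  qed
  show "(\<lambda>a\<in>{1..k}. \<lambda>v\<in>rep ` {1..m}. label (\<delta> a) v) a ((\<lambda>C\<in>P\<^sub>0. rep (class_survivor \<delta> C)) (class_of P\<^sub>0 a j)) = j"
    if j: "j \<in> {1..n}" for j
  proof -
    have "class_of P\<^sub>0 a j \<in> P\<^sub>0" using class_of_in(1)[OF partition_survivor_partition] a j by blast
    then show ?thesis
      using a survivor_le_m[OF a j] by (simp add: class_survivor_class_of[OF a j] label_rep label_survivor[OF a j])
  qed
  fix b assume b: "b \<in> {1..k}" and ab: "a \<noteq> b"
  show "(\<lambda>a\<in>{1..k}. \<lambda>v\<in>rep ` {1..m}. label (\<delta> a) v) a \<noteq> (\<lambda>a\<in>{1..k}. \<lambda>v\<in>rep ` {1..m}. label (\<delta> a) v) b \<or>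
      (\<exists>j\<in>{1..n}. class_of P\<^sub>0 a j \<noteq> class_of P\<^sub>0 b j)"
  proof (rule ccontr)
    assume neg: "\<not> ?thesis"
    then have p: "(\<lambda>v\<in>rep ` {1..m}. label (\<delta> a) v) = (\<lambda>v\<in>rep ` {1..m}. label (\<delta> b) v)"
      using a b by simp
    have "a = b"
    proof (rule display_eqI[OF a b])
      show "survivor (\<delta> a) j = survivor (\<delta> b) j" if "j \<in> {1..n}" for j
        using neg class_of_survivor_eq_iff[OF a that b that] that by blast
      show "label (\<delta> a) x = label (\<delta> b) x" if x: "x \<in> {1..m}" for x
        using fun_cong[OF p, of "rep x"] repV[OF x] label_rep[OF x] a b by simp
    qed
    then show False using ab by simp
  qed
next
  have "class_order k n P\<^sub>0 \<subseteq> inv_image {(x, y). x < y} (class_survivor \<delta>)"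
  proof
    fix p assume "p \<in> class_order k n P\<^sub>0"
    then obtain a j where aj: "a \<in> {1..k}" "j \<in> {1..<n}"
      and p: "p = (class_of P\<^sub>0 a j, class_of P\<^sub>0 a (Suc j))"
      by (auto simp: class_order_def)
    then have j: "j \<in> {1..n}" "Suc j \<in> {1..n}" by auto
    have "survivor (\<delta> a) j < survivor (\<delta> a) (Suc j)"
      using strict_mono_onD[OF survivor_mono[OF aj(1)] j] by simp
    then show "p \<in> inv_image {(x, y). x < y} (class_survivor \<delta>)"
      by (simp add: p class_survivor_class_of[OF aj(1) j(1)] class_survivor_class_of[OF aj(1) j(2)])
  qed
  moreover have "acyclic (inv_image {(x, y :: nat). x < y} (class_survivor \<delta>))"
    by (intro wf_acyclic wf_inv_image wf)
  ultimately show "acyclic (class_order k n P\<^sub>0)" by (rule acyclic_subset[rotated])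
qed

text \<open>The bound on the number of vertices of the common contraction is the bound in the definition
  of the small cores.\<close>

lemma canonical_core_small: "\<Omega>\<^sub>0 \<in> small_cores k n T"
proof -
  have "bij_betw Min (components {1..m} F) (rep ` {1..m})"
  proof (rule bij_betw_imageI)
    show "inj_on Min (components {1..m} F)"
    proof (rule inj_onI)
      fix C D assume "C \<in> components {1..m} F" "D \<in> components {1..m} F" and eq: "Min C = Min D"
      then obtain x y where xy: "x \<in> {1..m}" "y \<in> {1..m}"
        "C = component {1..m} F x" "D = component {1..m} F y"
        by (auto simp: components_def)
      then have "rep x = rep y" using eq by (simp add: component_rep_def)
      then show "C = D" using xy rep(4) component_eq_iff by metis
    qed
    show "Min ` components {1..m} F = rep ` {1..m}"
      by (simp add: components_def component_rep_def image_image)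
  qed
  then have "card (rep ` {1..m}) = card (components {1..m} F)"
    using bij_betw_same_card by metis
  then show ?thesis
    using card_components_F canonical_core_is_core by (simp add: small_cores_def verts_U)
qed

section \<open>Lifts with a given tuple of displays as isomorphisms\<close>

text \<open>An isomorphism from the canonical core to \<open>\<Omega>\<close> names the component of each host vertex by a
  vertex of \<open>\<Omega>\<close>; the choice of survivors is forced by the tuple of displays.\<close>

lemma iso_gives_lift:
  assumes core: "is_core k n T \<Omega>" and g: "core_iso k g \<Omega>\<^sub>0 \<Omega>"
  defines "f \<equiv> \<lambda>x\<in>{1..m}. g (rep x)" and "\<theta> \<equiv> \<lambda>C\<in>P\<^sub>0. class_survivor \<delta> C"
  shows "(f, \<theta>) \<in> lifts k n m \<Omega> U" and "lift_display k n m \<Omega> (f, \<theta>) = \<delta>"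
proof -
  let ?Q = "quotient_graph rep U" and ?H = "underlying \<Omega>"
  have P: "mark_partition \<Omega> = P\<^sub>0" using g by (simp add: core_iso_def)
  have gi: "graph_iso g ?Q ?H" using g by (simp add: core_iso_def)
  have gp: "proj \<Omega> a (g (rep x)) = label (\<delta> a) x" if "a \<in> {1..k}" "x \<in> {1..m}" for a x
    using g that label_rep by (simp add: core_iso_def verts_U)
  have gpl: "g (rep (class_survivor \<delta> C)) = place \<Omega> C" if "C \<in> P\<^sub>0" for C
    using g that by (simp add: core_iso_def)
  have cl: "class_of P\<^sub>0 a j \<in> P\<^sub>0" if "a \<in> {1..k}" "j \<in> {1..n}" for a j
    using class_of_in(1)[OF partition_survivor_partition] that by blast
  have \<theta>cl: "\<theta> (class_of P\<^sub>0 a j) = survivor (\<delta> a) j" if "a \<in> {1..k}" "j \<in> {1..n}" for a j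
    using cl[OF that] class_survivor_class_of[OF that] by (simp add: \<theta>_def)
  have sH0: "simple_graph ?Q" using simple_quotient[OF simple_U] .
  have b: "bij_betw g (verts ?Q) (verts ?H)" using gi by (simp add: graph_iso_def)
  have "contracts_onto g ?Q ?H"
    unfolding contracts_onto_iff
  proof
    show "connected_fibers g ?Q"
      unfolding connected_fibers_def
    proof
      fix y assume "y \<in> g ` verts ?Q"
      then obtain x where x: "x \<in> verts ?Q" "y = g x" by blast
      then have "fiber g (verts ?Q) y = {x}"
        using b by (auto simp: fiber_def bij_betw_def inj_on_def)
      then show "connected_graph (induced ?Q (fiber g (verts ?Q) y))"
        by (simp add: connected_graph_def)
    qed
    have "card (g ` e) = 2" if "e \<in> edges ?Q" for e
    proof -
      have "inj_on g e"
        using b simple_edges_subset[OF sH0 that] by (auto simp: bij_betw_def intro: inj_on_subset)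
      then show ?thesis using card_image simple_card_edge[OF sH0 that] by metis
    qed
    then have "edges (quotient_graph g ?Q) = (`) g ` edges ?Q"
      unfolding edges_quotient by auto
    then have "edges (quotient_graph g ?Q) = edges ?H" using gi by (simp add: graph_iso_def)
    moreover have "verts (quotient_graph g ?Q) = verts ?H" using b by (simp add: bij_betw_def)
    ultimately show "quotient_graph g ?Q = ?H" by (simp add: graph.expand)
  qed
  then have "contracts_onto (g \<circ> rep) U ?H"
    using contracts_onto_comp[OF simple_U _, of rep ?Q g ?H] connected_fibers_rep
    by (simp add: contracts_onto_iff)
  then have cf: "contracts_onto f U ?H"
    by (subst contracts_onto_cong[OF simple_U, of _ "g \<circ> rep"]) (simp_all add: f_def verts_U)
  have "f \<in> {1..m} \<rightarrow>\<^sub>E verts ?H"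
    using b by (auto simp: f_def bij_betw_def verts_U)
  moreover have "\<theta> \<in> P\<^sub>0 \<rightarrow>\<^sub>E {1..m}" unfolding \<theta>_def using class_survivor_mem by auto
  moreover have "inj_on \<theta> P\<^sub>0"
  proof (rule inj_onI)
    fix C D assume C: "C \<in> P\<^sub>0" and D: "D \<in> P\<^sub>0" and eq: "\<theta> C = \<theta> D"
    obtain a j where aj: "a \<in> {1..k}" "j \<in> {1..n}" "C = class_of P\<^sub>0 a j"
      using class_cases[OF partition_survivor_partition C] .
    obtain a' j' where aj': "a' \<in> {1..k}" "j' \<in> {1..n}" "D = class_of P\<^sub>0 a' j'"
      using class_cases[OF partition_survivor_partition D] .
    show "C = D" using eq \<theta>cl class_of_survivor_eq_iff aj aj' by metis
  qed
  moreover have "f (\<theta> C) = place \<Omega> C" if "C \<in> P\<^sub>0" for C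
    using class_survivor_mem[OF that] gpl[OF that] that by (simp add: f_def \<theta>_def)
  moreover have "strict_mono_on {1..n} (\<lambda>j. \<theta> (class_of P\<^sub>0 a j))" if a: "a \<in> {1..k}" for a
    using survivor_mono[OF a] \<theta>cl[OF a] by (simp add: strict_mono_on_def)
  ultimately show "(f, \<theta>) \<in> lifts k n m \<Omega> U"
    using cf by (simp add: lifts_def lift_maps_def P)
  show "lift_display k n m \<Omega> (f, \<theta>) = \<delta>"
  proof (rule extensionalityI[of _ "{1..k}"])
    show "lift_display k n m \<Omega> (f, \<theta>) \<in> extensional {1..k}" by (simp add: lift_display_def)
    show "\<delta> \<in> extensional {1..k}" using \<delta> by (auto simp: display_tuples_def PiE_def)
    fix a assume a: "a \<in> {1..k}"
    have "(\<lambda>j. \<theta> (class_of P\<^sub>0 a j)) ` {1..n} = fst (\<delta> a)"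
      unfolding fst_display[OF a] using \<theta>cl[OF a] by (intro image_cong) auto
    moreover have "(\<lambda>x\<in>{1..m}. \<theta> (class_of P\<^sub>0 a (proj \<Omega> a (f x)))) = snd (\<delta> a)"
    proof (rule extensionalityI[of _ "{1..m}"])
      show "snd (\<delta> a) \<in> extensional {1..m}" using display(5)[OF a] by (simp add: PiE_def)
      fix x assume x: "x \<in> {1..m}"
      show "(\<lambda>x\<in>{1..m}. \<theta> (class_of P\<^sub>0 a (proj \<Omega> a (f x)))) x = snd (\<delta> a) x"
        using x gp[OF a x] \<theta>cl[OF a label_in[OF a x]] survivor_label[OF a x] by (simp add: f_def)
    qed simp
    ultimately show "lift_display k n m \<Omega> (f, \<theta>) a = \<delta> a"
      using a by (simp add: lift_display_def P prod_eq_iff)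
  qed
qed

text \<open>Conversely, the blocks of a lift are exactly the components of the common contraction. A block
  is connected, and an edge inside it has equal labels at both ends in all displays; an edge between
  two blocks lies over an edge of \<open>\<Omega>\<close>, whose ends some projection separates. Hence the block map
  is, on representatives, an isomorphism from the canonical core.\<close>

lemma lift_gives_iso:
  assumes core: "is_core k n T \<Omega>" and l: "(f, \<theta>) \<in> lifts k n m \<Omega> U"
    and d: "lift_display k n m \<Omega> (f, \<theta>) = \<delta>"
  shows "core_iso k f \<Omega>\<^sub>0 \<Omega>"
    and "mark_partition \<Omega> = P\<^sub>0"
    and "\<And>x. x \<in> {1..m} \<Longrightarrow> f (rep x) = f x"
    and "\<And>C. C \<in> P\<^sub>0 \<Longrightarrow> \<theta> C = class_survivor \<delta> C"
proof -
  let ?Q = "quotient_graph rep U" and ?H = "underlying \<Omega>" and ?P = "mark_partition \<Omega>"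
  note co = is_coreD[OF core] and li = liftsD[OF l]
  have sv: "survivor (\<delta> a) j = \<theta> (class_of ?P a j)" if "a \<in> {1..k}" "j \<in> {1..n}" for a j
    using survivor_lift[OF core U l that] d by simp
  have lab: "label (\<delta> a) x = proj \<Omega> a (f x)" if "a \<in> {1..k}" "x \<in> {1..m}" for a x
    using label_lift[OF core U l that] d by simp
  have cl: "class_of ?P a j \<in> ?P" if "a \<in> {1..k}" "j \<in> {1..n}" for a j
    using class_of_in(1)[OF co(5)] that by blast
  show P: "?P = P\<^sub>0"
  proof (rule partition_eq_of_class_of[OF co(5) partition_survivor_partition])
    fix a j b l' assume aj: "a \<in> {1..k}" "j \<in> {1..n}" and bl: "b \<in> {1..k}" "l' \<in> {1..n}"
    have "class_of ?P a j = class_of ?P b l' \<longleftrightarrow> survivor (\<delta> a) j = survivor (\<delta> b) l'"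
      using sv[OF aj] sv[OF bl] inj_on_eq_iff[OF li(4) cl[OF aj] cl[OF bl]] by simp
    then show "class_of ?P a j = class_of ?P b l' \<longleftrightarrow> class_of P\<^sub>0 a j = class_of P\<^sub>0 b l'"
      using class_of_survivor_eq_iff[OF aj bl] by blast
  qed
  show \<theta>: "\<theta> C = class_survivor \<delta> C" if C: "C \<in> P\<^sub>0" for C
  proof -
    obtain a j where aj: "a \<in> {1..k}" "j \<in> {1..n}" "C = class_of P\<^sub>0 a j"
      using class_cases[OF partition_survivor_partition C] .
    then show ?thesis using sv[OF aj(1,2)] class_survivor_class_of[OF aj(1,2)] P by simp
  qed
  have Q: "quotient_graph f U = ?H" and cf: "connected_fibers f U"
    using li(2) by (auto simp: contracts_onto_iff)
  have vH: "verts ?H = f ` {1..m}" using Q verts_U verts_quotient by metis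
  \<comment> \<open>the contracted edges are those inside the blocks of the lift\<close>
  have F_iff: "{x, y} \<in> F \<longleftrightarrow> {x, y} \<in> edges U \<and> f x = f y" for x y
  proof -
    have "f x = f y \<longleftrightarrow> (\<forall>a\<in>{1..k}. label (\<delta> a) x = label (\<delta> a) y)" if e: "{x, y} \<in> edges U"
    proof -
      have V: "x \<in> {1..m}" "y \<in> {1..m}" using simple_edgeD[OF simple_U e] verts_U by auto
      have "\<exists>a\<in>{1..k}. proj \<Omega> a (f x) \<noteq> proj \<Omega> a (f y)" if "f x \<noteq> f y"
      proof -
        have "{f x, f y} \<in> edges ?H" using that e quotient_edge_iff[OF simple_U, of "f x" "f y" f] Q by auto
        then show ?thesis by (rule co(4))
      qed
      then show ?thesis using lab V by auto
    qed
    then show ?thesis using common_edge_iff by blast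
  qed
  have reach: "f x = f y \<longleftrightarrow> (x, y) \<in> (adj F)\<^sup>*" if x: "x \<in> {1..m}" and y: "y \<in> {1..m}" for x y
  proof
    assume eq: "f x = f y"
    have "connected_graph (induced U (fiber f {1..m} (f x)))"
      using cf x verts_U by (auto simp: connected_fibers_def)
    then have "(x, y) \<in> (adj {e \<in> edges U. e \<subseteq> fiber f {1..m} (f x)})\<^sup>*"
      using x y eq by (auto simp: connected_graph_def fiber_def)
    moreover have "adj {e \<in> edges U. e \<subseteq> fiber f {1..m} (f x)} \<subseteq> adj F"
      using F_iff by (auto simp: fiber_def)
    ultimately show "(x, y) \<in> (adj F)\<^sup>*" using rtrancl_mono by blast
  next
    show "(x, y) \<in> (adj F)\<^sup>* \<Longrightarrow> f x = f y"
      by (rule constant_on_reach[of F]) (use F_iff in auto)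
  qed
  show frep: "f (rep x) = f x" if x: "x \<in> {1..m}" for x
    using reach[OF x rep(1)[OF x]] rep(2)[OF x] by simp
  have "bij_betw f (rep ` {1..m}) (verts ?H)"
  proof (rule bij_betw_imageI)
    show "inj_on f (rep ` {1..m})"
    proof (rule inj_onI)
      fix u v assume "u \<in> rep ` {1..m}" "v \<in> rep ` {1..m}" and eq: "f u = f v"
      then obtain x y where xy: "x \<in> {1..m}" "y \<in> {1..m}" "u = rep x" "v = rep y" by blast
      then have "f x = f y" using eq frep by simp
      then show "u = v" using reach[OF xy(1,2)] rep(4)[OF xy(1,2)] xy by simp
    qed
    show "f ` rep ` {1..m} = verts ?H"
      unfolding vH image_image using frep by (intro image_cong) auto
  qed
  moreover have "(`) f ` edges ?Q = edges ?H"
  proof -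
    have fr: "f ` rep ` e = f ` e" if "e \<in> edges U" for e
    proof -
      have "e \<subseteq> {1..m}" using simple_edges_subset[OF simple_U that] verts_U by simp
      then show ?thesis unfolding image_image using frep by (intro image_cong) auto
    qed
    have c2: "card (rep ` e) = 2 \<longleftrightarrow> card (f ` e) = 2" if e: "e \<in> edges U" for e
    proof -
      obtain x y where xy: "e = {x, y}" using simple_edgeE[OF simple_U e] by blast
      have V: "x \<in> {1..m}" "y \<in> {1..m}" using simple_edgeD[OF simple_U e[unfolded xy]] verts_U by auto
      have "rep x = rep y \<longleftrightarrow> f x = f y" using reach[OF V] rep(4)[OF V] by simp
      then show ?thesis by (simp add: xy card_insert_if)
    qed
    have "(`) f ` edges ?Q = {f ` rep ` e | e. e \<in> edges U \<and> card (rep ` e) = 2}"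
      unfolding edges_quotient by blast
    also have "\<dots> = {f ` e | e. e \<in> edges U \<and> card (f ` e) = 2}"
    proof (intro Collect_cong ex_cong1)
      fix h e
      show "(h = f ` rep ` e \<and> e \<in> edges U \<and> card (rep ` e) = 2) \<longleftrightarrow>
          (h = f ` e \<and> e \<in> edges U \<and> card (f ` e) = 2)"
        using fr[of e] c2[of e] by (cases "e \<in> edges U") simp_all
    qed
    also have "\<dots> = edges ?H" unfolding Q[symmetric] edges_quotient ..
    finally show ?thesis .
  qed
  moreover have "proj \<Omega> a (f v) = proj \<Omega>\<^sub>0 a v" if a: "a \<in> {1..k}" and v: "v \<in> rep ` {1..m}" for a v
  proof -
    have "v \<in> {1..m}" using v rep(1) by blast
    then show ?thesis using lab[OF a] a v by simp
  qed
  moreover have "f (place \<Omega>\<^sub>0 C) = place \<Omega> C" if C: "C \<in> P\<^sub>0" for C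
    using frep[OF class_survivor_mem[OF C]] li(5)[of C] P C \<theta>[OF C] by simp
  ultimately show "core_iso k f \<Omega>\<^sub>0 \<Omega>"
    by (simp add: core_iso_def graph_iso_def P verts_U)
qed

text \<open>The lifts that give a fixed tuple of displays correspond to isomorphisms from its canonical core. The
  inverse direction restricts the block map to the representatives, which lie in their own blocks.\<close>

theorem card_lifts_of_tuple:
  assumes core: "is_core k n T \<Omega>"
  shows "card {p \<in> lifts k n m \<Omega> U. lift_display k n m \<Omega> p = \<delta>} = card (core_isos k \<Omega>\<^sub>0 \<Omega>)"
proof -
  let ?L = "{p \<in> lifts k n m \<Omega> U. lift_display k n m \<Omega> p = \<delta>}"
  let ?Vc = "verts (underlying \<Omega>\<^sub>0)"
  have V0: "?Vc = rep ` {1..m}" by (simp add: verts_U)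
  have rep_V0: "rep v = v" "v \<in> {1..m}" if "v \<in> ?Vc" for v
    using that rep(1,3) unfolding V0 by auto
  have "bij_betw (\<lambda>g. (\<lambda>x\<in>{1..m}. g (rep x), \<lambda>C\<in>P\<^sub>0. class_survivor \<delta> C)) (core_isos k \<Omega>\<^sub>0 \<Omega>) ?L"
  proof (rule bij_betw_byWitness[where f' = "\<lambda>p. \<lambda>v\<in>?Vc. fst p v"])
    show "\<forall>g\<in>core_isos k \<Omega>\<^sub>0 \<Omega>.
        (\<lambda>v\<in>?Vc. fst (\<lambda>x\<in>{1..m}. g (rep x), \<lambda>C\<in>P\<^sub>0. class_survivor \<delta> C) v) = g"
    proof
      fix g assume "g \<in> core_isos k \<Omega>\<^sub>0 \<Omega>"
      then have "g \<in> extensional ?Vc" by (simp add: core_isos_def)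
      then show "(\<lambda>v\<in>?Vc. fst (\<lambda>x\<in>{1..m}. g (rep x), \<lambda>C\<in>P\<^sub>0. class_survivor \<delta> C) v) = g"
      proof (intro extensionalityI[of _ ?Vc])
        fix v assume v: "v \<in> ?Vc"
        show "(\<lambda>v\<in>?Vc. fst (\<lambda>x\<in>{1..m}. g (rep x), \<lambda>C\<in>P\<^sub>0. class_survivor \<delta> C) v) v = g v"
          unfolding restrict_apply'[OF v] fst_conv restrict_apply'[OF rep_V0(2)[OF v]] rep_V0(1)[OF v] ..
      qed (simp_all only: restrict_extensional)
    qed
    show "\<forall>p\<in>?L. (\<lambda>x\<in>{1..m}. (\<lambda>v\<in>?Vc. fst p v) (rep x), \<lambda>C\<in>P\<^sub>0. class_survivor \<delta> C) = p"
    proof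
      fix p assume p: "p \<in> ?L"
      obtain f \<theta> where ft: "p = (f, \<theta>)" by force
      then have l: "(f, \<theta>) \<in> lifts k n m \<Omega> U" and d: "lift_display k n m \<Omega> (f, \<theta>) = \<delta>" using p by auto
      note gi = lift_gives_iso[OF core l d]
      have "(\<lambda>x\<in>{1..m}. (\<lambda>v\<in>?Vc. f v) (rep x)) = f"
        using liftsD(1)[OF l] gi(3) unfolding V0
        by (intro extensionalityI[of _ "{1..m}"]) (simp_all add: PiE_def)
      moreover have "(\<lambda>C\<in>P\<^sub>0. class_survivor \<delta> C) = \<theta>"
        using liftsD(3)[OF l] gi(2,4)
        by (intro extensionalityI[of _ P\<^sub>0]) (auto simp: PiE_def)
      ultimately show "(\<lambda>x\<in>{1..m}. (\<lambda>v\<in>?Vc. fst p v) (rep x), \<lambda>C\<in>P\<^sub>0. class_survivor \<delta> C) = p"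
        by (simp add: ft)
    qed
    show "(\<lambda>g. (\<lambda>x\<in>{1..m}. g (rep x), \<lambda>C\<in>P\<^sub>0. class_survivor \<delta> C)) ` core_isos k \<Omega>\<^sub>0 \<Omega> \<subseteq> ?L"
      using iso_gives_lift[OF core] by (auto simp: core_isos_def)
    show "(\<lambda>p. \<lambda>v\<in>?Vc. fst p v) ` ?L \<subseteq> core_isos k \<Omega>\<^sub>0 \<Omega>"
    proof (rule image_subsetI)
      fix p assume p: "p \<in> ?L"
      obtain f \<theta> where ft: "p = (f, \<theta>)" by force
      then have "core_iso k f \<Omega>\<^sub>0 \<Omega>" using p lift_gives_iso(1)[OF core] by blast
      then have "core_iso k (\<lambda>v\<in>?Vc. f v) \<Omega>\<^sub>0 \<Omega>"
        by (rule core_iso_cong[OF is_core_regular[OF canonical_core_is_core], rotated]) simp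
      then show "(\<lambda>v\<in>?Vc. fst p v) \<in> core_isos k \<Omega>\<^sub>0 \<Omega>" by (simp add: core_isos_def ft)
    qed
  qed
  then show ?thesis by (rule bij_betw_same_card[symmetric])
qed

end

section \<open>Summing over isomorphism classes\<close>

lemma finite_lifts:
  assumes "is_core k n T \<Omega>"
  shows "finite (lifts k n m \<Omega> U)"
proof -
  note co = is_coreD[OF assms]
  have "finite (mark_partition \<Omega>)" using finite_elements[OF _ co(5)] by simp
  moreover have "finite (verts (underlying \<Omega>))" using co(1) by (simp add: is_tree_def simple_graph_def)
  ultimately show ?thesis
    unfolding lifts_def by (intro finite_SigmaI finite_lift_maps) (auto simp: finite_PiE)
qed

text \<open>A tuple of displays whose canonical core lies in the class of \<open>\<Omega>\<close> comes from as many lifts of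
  \<open>\<Omega>\<close> as \<open>\<Omega>\<close> has automorphisms, and any other tuple comes from none. So the quotient counts the tuples in the class.\<close>

lemma L_rig_of_class:
  assumes T: "T \<in> labeled_trees n" and X: "X \<in> core_classes k n T" and \<Omega>: "\<Omega> \<in> X"
  shows "L_rig k n m \<Omega> / real (card (core_aut k \<Omega>)) =
    (\<Sum>(U, \<delta>)\<in>(SIGMA U : labeled_trees m. display_tuples k n m T U).
       if canonical_core k n m U \<delta> \<in> X then 1 else 0)"
proof -
  obtain \<Omega>' where "\<Omega>' \<in> small_cores k n T" "X = isomorphic_cores k n T `` {\<Omega>'}"
    using X by (auto simp: core_classes_def elim: quotientE)
  then have X_eq: "X = isomorphic_cores k n T `` {\<Omega>}" and sm: "\<Omega> \<in> small_cores k n T"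
    using \<Omega> equiv_class_eq[OF equiv_isomorphic_cores] by (auto simp: isomorphic_cores_def)
  have core: "is_core k n T \<Omega>" using sm by (simp add: small_cores_def)
  note co = is_coreD[OF core]
  let ?D = "\<lambda>U. display_tuples k n m T U" and ?c = "\<lambda>U \<delta>. canonical_core k n m U \<delta>"
  have pos: "card (core_aut k \<Omega>) > 0" using card_core_aut_pos is_core_regular[OF core] by blast
  have cnt: "card {p \<in> lifts k n m \<Omega> U. lift_display k n m \<Omega> p = \<delta>} =
      (if ?c U \<delta> \<in> X then card (core_aut k \<Omega>) else 0)"
    if U: "U \<in> labeled_trees m" and \<delta>: "\<delta> \<in> ?D U" for U \<delta>
  proof -
    interpret display_tuple k n m T U \<delta> using T U \<delta> by unfold_locales
    show ?thesis
    proof (cases "?c U \<delta> \<in> X")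
      case True
      then obtain h where "core_iso k h \<Omega> (?c U \<delta>)" by (auto simp: X_eq isomorphic_cores_def)
      then have "core_iso k (inv_into (verts (underlying \<Omega>)) h) (?c U \<delta>) \<Omega>"
        by (rule core_iso_inv[OF is_core_regular[OF core]])
      then show ?thesis
        using True card_lifts_of_tuple[OF core]
          card_core_isos[OF is_core_regular[OF canonical_core_is_core] is_core_regular[OF core]]
        by simp
    next
      case False
      have "core_isos k (?c U \<delta>) \<Omega> = {}"
      proof (rule equals0I)
        fix g assume "g \<in> core_isos k (?c U \<delta>) \<Omega>"
        then have "core_iso k g (?c U \<delta>) \<Omega>" by (simp add: core_isos_def)
        then have "core_iso k (inv_into (verts (underlying (?c U \<delta>))) g) \<Omega> (?c U \<delta>)"
          by (rule core_iso_inv[OF is_core_regular[OF canonical_core_is_core]])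
        then have "(\<Omega>, ?c U \<delta>) \<in> isomorphic_cores k n T"
          using sm canonical_core_small unfolding isomorphic_cores_def by blast
        then show False using False X_eq by blast
      qed
      then show ?thesis using False card_lifts_of_tuple[OF core] by simp
    qed
  qed
  have lifts: "card (lifts k n m \<Omega> U) = (\<Sum>\<delta>\<in>?D U. if ?c U \<delta> \<in> X then card (core_aut k \<Omega>) else 0)"
    if U: "U \<in> labeled_trees m" for U
  proof -
    have "lift_display k n m \<Omega> p \<in> ?D U" if "p \<in> lifts k n m \<Omega> U" for p
      using lift_display_tuple[OF core U] that by (cases p) simp
    \<comment> \<open>every lift gives exactly one tuple of displays, so the lifts are grouped by it\<close>
    then have "(\<Sum>\<delta>\<in>?D U. \<Sum>p | p \<in> lifts k n m \<Omega> U \<and> lift_display k n m \<Omega> p = \<delta>. 1) =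
        (\<Sum>p\<in>lifts k n m \<Omega> U. 1 :: nat)"
      by (intro sum.group finite_lifts[OF core] finite_display_tuples) auto
    then have "card (lifts k n m \<Omega> U) =
        (\<Sum>\<delta>\<in>?D U. card {p \<in> lifts k n m \<Omega> U. lift_display k n m \<Omega> p = \<delta>})" by simp
    then show ?thesis using cnt[OF U] by simp
  qed
  have "L_rig k n m \<Omega> = (\<Sum>U\<in>labeled_trees m. real (card (lifts k n m \<Omega> U)))"
  proof (rule L_rig_eq_card_lifts)
    show "finite (mark_partition \<Omega>)" using finite_elements[OF _ co(5)] by simp
    show "place \<Omega> \<in> mark_partition \<Omega> \<rightarrow> verts (underlying \<Omega>)" using co(6) by auto
  qed (rule co(1))
  also have "\<dots> = (\<Sum>U\<in>labeled_trees m. \<Sum>\<delta>\<in>?D U.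
      real (card (core_aut k \<Omega>)) * (if ?c U \<delta> \<in> X then 1 else 0))"
    using lifts by (intro sum.cong refl) (simp add: if_distrib cong: if_cong sum.cong)
  also have "\<dots> = real (card (core_aut k \<Omega>)) *
      (\<Sum>U\<in>labeled_trees m. \<Sum>\<delta>\<in>?D U. if ?c U \<delta> \<in> X then 1 else 0)"
    by (simp only: sum_distrib_left)
  also have "(\<Sum>U\<in>labeled_trees m. \<Sum>\<delta>\<in>?D U. if ?c U \<delta> \<in> X then 1 else 0) =
      (\<Sum>(U, \<delta>)\<in>(SIGMA U : labeled_trees m. ?D U). if ?c U \<delta> \<in> X then 1 else (0::real))"
    by (rule sum.Sigma[OF finite_labeled_trees]) (simp add: finite_display_tuples)
  finally show ?thesis using pos by simp
qed

theorem theorem1p4: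
  fixes T :: "nat graph" and n k :: nat
  assumes "T \<in> labeled_trees n" and "k \<ge> 1"
  shows "(\<forall>m. \<forall>U \<in> labeled_trees m. \<forall>\<delta> \<in> display_tuples k n m T U.
            is_tree (contract_edges U (common_block_edges k U \<delta>)) \<and>
            card (verts (contract_edges U (common_block_edges k U \<delta>))) \<le> k * (n - 1) + 1)
       \<and> finite (core_classes k n T)
       \<and> (\<forall>m. card (SIGMA U : labeled_trees m. display_tuples k n m T U) = fact k * Ck k n T m \<and>
            (\<forall>rep. (\<forall>X \<in> core_classes k n T. rep X \<in> X) \<longrightarrow>
               real (fact k * Ck k n T m) =
                 (\<Sum>X \<in> core_classes k n T. L_rig k n m (rep X) / real (card (core_aut k (rep X))))))"
proof (intro conjI allI ballI impI)
  fix m U \<delta> assume "U \<in> labeled_trees m" "\<delta> \<in> display_tuples k n m T U"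
  then interpret display_tuple k n m T U \<delta> using assms(1) by unfold_locales
  show "is_tree (contract_edges U (common_block_edges k U \<delta>))"
    and "card (verts (contract_edges U (common_block_edges k U \<delta>))) \<le> k * (n - 1) + 1"
    by (rule contract_common_tree)+
next
  show "finite (core_classes k n T)" by (rule finite_core_classes)
next
  fix m
  let ?X = "SIGMA U : labeled_trees m. display_tuples k n m T U"
  show card_X: "card ?X = fact k * Ck k n T m" by (rule card_all_display_tuples)
  fix rep :: "nat core set \<Rightarrow> nat core"
  assume rep: "\<forall>X \<in> core_classes k n T. rep X \<in> X"
  \<comment> \<open>every small core lies in exactly one class\<close>
  have one: "(\<Sum>X\<in>core_classes k n T. if \<Omega> \<in> X then 1 else (0::real)) = 1"
    if \<Omega>: "\<Omega> \<in> small_cores k n T" for \<Omega>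
  proof -
    let ?C = "isomorphic_cores k n T `` {\<Omega>}"
    have "\<Omega> \<in> X \<longleftrightarrow> X = ?C" if X: "X \<in> core_classes k n T" for X
    proof
      assume "\<Omega> \<in> X"
      moreover obtain \<Omega>' where "X = isomorphic_cores k n T `` {\<Omega>'}"
        using X unfolding core_classes_def by (auto elim: quotientE)
      ultimately show "X = ?C" using equiv_class_eq[OF equiv_isomorphic_cores] by blast
    next
      assume "X = ?C"
      then show "\<Omega> \<in> X" using equiv_class_self[OF equiv_isomorphic_cores \<Omega>] by blast
    qed
    moreover have "?C \<in> core_classes k n T" unfolding core_classes_def using \<Omega> by (rule quotientI)
    ultimately have "(\<Sum>X\<in>core_classes k n T. if \<Omega> \<in> X then 1 else (0::real)) =
        (\<Sum>X\<in>core_classes k n T. if X = ?C then 1 else 0)" by (intro sum.cong) auto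
    also have "\<dots> = 1" using \<open>?C \<in> core_classes k n T\<close> finite_core_classes[of k n T] by simp
    finally show ?thesis .
  qed
  have "(\<Sum>X\<in>core_classes k n T. L_rig k n m (rep X) / real (card (core_aut k (rep X)))) =
      (\<Sum>X\<in>core_classes k n T. \<Sum>(U, \<delta>)\<in>?X. if canonical_core k n m U \<delta> \<in> X then 1 else 0)"
    using L_rig_of_class[OF assms(1)] rep by (intro sum.cong) auto
  also have "\<dots> = (\<Sum>(U, \<delta>)\<in>?X. \<Sum>X\<in>core_classes k n T. if canonical_core k n m U \<delta> \<in> X then 1 else 0)"
    unfolding case_prod_beta by (rule sum.swap)
  also have "\<dots> = (\<Sum>(U, \<delta>)\<in>?X. 1)"
  proof (intro sum.cong refl, clarify)
    fix U \<delta> assume "U \<in> labeled_trees m" "\<delta> \<in> display_tuples k n m T U"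
    then interpret display_tuple k n m T U \<delta> using assms(1) by unfold_locales
    show "(\<Sum>X\<in>core_classes k n T. if canonical_core k n m U \<delta> \<in> X then 1 else (0::real)) = 1"
      by (rule one[OF canonical_core_small])
  qed
  also have "\<dots> = real (fact k * Ck k n T m)" by (simp add: card_X case_prod_beta)
  finally show "real (fact k * Ck k n T m) =
      (\<Sum>X\<in>core_classes k n T. L_rig k n m (rep X) / real (card (core_aut k (rep X))))" by simp
qed

end
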